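(* The family of maps $\alpha_X:\mathsf{SF}\left(\binom{X_{\rm in}}{X_{\rm out}},d_X\right)\to\mathsf{Mealy}\left(\binom{X_{\rm in}}{X_{\rm out}},d_X\right)$, sending an open stock-flow diagram $(F,\varphi)$ to the Mealy machine $(F(\text{stock}),u(F,\varphi),r(F,\varphi))$, indexed by the objects of $\mathsf{dDWD}$, is a monoidal natural transformation $\alpha:\mathsf{SF}\Rightarrow\mathsf{Mealy}$ between the lax monoidal functors $\mathsf{SF},\mathsf{Mealy}:\left(\mathsf{dDWD},+,\left(\tbinom00,!\right)\right)\to(\mathsf{Set},\times,1)$.
   Context: **Maps induced by functions and spans.** For a finite set $A$, an element of $\mathbb{R}^A$ is a function $A\to\mathbb{R}$. For $f:A\to B$ a map of finite sets, $f^*:\mathbb{R}^B\to\mathbb{R}^A$ is $f^*(x)=x\circ f$ and $f_*:\mathbb{R}^A\to\mathbb{R}^B$ is $f_*(x)(b)=\sum_{a\in f^{-1}(b)}x(a)$. For a span of finite sets $A\xleftarrow{s}R\xrightarrow{t}B$ write $R^*:=t_*\circ s^*:\mathbb{R}^A\to\mathbb{R}^B$. A function $\phi:\mathbb{R}^A\to\mathbb{R}^B$ respects the span (or relation) $A\xleftarrow{s}R\xrightarrow{t}B$ if for every $b\in B$ and $x\in\mathbb{R}^A$, the value $\phi(x)(b)$ depends only on the restriction of $x$ to $s(t^{-1}(b))\subseteq A$. **Directed wiring diagrams.** $\mathsf{DWD}$ is the symmetric monoidal category whose objects are pairs $\binom{X_{\rm in}}{X_{\rm out}}$ of finite sets (input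 ports, output ports), and whose morphisms $f:\binom{X_{\rm in}}{X_{\rm out}}\to\binom{Y_{\rm in}}{Y_{\rm out}}$ are triples of spans of finite sets $$Y_{\rm in}\xleftarrow{s}f(W_{\rm in})\xrightarrow{t}X_{\rm in},\qquad X_{\rm out}\xleftarrow{s}f(W)\xrightarrow{t}X_{\rm in},\qquad X_{\rm out}\xleftarrow{s}f(W_{\rm out})\xrightarrow{t}Y_{\rm out},$$ considered up to isomorphism of spans (input, trace and output wires). The composite of $f$ with $g:\binom{Y_{\rm in}}{Y_{\rm out}}\to\binom{Z_{\rm in}}{Z_{\rm out}}$ is $(g\circ f)(W_{\rm in})=g(W_{\rm in})\times_{Y_{\rm in}}f(W_{\rm in})$, $(g\circ f)(W)=f(W)+f(W_{\rm out})\times_{Y_{\rm out}}g(W)\times_{Y_{\rm in}}f(W_{\rm in})$, $(g\circ f)(W_{\rm out})=g(W_{\rm out})\times_{Y_{\rm out}}f(W_{\rm out})$, with the evident source and target maps. The identity has $W_{\rm in}=X_{\rm in}$, $W=\emptyset$, $W_{\rm out}=X_{\rm out}$. The monoidal product $+$ is disjoint union of ports and of wires, with unit $\binom{0}{0}$. **Dependencies.** A dependency $d_X$ on $\binom{X_{\rm in}}{X_{\rm out}}$ is a relation between $X_{\rm in}$ and $X_{\rm out}$, viewed as a span $X_{\rm in}\xleftarrow{s}d_X\xrightarrow{t}X_{\rm out}$; dependencies are ordered by inclusion. For $f:\binom{X_{\rm in}}{X_{\rm out}}\to\binom{Y_{\rm in}}{Y_{\rm out}}$, put $X=X_{\rm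 in}+X_{\rm out}$ and let $f(W)+_Xd_X$ be the directed graph with vertex set $X$ and edge set $f(W)+d_X$ (each element directed from its source to its target). For a directed graph $G$, $\mathsf{Path}(G)$ is the set of directed paths in $G$, including the trivial path at each vertex, with its source and target maps to the vertices. $R(f)(d_X)$ is the relation between $Y_{\rm in}$ and $Y_{\rm out}$ that is the image of the span $Y_{\rm in}\leftarrow f(W_{\rm in})\times_X\mathsf{Path}(f(W)+_Xd_X)\times_Xf(W_{\rm out})\to Y_{\rm out}$. **The category $\mathsf{dDWD}$.** Objects are pairs $\left(\binom{X_{\rm in}}{X_{\rm out}},d_X\right)$ with $d_X$ a dependency. Morphisms $\left(\binom{X_{\rm in}}{X_{\rm out}},d_X\right)\to\left(\binom{Y_{\rm in}}{Y_{\rm out}},d_Y\right)$ are morphisms $f$ of $\mathsf{DWD}$ with $R(f)(d_X)\subseteq d_Y$ and such that $f(W)+_Xd_X$ is acyclic. Composition is as in $\mathsf{DWD}$; the monoidal product is $+$ on ports, wires and dependencies (disjoint union), with unit $\left(\binom00,!\right)$, where $!$ is the unique (empty) dependency. **The functor $\mathsf{Mealy}$.** $\mathsf{Mealy}\left(\binom{X_{\rm in}}{X_{\rm out}},d_X\right)$ is the set of triples $(S,\ u:\mathbb{R}^{X_{\rm in}}\times\mathbb{R}^S\to\mathbb{R}^S,\ r:\mathbb{R}^{X_{\rm in}}\times\mathbb{R}^S\to\mathbb{R}^{X_{\rm out}})$ where $S$ is a finite set and, for each $x\in\mathbb{R}^S$, $r(-,x)$ respects $d_X$. Triples are considered up to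 bijections of state sets $S\cong S'$ compatible with $u$ and $r$. For $f:\left(\binom{X_{\rm in}}{X_{\rm out}},d_X\right)\to\left(\binom{Y_{\rm in}}{Y_{\rm out}},d_Y\right)$ in $\mathsf{dDWD}$, $a\in\mathbb{R}^{X_{\rm in}}$, $x\in\mathbb{R}^S$, the endomorphism $(x_{\rm in},x_{\rm out})\mapsto(f(W)^*(x_{\rm out})+a,\ r(x_{\rm in},x))$ of $\mathbb{R}^{X_{\rm in}}\times\mathbb{R}^{X_{\rm out}}$ has a unique fixed point because $f$ is acyclic; denote it $(\overline{\phi}^{f,r}_{\rm in}(a,x),\overline{\phi}^{f,r}_{\rm out}(a,x))$. Then $\mathsf{Mealy}(f)(S,u,r)=(S,\mathsf{Mealy}(f)(u),\mathsf{Mealy}(f)(r))$ with $$\mathsf{Mealy}(f)(u)(y,x)=u\big(\overline{\phi}^{f,r}_{\rm in}(f(W_{\rm in})^*(y),x),\,x\big),\qquad \mathsf{Mealy}(f)(r)(y,x)=f(W_{\rm out})^*\big(\overline{\phi}^{f,r}_{\rm out}(f(W_{\rm in})^*(y),x)\big).$$ The laxator sends $((S,u,r),(S',u',r'))$ to $(S+S',u\times u',r\times r')$ (using $\mathbb{R}^{A+B}\cong\mathbb{R}^A\times\mathbb{R}^B$), and the unit map picks out the machine with $S=\emptyset$. **Open stock-flow diagrams.** Let $\mathsf{H_f}$ be the free category on the graph with vertices stock, flow, inflow, outflow, var, sum var, stock link, sum link, stock sum link, var link, in link, out link, in port, out port, and arrows: is: inflow→stock, if: inflow→flow, os: outflow→stock,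 of: outflow→flow, fv: flow→var, and source/target arrows $(s,t)$: stock link→(stock, var), sum link→(sum var, var), stock sum link→(stock, sum var), var link→(var, var), in link→(in port, var), out link→(var, out port). An open stock-flow diagram with interface $\left(\binom{X_{\rm in}}{X_{\rm out}},d_X\right)$ is a pair $(F,\varphi)$ where $F:\mathsf{H_f}\to\mathsf{Set}$ is a functor with finite values such that (1) $F(\text{if})$ and $F(\text{of})$ are injective; (2) the graph with edges $F(\text{var link})$ and vertices $F(\text{var})$ is acyclic; (3) $F(\text{in port})=X_{\rm in}$ and $F(\text{out port})=X_{\rm out}$; (4) $d_X$ contains the relation induced by the span $X_{\rm in}\leftarrow F(\text{in link})\times_{F(\text{var})}\mathsf{Path}(F(\text{var link}))\times_{F(\text{var})}F(\text{out link})\to X_{\rm out}$, where $\mathsf{Path}(F(\text{var link}))$ is the set of paths of the graph in (2); and $\varphi:\mathbb{R}^{F(\text{stock})}\times\mathbb{R}^{F(\text{sum var})}\times\mathbb{R}^{F(\text{var})}\times\mathbb{R}^{F(\text{in port})}\to\mathbb{R}^{F(\text{var})}$ is a function respecting the span $$F(\text{stock})+F(\text{sum var})+F(\text{var})+F(\text{in port})\xleftarrow{s}F(\text{stock link})+F(\text{sum link})+F(\text{var link})+F(\text{in link})\xrightarrow{t}F(\text{var}).$$ Open stock-flow diagrams with a given interface are considered up to isomorphism (natural isomorphism $F\cong F'$ that is the identity on in ports and out ports and is compatible with $\varphi,\varphi'$). **The functor $\mathsf{SF}$.** $\mathsf{SF}\left(\binom{X_{\rm in}}{X_{\rm out}},d_X\right)$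 is the set of open stock-flow diagrams with this interface. For $f:\left(\binom{X_{\rm in}}{X_{\rm out}},d_X\right)\to\left(\binom{Y_{\rm in}}{Y_{\rm out}},d_Y\right)$, $\mathsf{SF}(f)(F,\varphi)=(\mathsf{SF}(f)(F),\mathsf{SF}(f)(\varphi))$ where $\mathsf{SF}(f)(F)$ agrees with $F$ except that $\mathsf{SF}(f)(F)(\text{in port})=Y_{\rm in}$, $\mathsf{SF}(f)(F)(\text{out port})=Y_{\rm out}$, and $$\mathsf{SF}(f)(F)(\text{in link})=f(W_{\rm in})\times_{X_{\rm in}}F(\text{in link}),\quad \mathsf{SF}(f)(F)(\text{out link})=F(\text{out link})\times_{X_{\rm out}}f(W_{\rm out}),$$ $$\mathsf{SF}(f)(F)(\text{var link})=F(\text{var link})+\left(F(\text{out link})\times_{X_{\rm out}}f(W)\times_{X_{\rm in}}F(\text{in link})\right),$$ with the evident composite source and target maps, and $\mathsf{SF}(f)(\varphi)$ sends $(x_{\rm stock},x_{\rm sumvar},x_{\rm var},y_{\rm in})$ to $$\varphi\left(x_{\rm stock},x_{\rm sumvar},x_{\rm var},\ f(W_{\rm in})^*(y_{\rm in})+(f(W)^*\circ F(\text{out link})^* )(x_{\rm var})\right).$$ The laxator sends $((F,\varphi),(F',\varphi'))$ to $(F+F',\varphi\times\varphi')$ (objectwise disjoint union), and the unit map picks out the empty diagram. **The maps $\alpha_X$.** For $(F,\varphi)\in\mathsf{SF}\left(\binom{X_{\rm in}}{X_{\rm out}},d_X\right)$, $a\in\mathbb{R}^{X_{\rm in}}$ and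 $s\in\mathbb{R}^{F(\text{stock})}$, the endomorphism $\varphi(s,F(\text{stock sum link})^*(s),-,a)$ of $\mathbb{R}^{F(\text{var})}$ has a unique fixed point (by acyclicity of $F(\text{var link})$), denoted $\overline{\varphi}(a,s)$. Then $\alpha_X(F,\varphi)$ is the Mealy machine with state set $F(\text{stock})$, readout $r(F,\varphi)=F(\text{out link})^*\circ\overline{\varphi}$, and update $$u(F,\varphi)(a,s)=\big(F(\text{is})_*\circ F(\text{if})^*\circ F(\text{fv})^*\big)(\overline{\varphi}(a,s))-\big(F(\text{os})_*\circ F(\text{of})^*\circ F(\text{fv})^*\big)(\overline{\varphi}(a,s)).$$ *)

theory Defs
  imports Complex_Main "HOL-Library.FuncSet" "Graph_Theory.Arc_Walk"
begin

section \<open>Lax monoidal functors to Set and monoidal natural transformations\<close>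

record ('o, 'm) cat =
  Obj :: "'o set"
  Arr :: "'m set"
  Dom :: "'m \<Rightarrow> 'o"
  Cod :: "'m \<Rightarrow> 'o"
  Ident :: "'o \<Rightarrow> 'm"
  Comp :: "'m \<Rightarrow> 'm \<Rightarrow> 'm"

text \<open>\<open>Comp g f\<close> is the composite of \<open>f\<close> followed by \<open>g\<close>; it is only meaningful
  if \<open>Dom g = Cod f\<close>.\<close>

definition hom :: "('o, 'm, 'z) cat_scheme \<Rightarrow> 'o \<Rightarrow> 'o \<Rightarrow> 'm set" where
  "hom C X Y = {f \<in> Arr C. Dom C f = X \<and> Cod C f = Y}"

definition iso_arrow :: "('o, 'm, 'z) cat_scheme \<Rightarrow> 'm \<Rightarrow> bool" where
  "iso_arrow C f \<longleftrightarrow> f \<in> Arr C \<and>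
     (\<exists>g \<in> hom C (Cod C f) (Dom C f).
        Comp C g f = Ident C (Dom C f) \<and> Comp C f g = Ident C (Cod C f))"

locale category =
  fixes C :: "('o, 'm, 'z) cat_scheme"
  assumes dom_obj: "f \<in> Arr C \<Longrightarrow> Dom C f \<in> Obj C"
    and cod_obj: "f \<in> Arr C \<Longrightarrow> Cod C f \<in> Obj C"
    and ident_hom: "X \<in> Obj C \<Longrightarrow> Ident C X \<in> hom C X X"
    and comp_hom: "f \<in> hom C X Y \<Longrightarrow> g \<in> hom C Y Z \<Longrightarrow> Comp C g f \<in> hom C X Z"
    and comp_ident_right: "f \<in> hom C X Y \<Longrightarrow> Comp C f (Ident C X) = f"
    and comp_ident_left: "f \<in> hom C X Y \<Longrightarrow> Comp C (Ident C Y) f = f"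
    and comp_assoc: "f \<in> hom C W X \<Longrightarrow> g \<in> hom C X Y \<Longrightarrow> h \<in> hom C Y Z \<Longrightarrow>
      Comp C h (Comp C g f) = Comp C (Comp C h g) f"

record ('o, 'm) moncat = "('o, 'm) cat" +
  TensorO :: "'o \<Rightarrow> 'o \<Rightarrow> 'o"
  TensorA :: "'m \<Rightarrow> 'm \<Rightarrow> 'm"
  UnitO :: "'o"
  Assoc :: "'o \<Rightarrow> 'o \<Rightarrow> 'o \<Rightarrow> 'm"
  LUnit :: "'o \<Rightarrow> 'm"
  RUnit :: "'o \<Rightarrow> 'm"

locale monoidal_category = category C
  for C :: "('o, 'm, 'z) moncat_scheme" +
  assumes unit_obj: "UnitO C \<in> Obj C"
    and tensor_obj: "X \<in> Obj C \<Longrightarrow> Y \<in> Obj C \<Longrightarrow> TensorO C X Y \<in> Obj C"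
    and tensor_hom: "f \<in> hom C X Y \<Longrightarrow> f' \<in> hom C X' Y' \<Longrightarrow>
      TensorA C f f' \<in> hom C (TensorO C X X') (TensorO C Y Y')"
    and tensor_ident: "X \<in> Obj C \<Longrightarrow> Y \<in> Obj C \<Longrightarrow>
      TensorA C (Ident C X) (Ident C Y) = Ident C (TensorO C X Y)"
    and tensor_comp: "f \<in> hom C X Y \<Longrightarrow> g \<in> hom C Y Z \<Longrightarrow>
      f' \<in> hom C X' Y' \<Longrightarrow> g' \<in> hom C Y' Z' \<Longrightarrow>
      TensorA C (Comp C g f) (Comp C g' f') = Comp C (TensorA C g g') (TensorA C f f')"
    and assoc_hom: "X \<in> Obj C \<Longrightarrow> Y \<in> Obj C \<Longrightarrow> Z \<in> Obj C \<Longrightarrow>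
      Assoc C X Y Z \<in> hom C (TensorO C (TensorO C X Y) Z) (TensorO C X (TensorO C Y Z))"
    and assoc_iso: "X \<in> Obj C \<Longrightarrow> Y \<in> Obj C \<Longrightarrow> Z \<in> Obj C \<Longrightarrow> iso_arrow C (Assoc C X Y Z)"
    and assoc_natural: "f \<in> hom C X X' \<Longrightarrow> g \<in> hom C Y Y' \<Longrightarrow> h \<in> hom C Z Z' \<Longrightarrow>
      Comp C (Assoc C X' Y' Z') (TensorA C (TensorA C f g) h) =
      Comp C (TensorA C f (TensorA C g h)) (Assoc C X Y Z)"
    and lunit_hom: "X \<in> Obj C \<Longrightarrow> LUnit C X \<in> hom C (TensorO C (UnitO C) X) X"
    and lunit_iso: "X \<in> Obj C \<Longrightarrow> iso_arrow C (LUnit C X)"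
    and lunit_natural: "f \<in> hom C X Y \<Longrightarrow>
      Comp C (LUnit C Y) (TensorA C (Ident C (UnitO C)) f) = Comp C f (LUnit C X)"
    and runit_hom: "X \<in> Obj C \<Longrightarrow> RUnit C X \<in> hom C (TensorO C X (UnitO C)) X"
    and runit_iso: "X \<in> Obj C \<Longrightarrow> iso_arrow C (RUnit C X)"
    and runit_natural: "f \<in> hom C X Y \<Longrightarrow>
      Comp C (RUnit C Y) (TensorA C f (Ident C (UnitO C))) = Comp C f (RUnit C X)"
    and pentagon: "W \<in> Obj C \<Longrightarrow> X \<in> Obj C \<Longrightarrow> Y \<in> Obj C \<Longrightarrow> Z \<in> Obj C \<Longrightarrow>
      Comp C (TensorA C (Ident C W) (Assoc C X Y Z))
        (Comp C (Assoc C W (TensorO C X Y) Z) (TensorA C (Assoc C W X Y) (Ident C Z))) =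
      Comp C (Assoc C W X (TensorO C Y Z)) (Assoc C (TensorO C W X) Y Z)"
    and triangle: "X \<in> Obj C \<Longrightarrow> Y \<in> Obj C \<Longrightarrow>
      Comp C (TensorA C (Ident C X) (LUnit C Y)) (Assoc C X (UnitO C) Y) =
      TensorA C (RUnit C X) (Ident C Y)"

text \<open>Lax monoidal functors from a monoidal category to \<open>(Set, \<times>, 1)\<close>.  All sets
  \<open>FObj F X\<close> are subsets of one HOL type \<open>'e\<close>; equality of maps of sets is equality on their
  domain; the unit map \<open>1 \<rightarrow> F I\<close> is given by the element that it picks out.\<close>

record ('o, 'm, 'e) lax_data =
  FObj :: "'o \<Rightarrow> 'e set"
  FArr :: "'m \<Rightarrow> 'e \<Rightarrow> 'e"
  Laxator :: "'o \<Rightarrow> 'o \<Rightarrow> 'e \<times> 'e \<Rightarrow> 'e"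
  LaxUnit :: "'e"

locale lax_monoidal_functor_to_Set = monoidal_category C
  for C :: "('o, 'm, 'z) moncat_scheme" +
  fixes F :: "('o, 'm, 'e) lax_data"
  assumes map_arrow: "f \<in> hom C X Y \<Longrightarrow> FArr F f \<in> FObj F X \<rightarrow> FObj F Y"
    and map_ident: "X \<in> Obj C \<Longrightarrow> a \<in> FObj F X \<Longrightarrow> FArr F (Ident C X) a = a"
    and map_comp: "f \<in> hom C X Y \<Longrightarrow> g \<in> hom C Y Z \<Longrightarrow> a \<in> FObj F X \<Longrightarrow>
      FArr F (Comp C g f) a = FArr F g (FArr F f a)"
    and laxator_map: "X \<in> Obj C \<Longrightarrow> Y \<in> Obj C \<Longrightarrow>
      Laxator F X Y \<in> FObj F X \<times> FObj F Y \<rightarrow> FObj F (TensorO C X Y)"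
    and laxator_natural: "f \<in> hom C X X' \<Longrightarrow> g \<in> hom C Y Y' \<Longrightarrow> a \<in> FObj F X \<Longrightarrow> b \<in> FObj F Y \<Longrightarrow>
      FArr F (TensorA C f g) (Laxator F X Y (a, b)) = Laxator F X' Y' (FArr F f a, FArr F g b)"
    and laxunit_elem: "LaxUnit F \<in> FObj F (UnitO C)"
    and laxator_assoc: "X \<in> Obj C \<Longrightarrow> Y \<in> Obj C \<Longrightarrow> Z \<in> Obj C \<Longrightarrow>
      a \<in> FObj F X \<Longrightarrow> b \<in> FObj F Y \<Longrightarrow> c \<in> FObj F Z \<Longrightarrow>
      FArr F (Assoc C X Y Z) (Laxator F (TensorO C X Y) Z (Laxator F X Y (a, b), c)) =
      Laxator F X (TensorO C Y Z) (a, Laxator F Y Z (b, c))"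
    and laxator_lunit: "X \<in> Obj C \<Longrightarrow> a \<in> FObj F X \<Longrightarrow>
      FArr F (LUnit C X) (Laxator F (UnitO C) X (LaxUnit F, a)) = a"
    and laxator_runit: "X \<in> Obj C \<Longrightarrow> a \<in> FObj F X \<Longrightarrow>
      FArr F (RUnit C X) (Laxator F X (UnitO C) (a, LaxUnit F)) = a"

locale monoidal_natural_transformation =
  F: lax_monoidal_functor_to_Set C F + G: lax_monoidal_functor_to_Set C G
  for C :: "('o, 'm, 'z) moncat_scheme"
    and F :: "('o, 'm, 'e) lax_data"
    and G :: "('o, 'm, 'h) lax_data" +
  fixes \<tau> :: "'o \<Rightarrow> 'e \<Rightarrow> 'h"
  assumes component: "X \<in> Obj C \<Longrightarrow> \<tau> X \<in> FObj F X \<rightarrow> FObj G X"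
    and natural: "f \<in> hom C X Y \<Longrightarrow> a \<in> FObj F X \<Longrightarrow>
      \<tau> Y (FArr F f a) = FArr G f (\<tau> X a)"
    and monoidal_tensor: "X \<in> Obj C \<Longrightarrow> Y \<in> Obj C \<Longrightarrow> a \<in> FObj F X \<Longrightarrow> b \<in> FObj F Y \<Longrightarrow>
      \<tau> (TensorO C X Y) (Laxator F X Y (a, b)) = Laxator G X Y (\<tau> X a, \<tau> Y b)"
    and monoidal_unit: "\<tau> (UnitO C) (LaxUnit F) = LaxUnit G"


section \<open>Finite sets, vectors and spans\<close>

text \<open>All finite sets are finite subsets of one type, freely closed under disjoint sums and
  pairs over an arbitrary type \<open>'a\<close> of atoms.\<close>

datatype 'a univ =
    Atom 'a
  | In1 "'a univ"
  | In2 "'a univ"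
  | Pr (pfst: "'a univ") (psnd: "'a univ")

definition usum :: "'a univ set \<Rightarrow> 'a univ set \<Rightarrow> 'a univ set" where
  "usum A B = In1 ` A \<union> In2 ` B"

definition ucase :: "('a univ \<Rightarrow> 'b) \<Rightarrow> ('a univ \<Rightarrow> 'b) \<Rightarrow> 'a univ \<Rightarrow> 'b" where
  "ucase f g z = (case z of In1 x \<Rightarrow> f x | In2 y \<Rightarrow> g y | _ \<Rightarrow> undefined)"

definition umap :: "('a univ \<Rightarrow> 'a univ) \<Rightarrow> ('a univ \<Rightarrow> 'a univ) \<Rightarrow> 'a univ \<Rightarrow> 'a univ" where
  "umap f g = ucase (In1 \<circ> f) (In2 \<circ> g)"

definition RR :: "'v set \<Rightarrow> ('v \<Rightarrow> real) set" where
  "RR A = (A \<rightarrow>\<^sub>E UNIV)"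

definition vadd :: "'v set \<Rightarrow> ('v \<Rightarrow> real) \<Rightarrow> ('v \<Rightarrow> real) \<Rightarrow> 'v \<Rightarrow> real" where
  "vadd A x y = (\<lambda>a\<in>A. x a + y a)"

definition vsub :: "'v set \<Rightarrow> ('v \<Rightarrow> real) \<Rightarrow> ('v \<Rightarrow> real) \<Rightarrow> 'v \<Rightarrow> real" where
  "vsub A x y = (\<lambda>a\<in>A. x a - y a)"

text \<open>For \<open>f : A \<rightarrow> B\<close>, \<open>pull A f\<close> is \<open>f\<^sup>*\<close> and \<open>push A B f\<close> is \<open>f\<^sub>*\<close>.\<close>

definition pull :: "'v set \<Rightarrow> ('v \<Rightarrow> 'w) \<Rightarrow> ('w \<Rightarrow> real) \<Rightarrow> 'v \<Rightarrow> real" where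
  "pull A f x = (\<lambda>a\<in>A. x (f a))"

definition push :: "'v set \<Rightarrow> 'w set \<Rightarrow> ('v \<Rightarrow> 'w) \<Rightarrow> ('v \<Rightarrow> real) \<Rightarrow> 'w \<Rightarrow> real" where
  "push A B f x = (\<lambda>b\<in>B. \<Sum>a | a \<in> A \<and> f a = b. x a)"

definition vjoin :: "'a univ set \<Rightarrow> 'a univ set \<Rightarrow> ('a univ \<Rightarrow> real) \<Rightarrow> ('a univ \<Rightarrow> real) \<Rightarrow>
    'a univ \<Rightarrow> real" where
  "vjoin A B x y = (\<lambda>z \<in> usum A B. ucase x y z)"

record 'a span =
  apex :: "'a univ set"
  sleg :: "'a univ \<Rightarrow> 'a univ"
  tleg :: "'a univ \<Rightarrow> 'a univ"

definition is_span :: "'a univ set \<Rightarrow> 'a univ set \<Rightarrow> 'a span \<Rightarrow> bool" where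
  "is_span A B R \<longleftrightarrow> finite (apex R) \<and> sleg R \<in> apex R \<rightarrow> A \<and> tleg R \<in> apex R \<rightarrow> B"

definition span_iso :: "'a span \<Rightarrow> 'a span \<Rightarrow> bool" where
  "span_iso R R' \<longleftrightarrow> (\<exists>h. bij_betw h (apex R) (apex R') \<and>
     (\<forall>w \<in> apex R. sleg R' (h w) = sleg R w \<and> tleg R' (h w) = tleg R w))"

text \<open>For a span \<open>A \<leftarrow> R \<rightarrow> B\<close>, \<open>span_map R B\<close> is \<open>R\<^sup>* : \<real>\<^sup>A \<rightarrow> \<real>\<^sup>B\<close>.\<close>

definition span_map :: "'a span \<Rightarrow> 'a univ set \<Rightarrow> ('a univ \<Rightarrow> real) \<Rightarrow> 'a univ \<Rightarrow> real" where
  "span_map R B x = push (apex R) B (tleg R) (pull (apex R) (sleg R) x)"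

definition empty_span :: "'a span" where
  "empty_span = \<lparr>apex = {}, sleg = id, tleg = id\<rparr>"

text \<open>Fibre product over the common foot of \<open>A \<leftarrow> R \<rightarrow> B\<close> and \<open>B \<leftarrow> S \<rightarrow> C\<close>.\<close>

definition span_comp :: "'a span \<Rightarrow> 'a span \<Rightarrow> 'a span" where
  "span_comp R S = \<lparr>apex = {Pr r s | r s. r \<in> apex R \<and> s \<in> apex S \<and> tleg R r = sleg S s},
     sleg = sleg R \<circ> pfst, tleg = tleg S \<circ> psnd\<rparr>"

text \<open>\<open>span_plus\<close>: disjoint union of two spans with the same feet;
  \<open>span_par\<close>: disjoint union of spans and of their feet.\<close>

definition span_plus :: "'a span \<Rightarrow> 'a span \<Rightarrow> 'a span" where
  "span_plus R S = \<lparr>apex = usum (apex R) (apex S),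
     sleg = ucase (sleg R) (sleg S), tleg = ucase (tleg R) (tleg S)\<rparr>"

definition span_par :: "'a span \<Rightarrow> 'a span \<Rightarrow> 'a span" where
  "span_par R S = \<lparr>apex = usum (apex R) (apex S),
     sleg = umap (sleg R) (sleg S), tleg = umap (tleg R) (tleg S)\<rparr>"

text \<open>\<open>\<phi> : \<real>\<^sup>A \<rightarrow> \<real>\<^sup>B\<close> respects the span \<open>A \<leftarrow> R \<rightarrow> B\<close> with legs \<open>s\<close>, \<open>t\<close>.\<close>

definition respects_span :: "'v set \<Rightarrow> 'w set \<Rightarrow> 'e set \<Rightarrow> ('e \<Rightarrow> 'v) \<Rightarrow> ('e \<Rightarrow> 'w) \<Rightarrow>
    (('v \<Rightarrow> real) \<Rightarrow> 'w \<Rightarrow> real) \<Rightarrow> bool" where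
  "respects_span A B R s t \<phi> \<longleftrightarrow>
     (\<forall>b \<in> B. \<forall>x \<in> RR A. \<forall>x' \<in> RR A.
        (\<forall>a \<in> s ` {e \<in> R. t e = b}. x a = x' a) \<longrightarrow> \<phi> x b = \<phi> x' b)"

definition acyclic_graph :: "('v, 'e) pre_digraph \<Rightarrow> bool" where
  "acyclic_graph G \<longleftrightarrow> \<not> (\<exists>p. pre_digraph.cycle G p)"


section \<open>Directed wiring diagrams with dependencies\<close>

record 'a box =
  ins :: "'a univ set"
  outs :: "'a univ set"

record 'a wiring =
  win :: "'a span"
  wtr :: "'a span"
  wout :: "'a span"

definition wirings :: "('a, 'y) box_scheme \<Rightarrow> ('a, 'z) box_scheme \<Rightarrow> 'a wiring set" where
  "wirings X Y = {f. is_span (ins Y) (ins X) (win f) \<and> is_span (outs X) (ins X) (wtr f) \<and>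
     is_span (outs X) (outs Y) (wout f)}"

definition wiring_rel :: "('a, 'y) box_scheme \<Rightarrow> ('a, 'z) box_scheme \<Rightarrow>
    ('a wiring \<times> 'a wiring) set" where
  "wiring_rel X Y = {(f, g). f \<in> wirings X Y \<and> g \<in> wirings X Y \<and>
     span_iso (win f) (win g) \<and> span_iso (wtr f) (wtr g) \<and> span_iso (wout f) (wout g)}"

definition wiring_class :: "('a, 'y) box_scheme \<Rightarrow> ('a, 'z) box_scheme \<Rightarrow> 'a wiring \<Rightarrow>
    'a wiring set" where
  "wiring_class X Y f = wiring_rel X Y `` {f}"

definition wiring_comp :: "'a wiring \<Rightarrow> 'a wiring \<Rightarrow> 'a wiring" where
  "wiring_comp g f = \<lparr>win = span_comp (win g) (win f),
     wtr = span_plus (wtr f) (span_comp (span_comp (wout f) (wtr g)) (win f)),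
     wout = span_comp (wout f) (wout g)\<rparr>"

definition wiring_par :: "'a wiring \<Rightarrow> 'a wiring \<Rightarrow> 'a wiring" where
  "wiring_par f g = \<lparr>win = span_par (win f) (win g), wtr = span_par (wtr f) (wtr g),
     wout = span_par (wout f) (wout g)\<rparr>"

text \<open>The wiring diagram from \<open>X\<close> determined by bijections from its input and output ports to
  those of another box; for \<open>b = c = id\<close> it is the identity of \<open>X\<close>.\<close>

definition wiring_of_bij :: "('a, 'y) box_scheme \<Rightarrow> ('a univ \<Rightarrow> 'a univ) \<Rightarrow>
    ('a univ \<Rightarrow> 'a univ) \<Rightarrow> 'a wiring" where
  "wiring_of_bij X b c = \<lparr>win = \<lparr>apex = ins X, sleg = b, tleg = id\<rparr>, wtr = empty_span,
     wout = \<lparr>apex = outs X, sleg = id, tleg = c\<rparr>\<rparr>"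

record 'a dbox = "'a box" +
  dep :: "('a univ \<times> 'a univ) set"

definition dboxes :: "'a dbox set" where
  "dboxes = {X. finite (ins X) \<and> finite (outs X) \<and> dep X \<subseteq> ins X \<times> outs X}"

text \<open>The graph \<open>f(W) +\<^sub>X d\<^sub>X\<close>.\<close>

definition trace_graph :: "'a dbox \<Rightarrow> 'a wiring \<Rightarrow>
    ('a univ + 'a univ, 'a univ + 'a univ \<times> 'a univ) pre_digraph" where
  "trace_graph X f = \<lparr>verts = ins X <+> outs X, arcs = apex (wtr f) <+> dep X,
     tail = case_sum (Inr \<circ> sleg (wtr f)) (Inl \<circ> fst),
     head = case_sum (Inl \<circ> tleg (wtr f)) (Inr \<circ> snd)\<rparr>"

text \<open>\<open>R(f)(d\<^sub>X)\<close>; \<open>awalk u p v\<close> says that the list of arcs \<open>p\<close> is a directed path (possibly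
  trivial, vertices may repeat) from \<open>u\<close> to \<open>v\<close>.\<close>

definition dep_image :: "'a dbox \<Rightarrow> 'a wiring \<Rightarrow> ('a univ \<times> 'a univ) set" where
  "dep_image X f = {(sleg (win f) i, tleg (wout f) j) | i j p.
     i \<in> apex (win f) \<and> j \<in> apex (wout f) \<and>
     pre_digraph.awalk (trace_graph X f) (Inl (tleg (win f) i)) p (Inr (sleg (wout f) j))}"

type_synonym 'a darrow = "'a dbox \<times> 'a dbox \<times> 'a wiring set"

definition darrows :: "'a darrow set" where
  "darrows = {(X, Y, wiring_class X Y f) | X Y f.
     X \<in> dboxes \<and> Y \<in> dboxes \<and> f \<in> wirings X Y \<and>
     dep_image X f \<subseteq> dep Y \<and> acyclic_graph (trace_graph X f)}"

definition darrow_of_bij :: "'a dbox \<Rightarrow> 'a dbox \<Rightarrow> ('a univ \<Rightarrow> 'a univ) \<Rightarrow>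
    ('a univ \<Rightarrow> 'a univ) \<Rightarrow> 'a darrow" where
  "darrow_of_bij X Y b c = (X, Y, wiring_class X Y (wiring_of_bij X b c))"

definition dcomp :: "'a darrow \<Rightarrow> 'a darrow \<Rightarrow> 'a darrow" where
  "dcomp = (\<lambda>(Y', Z, gs) (X, Y, fs).
     (X, Z, \<Union>g\<in>gs. \<Union>f\<in>fs. wiring_class X Z (wiring_comp g f)))"

definition dtensor :: "'a dbox \<Rightarrow> 'a dbox \<Rightarrow> 'a dbox" where
  "dtensor X Y = \<lparr>ins = usum (ins X) (ins Y), outs = usum (outs X) (outs Y),
     dep = map_prod In1 In1 ` dep X \<union> map_prod In2 In2 ` dep Y\<rparr>"

definition dtensor_arrow :: "'a darrow \<Rightarrow> 'a darrow \<Rightarrow> 'a darrow" where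
  "dtensor_arrow = (\<lambda>(X, Y, fs) (X', Y', gs). (dtensor X X', dtensor Y Y',
     \<Union>f\<in>fs. \<Union>g\<in>gs. wiring_class (dtensor X X') (dtensor Y Y') (wiring_par f g)))"

definition dunit :: "'a dbox" where
  "dunit = \<lparr>ins = {}, outs = {}, dep = {}\<rparr>"

definition uassoc :: "'a univ \<Rightarrow> 'a univ" where
  "uassoc = ucase (ucase In1 (In2 \<circ> In1)) (In2 \<circ> In2)"

definition ucodiag :: "'a univ \<Rightarrow> 'a univ" where
  "ucodiag = ucase id id"

definition dDWD :: "('a dbox, 'a darrow) moncat" where
  "dDWD = \<lparr>Obj = dboxes, Arr = darrows, Dom = fst, Cod = fst \<circ> snd,
     Ident = (\<lambda>X. darrow_of_bij X X id id), Comp = dcomp,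
     TensorO = dtensor, TensorA = dtensor_arrow, UnitO = dunit,
     Assoc = (\<lambda>X Y Z. darrow_of_bij (dtensor (dtensor X Y) Z) (dtensor X (dtensor Y Z))
                        uassoc uassoc),
     LUnit = (\<lambda>X. darrow_of_bij (dtensor dunit X) X ucodiag ucodiag),
     RUnit = (\<lambda>X. darrow_of_bij (dtensor X dunit) X ucodiag ucodiag)\<rparr>"


section \<open>Mealy machines\<close>

text \<open>Maps \<open>\<real>\<^sup>A \<times> \<real>\<^sup>B \<rightarrow> \<real>\<^sup>C\<close> are curried HOL functions; their values outside
  \<open>RR A\<close>, \<open>RR B\<close> are irrelevant and are disregarded by the isomorphism relations below.\<close>

record 'a mealy =
  states :: "'a univ set"
  upd :: "('a univ \<Rightarrow> real) \<Rightarrow> ('a univ \<Rightarrow> real) \<Rightarrow> 'a univ \<Rightarrow> real"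
  rdt :: "('a univ \<Rightarrow> real) \<Rightarrow> ('a univ \<Rightarrow> real) \<Rightarrow> 'a univ \<Rightarrow> real"

definition mealys :: "'a dbox \<Rightarrow> 'a mealy set" where
  "mealys X = {m. finite (states m) \<and>
     upd m \<in> RR (ins X) \<rightarrow> RR (states m) \<rightarrow> RR (states m) \<and>
     rdt m \<in> RR (ins X) \<rightarrow> RR (states m) \<rightarrow> RR (outs X) \<and>
     (\<forall>x \<in> RR (states m). respects_span (ins X) (outs X) (dep X) fst snd (\<lambda>a. rdt m a x))}"

definition mealy_rel :: "'a dbox \<Rightarrow> ('a mealy \<times> 'a mealy) set" where
  "mealy_rel X = {(m, m'). m \<in> mealys X \<and> m' \<in> mealys X \<and>
     (\<exists>h. bij_betw h (states m) (states m') \<and>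
        (\<forall>a \<in> RR (ins X). \<forall>x \<in> RR (states m').
           upd m a (pull (states m) h x) = pull (states m) h (upd m' a x) \<and>
           rdt m a (pull (states m) h x) = rdt m' a x))}"

definition mealy_class :: "'a dbox \<Rightarrow> 'a mealy \<Rightarrow> 'a mealy set" where
  "mealy_class X m = mealy_rel X `` {m}"

definition mealy_fix :: "'a dbox \<Rightarrow> 'a wiring \<Rightarrow> 'a mealy \<Rightarrow> ('a univ \<Rightarrow> real) \<Rightarrow>
    ('a univ \<Rightarrow> real) \<Rightarrow> ('a univ \<Rightarrow> real) \<times> ('a univ \<Rightarrow> real)" where
  "mealy_fix X f m a x = (THE z. z \<in> RR (ins X) \<times> RR (outs X) \<and>
     (vadd (ins X) (span_map (wtr f) (ins X) (snd z)) a, rdt m (fst z) x) = z)"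

definition mealy_act :: "'a dbox \<Rightarrow> 'a dbox \<Rightarrow> 'a wiring \<Rightarrow> 'a mealy \<Rightarrow> 'a mealy" where
  "mealy_act X Y f m = \<lparr>states = states m,
     upd = (\<lambda>y x. upd m (fst (mealy_fix X f m (span_map (win f) (ins X) y) x)) x),
     rdt = (\<lambda>y x. span_map (wout f) (outs Y)
              (snd (mealy_fix X f m (span_map (win f) (ins X) y) x)))\<rparr>"

definition mealy_par :: "'a dbox \<Rightarrow> 'a dbox \<Rightarrow> 'a mealy \<Rightarrow> 'a mealy \<Rightarrow> 'a mealy" where
  "mealy_par X Y m n = \<lparr>states = usum (states m) (states n),
     upd = (\<lambda>a x. vjoin (states m) (states n)
              (upd m (pull (ins X) In1 a) (pull (states m) In1 x))
              (upd n (pull (ins Y) In2 a) (pull (states n) In2 x))),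
     rdt = (\<lambda>a x. vjoin (outs X) (outs Y)
              (rdt m (pull (ins X) In1 a) (pull (states m) In1 x))
              (rdt n (pull (ins Y) In2 a) (pull (states n) In2 x)))\<rparr>"

definition mealy_unit :: "'a mealy" where
  "mealy_unit = \<lparr>states = {}, upd = (\<lambda>a x. \<lambda>v\<in>{}. 0), rdt = (\<lambda>a x. \<lambda>v\<in>{}. 0)\<rparr>"

definition Mealy :: "('a dbox, 'a darrow, 'a mealy set) lax_data" where
  "Mealy = \<lparr>FObj = (\<lambda>X. mealys X // mealy_rel X),
     FArr = (\<lambda>(X, Y, fs) M. \<Union>f\<in>fs. \<Union>m\<in>M. mealy_class Y (mealy_act X Y f m)),
     Laxator = (\<lambda>X Y (M, N). \<Union>m\<in>M. \<Union>n\<in>N. mealy_class (dtensor X Y) (mealy_par X Y m n)),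
     LaxUnit = mealy_class dunit mealy_unit\<rparr>"


section \<open>Open stock-flow diagrams\<close>

text \<open>The generating graph of \<open>H\<^sub>f\<close>.  Each of the six kinds \<open>l\<close> of links is a vertex \<open>Link l\<close>
  with a source arrow \<open>A_s l : Link l \<rightarrow> lsrc l\<close> and a target arrow \<open>A_t l : Link l \<rightarrow> ltgt l\<close>.\<close>

datatype hlink = StockL | SumL | StockSumL | VarL | InL | OutL

datatype hob = Stock | Flow | Inflow | Outflow | Var | SumVar | InPort | OutPort | Link hlink

datatype har = A_is | A_if | A_os | A_of | A_fv | A_s hlink | A_t hlink

fun lsrc :: "hlink \<Rightarrow> hob" where
  "lsrc StockL = Stock"
| "lsrc SumL = SumVar"
| "lsrc StockSumL = Stock"
| "lsrc VarL = Var"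
| "lsrc InL = InPort"
| "lsrc OutL = Var"

fun ltgt :: "hlink \<Rightarrow> hob" where
  "ltgt StockL = Var"
| "ltgt SumL = Var"
| "ltgt StockSumL = SumVar"
| "ltgt VarL = Var"
| "ltgt InL = Var"
| "ltgt OutL = OutPort"

fun hdom :: "har \<Rightarrow> hob" where
  "hdom A_is = Inflow"
| "hdom A_if = Inflow"
| "hdom A_os = Outflow"
| "hdom A_of = Outflow"
| "hdom A_fv = Flow"
| "hdom (A_s l) = Link l"
| "hdom (A_t l) = Link l"

fun hcod :: "har \<Rightarrow> hob" where
  "hcod A_is = Stock"
| "hcod A_if = Flow"
| "hcod A_os = Stock"
| "hcod A_of = Flow"
| "hcod A_fv = Var"
| "hcod (A_s l) = lsrc l"
| "hcod (A_t l) = ltgt l"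

text \<open>A functor on the free category \<open>H\<^sub>f\<close> is the same as its values on the vertices and
  arrows of the generating graph; likewise naturality is naturality for the generating arrows.\<close>

record 'a hfun =
  ob :: "hob \<Rightarrow> 'a univ set"
  ar :: "har \<Rightarrow> 'a univ \<Rightarrow> 'a univ"

definition finite_hfun :: "('a, 'z) hfun_scheme \<Rightarrow> bool" where
  "finite_hfun F \<longleftrightarrow> (\<forall>v. finite (ob F v)) \<and> (\<forall>h. ar F h \<in> ob F (hdom h) \<rightarrow> ob F (hcod h))"

definition link_span :: "('a, 'z) hfun_scheme \<Rightarrow> hlink \<Rightarrow> 'a span" where
  "link_span F l = \<lparr>apex = ob F (Link l), sleg = ar F (A_s l), tleg = ar F (A_t l)\<rparr>"

definition var_graph :: "('a, 'z) hfun_scheme \<Rightarrow> ('a univ, 'a univ) pre_digraph" where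
  "var_graph F = \<lparr>verts = ob F Var, arcs = ob F (Link VarL),
     tail = ar F (A_s VarL), head = ar F (A_t VarL)\<rparr>"

definition link_dep :: "('a, 'z) hfun_scheme \<Rightarrow> ('a univ \<times> 'a univ) set" where
  "link_dep F = {(ar F (A_s InL) i, ar F (A_t OutL) j) | i j p.
     i \<in> ob F (Link InL) \<and> j \<in> ob F (Link OutL) \<and>
     pre_digraph.awalk (var_graph F) (ar F (A_t InL) i) p (ar F (A_s OutL) j)}"

text \<open>The arguments of \<open>phi\<close> are, in this order, the values of stocks, sum variables, variables
  and in ports.\<close>

record 'a sfd = "'a hfun" +
  phi :: "('a univ \<Rightarrow> real) \<Rightarrow> ('a univ \<Rightarrow> real) \<Rightarrow> ('a univ \<Rightarrow> real) \<Rightarrow> ('a univ \<Rightarrow> real) \<Rightarrow>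
            'a univ \<Rightarrow> real"

text \<open>The disjoint unions of vertices and of links in the span that \<open>phi\<close> has to respect are
  dependent sums, tagged by the vertices of the generating graph and the kinds of links.\<close>

definition phi_respects :: "'a sfd \<Rightarrow> bool" where
  "phi_respects F \<longleftrightarrow> respects_span
     (Sigma {Stock, SumVar, Var, InPort} (ob F)) (ob F Var)
     (Sigma {StockL, SumL, VarL, InL} (\<lambda>l. ob F (Link l)))
     (\<lambda>(l, e). (lsrc l, ar F (A_s l) e)) (\<lambda>(l, e). ar F (A_t l) e)
     (\<lambda>x. phi F (pull (ob F Stock) (Pair Stock) x) (pull (ob F SumVar) (Pair SumVar) x)
                (pull (ob F Var) (Pair Var) x) (pull (ob F InPort) (Pair InPort) x))"

definition sfds :: "'a dbox \<Rightarrow> 'a sfd set" where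
  "sfds X = {F. finite_hfun F \<and>
     inj_on (ar F A_if) (ob F Inflow) \<and> inj_on (ar F A_of) (ob F Outflow) \<and>
     acyclic_graph (var_graph F) \<and>
     ob F InPort = ins X \<and> ob F OutPort = outs X \<and>
     link_dep F \<subseteq> dep X \<and>
     phi F \<in> RR (ob F Stock) \<rightarrow> RR (ob F SumVar) \<rightarrow> RR (ob F Var) \<rightarrow> RR (ob F InPort) \<rightarrow>
               RR (ob F Var) \<and>
     phi_respects F}"

definition sfd_rel :: "'a dbox \<Rightarrow> ('a sfd \<times> 'a sfd) set" where
  "sfd_rel X = {(F, G). F \<in> sfds X \<and> G \<in> sfds X \<and>
     (\<exists>\<eta>. (\<forall>v. bij_betw (\<eta> v) (ob F v) (ob G v)) \<and>
        (\<forall>h. \<forall>e \<in> ob F (hdom h). \<eta> (hcod h) (ar F h e) = ar G h (\<eta> (hdom h) e)) \<and>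
        (\<forall>p \<in> ins X. \<eta> InPort p = p) \<and> (\<forall>p \<in> outs X. \<eta> OutPort p = p) \<and>
        (\<forall>s \<in> RR (ob G Stock). \<forall>w \<in> RR (ob G SumVar). \<forall>v \<in> RR (ob G Var). \<forall>a \<in> RR (ins X).
           phi F (pull (ob F Stock) (\<eta> Stock) s) (pull (ob F SumVar) (\<eta> SumVar) w)
                 (pull (ob F Var) (\<eta> Var) v) a =
           pull (ob F Var) (\<eta> Var) (phi G s w v a)))}"

definition sfd_class :: "'a dbox \<Rightarrow> 'a sfd \<Rightarrow> 'a sfd set" where
  "sfd_class X F = sfd_rel X `` {F}"

definition act_in_links :: "'a wiring \<Rightarrow> 'a sfd \<Rightarrow> 'a span" where
  "act_in_links f F = span_comp (win f) (link_span F InL)"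

definition act_out_links :: "'a wiring \<Rightarrow> 'a sfd \<Rightarrow> 'a span" where
  "act_out_links f F = span_comp (link_span F OutL) (wout f)"

definition act_var_links :: "'a wiring \<Rightarrow> 'a sfd \<Rightarrow> 'a span" where
  "act_var_links f F = span_plus (link_span F VarL)
     (span_comp (span_comp (link_span F OutL) (wtr f)) (link_span F InL))"

definition sfd_act :: "'a dbox \<Rightarrow> 'a dbox \<Rightarrow> 'a wiring \<Rightarrow> 'a sfd \<Rightarrow> 'a sfd" where
  "sfd_act X Y f F = \<lparr>
     ob = (ob F)(InPort := ins Y, OutPort := outs Y,
            Link InL := apex (act_in_links f F), Link OutL := apex (act_out_links f F),
            Link VarL := apex (act_var_links f F)),
     ar = (ar F)(A_s InL := sleg (act_in_links f F), A_t InL := tleg (act_in_links f F),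
            A_s OutL := sleg (act_out_links f F), A_t OutL := tleg (act_out_links f F),
            A_s VarL := sleg (act_var_links f F), A_t VarL := tleg (act_var_links f F)),
     phi = (\<lambda>s w v y. phi F s w v
              (vadd (ins X) (span_map (win f) (ins X) y)
                 (span_map (wtr f) (ins X) (span_map (link_span F OutL) (outs X) v))))\<rparr>"

definition sfd_par :: "'a sfd \<Rightarrow> 'a sfd \<Rightarrow> 'a sfd" where
  "sfd_par F G = \<lparr>
     ob = (\<lambda>v. usum (ob F v) (ob G v)),
     ar = (\<lambda>h. umap (ar F h) (ar G h)),
     phi = (\<lambda>s w v a. vjoin (ob F Var) (ob G Var)
       (phi F (pull (ob F Stock) In1 s) (pull (ob F SumVar) In1 w)
              (pull (ob F Var) In1 v) (pull (ob F InPort) In1 a))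
       (phi G (pull (ob G Stock) In2 s) (pull (ob G SumVar) In2 w)
              (pull (ob G Var) In2 v) (pull (ob G InPort) In2 a)))\<rparr>"

definition sfd_empty :: "'a sfd" where
  "sfd_empty = \<lparr>ob = (\<lambda>v. {}), ar = (\<lambda>h. id), phi = (\<lambda>s w v a. \<lambda>z\<in>{}. 0)\<rparr>"

definition SF :: "('a dbox, 'a darrow, 'a sfd set) lax_data" where
  "SF = \<lparr>FObj = (\<lambda>X. sfds X // sfd_rel X),
     FArr = (\<lambda>(X, Y, fs) D. \<Union>f\<in>fs. \<Union>F\<in>D. sfd_class Y (sfd_act X Y f F)),
     Laxator = (\<lambda>X Y (D, E). \<Union>F\<in>D. \<Union>G\<in>E. sfd_class (dtensor X Y) (sfd_par F G)),
     LaxUnit = sfd_class dunit sfd_empty\<rparr>"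


section \<open>The Mealy machine of an open stock-flow diagram\<close>

definition var_fix :: "'a sfd \<Rightarrow> ('a univ \<Rightarrow> real) \<Rightarrow> ('a univ \<Rightarrow> real) \<Rightarrow> 'a univ \<Rightarrow> real" where
  "var_fix F a s = (THE v. v \<in> RR (ob F Var) \<and>
     phi F s (span_map (link_span F StockSumL) (ob F SumVar) s) v a = v)"

definition flow_in :: "'a sfd \<Rightarrow> ('a univ \<Rightarrow> real) \<Rightarrow> 'a univ \<Rightarrow> real" where
  "flow_in F v = push (ob F Inflow) (ob F Stock) (ar F A_is)
     (pull (ob F Inflow) (ar F A_if) (pull (ob F Flow) (ar F A_fv) v))"

definition flow_out :: "'a sfd \<Rightarrow> ('a univ \<Rightarrow> real) \<Rightarrow> 'a univ \<Rightarrow> real" where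
  "flow_out F v = push (ob F Outflow) (ob F Stock) (ar F A_os)
     (pull (ob F Outflow) (ar F A_of) (pull (ob F Flow) (ar F A_fv) v))"

definition mealy_of_sfd :: "'a sfd \<Rightarrow> 'a mealy" where
  "mealy_of_sfd F = \<lparr>states = ob F Stock,
     upd = (\<lambda>a s. vsub (ob F Stock) (flow_in F (var_fix F a s)) (flow_out F (var_fix F a s))),
     rdt = (\<lambda>a s. span_map (link_span F OutL) (ob F OutPort) (var_fix F a s))\<rparr>"

definition alpha :: "'a dbox \<Rightarrow> 'a sfd set \<Rightarrow> 'a mealy set" where
  "alpha X D = (\<Union>F\<in>D. mealy_class X (mealy_of_sfd F))"

end

theory Submission
  imports Defs
begin

text \<open>
  On representatives, both functors have the same shape: a wiring diagram
  acts on a machine, two machines can be put side by side, and there is an empty machine.  The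
  laws of this action hold up to isomorphism of machines.  They are proved for representatives, and
  the locale \<open>wiring_action\<close> turns them into a lax monoidal functor on classes once for both cases.

  Finite spans are treated as matrices.  A span of finite sets is determined up to isomorphism by
  the number \<open>wires R a b\<close> of wires from \<open>a\<close> to \<open>b\<close> (\<open>span_iso_iff_wires\<close>); composition, sum
  and disjoint union of spans become product, sum and block sum of matrices, and \<open>R\<^sup>*\<close> becomes
  the linear map of the matrix.  The laws of wiring diagrams, and the comparison of the links of
  two stock-flow diagrams, are then identities between matrices of natural numbers: no bijection
  between sets of wires is ever written down.  Structural isomorphisms and renamings of ports are
  handled uniformly by \<open>wiring_square\<close>, which says that two diagrams become
  isomorphic after a relabelling of their ports.

  Acyclicity and dependency only see which matrix entries are nonzero, so they are statements about
  relations.  Composing two wiring diagrams, and letting a diagram act on a stock-flow diagram, both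
  close up an acyclic relation \<open>P\<close> by feedback through an outer layer: \<open>P \<union> K O W O I\<close>.  If the
  outer layer, with every passage through \<open>P\<close> contracted to one step, is acyclic, then so is the
  result (\<open>feedback_acyclic\<close>), and its passages are paths of the outer layer
  (\<open>feedback_through\<close>).  This gives composition in \<open>dDWD\<close> and the action on diagrams at once.

  A system of equations in which the value at a vertex depends only on the values at its
  predecessors in an acyclic graph has exactly one solution (\<open>acyclic_unique_fixpoint\<close>).  The
  equalities between Mealy machines follow from uniqueness.  For functoriality of \<open>Mealy\<close>, the
  solution for \<open>f\<close> at the inputs found by the solution for \<open>g\<close> solves the system of \<open>g \<circ> f\<close>.
  For naturality of \<open>\<alpha>\<close> (\<open>mealy_of_sfd_natural\<close>), let \<open>v\<close> be the values of the variables of the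
  rewired diagram at input \<open>y\<close>.  The defining equation of \<open>v\<close> says that \<open>v\<close> solves the system of
  the original diagram at the input \<open>p\<close> obtained by adding the traced outputs to the outer input;
  so the outputs of \<open>v\<close> are the readout of the original machine at \<open>p\<close>, and the pair of \<open>p\<close> with
  these outputs is the fixed point that defines the action on Mealy machines.  Hence both machines
  have the same flows and the same readout.
\<close>

section \<open>Finite spans as matrices of natural numbers\<close>

text \<open>The matrix of a span, with entries in the natural numbers.\<close>

definition wires :: "'a span \<Rightarrow> 'a univ \<Rightarrow> 'a univ \<Rightarrow> nat" where
  "wires R a b = card {w \<in> apex R. sleg R w = a \<and> tleg R w = b}"

text \<open>The relation induced by a span: the support of its matrix.\<close>

definition ends :: "'a span \<Rightarrow> ('a univ \<times> 'a univ) set" where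
  "ends R = (\<lambda>w. (sleg R w, tleg R w)) ` apex R"

definition mmult :: "'b set \<Rightarrow> ('a \<Rightarrow> 'b \<Rightarrow> nat) \<Rightarrow> ('b \<Rightarrow> 'c \<Rightarrow> nat) \<Rightarrow> 'a \<Rightarrow> 'c \<Rightarrow> nat" where
  "mmult B M N a c = (\<Sum>b\<in>B. M a b * N b c)"

text \<open>The block diagonal matrix, indexed by disjoint unions.\<close>

definition mblock :: "('a univ \<Rightarrow> 'a univ \<Rightarrow> nat) \<Rightarrow> ('a univ \<Rightarrow> 'a univ \<Rightarrow> nat) \<Rightarrow>
    'a univ \<Rightarrow> 'a univ \<Rightarrow> nat" where
  "mblock M N a b = (case a of In1 x \<Rightarrow> (case b of In1 y \<Rightarrow> M x y | _ \<Rightarrow> 0)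
     | In2 x \<Rightarrow> (case b of In2 y \<Rightarrow> N x y | _ \<Rightarrow> 0) | _ \<Rightarrow> 0)"

lemma mblock_simps [simp]:
  "mblock M N (In1 a) (In1 b) = M a b" "mblock M N (In2 c) (In2 d) = N c d"
  "mblock M N (In1 a) (In2 d) = 0" "mblock M N (In2 c) (In1 b) = 0"
  by (simp_all add: mblock_def)

lemma ucase_simps [simp]: "ucase f g (In1 x) = f x" "ucase f g (In2 y) = g y"
  by (simp_all add: ucase_def)

lemma umap_simps [simp]: "umap f g (In1 x) = In1 (f x)" "umap f g (In2 y) = In2 (g y)"
  by (simp_all add: umap_def)

lemma uassoc_simps [simp]: "uassoc (In1 (In1 x)) = In1 x" "uassoc (In1 (In2 y)) = In2 (In1 y)"
    "uassoc (In2 z) = In2 (In2 z)"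
  by (simp_all add: uassoc_def)

lemma ucodiag_simps [simp]: "ucodiag (In1 x) = x" "ucodiag (In2 x) = x"
  by (simp_all add: ucodiag_def)

lemma in_usum [simp]:
  "In1 a \<in> usum A B \<longleftrightarrow> a \<in> A" "In2 b \<in> usum A B \<longleftrightarrow> b \<in> B"
  by (auto simp: usum_def)

lemma inj_In [simp]: "inj_on In1 A" "inj_on In2 A"
  by (auto simp: inj_on_def)

lemma usumE: 
  assumes "z \<in> usum A B"
  obtains (1) x where "z = In1 x" "x \<in> A" | (2) y where "z = In2 y" "y \<in> B"
  using assms by (auto simp: usum_def)

lemma ball_usum [simp]: "(\<forall>z\<in>usum A B. P z) \<longleftrightarrow> (\<forall>x\<in>A. P (In1 x)) \<and> (\<forall>y\<in>B. P (In2 y))"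
  by (auto simp: usum_def)

lemma finite_usum [simp]: "finite (usum A B) \<longleftrightarrow> finite A \<and> finite B"
  by (auto simp: usum_def finite_image_iff inj_on_def)

lemma card_usum: "finite A \<Longrightarrow> finite B \<Longrightarrow> card (usum A B) = card A + card B"
  unfolding usum_def by (subst card_Un_disjoint) (auto simp: card_image)

lemma sum_usum: "finite A \<Longrightarrow> finite B \<Longrightarrow>
    sum g (usum A B) = (\<Sum>x\<in>A. g (In1 x)) + (\<Sum>y\<in>B. g (In2 y))"
  unfolding usum_def by (subst sum.union_disjoint) (auto simp: sum.reindex inj_on_def)

text \<open>Functions with equinumerous fibres differ by a bijection of their domains: choose a bijection on
  each fibre and glue.  This turns equality of wire counts into isomorphisms of spans and of diagrams.\<close>

lemma fibrewise_bij:
  fixes p :: "'x \<Rightarrow> 'c" and q :: "'y \<Rightarrow> 'c"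
  assumes "finite A" "finite B" and eq: "\<And>c. card {x\<in>A. p x = c} = card {y\<in>B. q y = c}"
  shows "\<exists>h. bij_betw h A B \<and> (\<forall>x\<in>A. q (h x) = p x)"
proof -
  have "\<exists>h. bij_betw h {x\<in>A. p x = c} {y\<in>B. q y = c}" for c
    using finite_same_card_bij[of "{x\<in>A. p x = c}" "{y\<in>B. q y = c}"] assms by auto
  then obtain k where "\<forall>c. bij_betw (k c) {x\<in>A. p x = c} {y\<in>B. q y = c}"
    using choice[of "\<lambda>c h. bij_betw h {x\<in>A. p x = c} {y\<in>B. q y = c}"] by auto
  then have k: "bij_betw (k c) {x\<in>A. p x = c} {y\<in>B. q y = c}" for c ..
  define h where "h x = k (p x) x" for x
  have img: "h x \<in> B \<and> q (h x) = p x" if "x \<in> A" for x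
    using bij_betwE[OF k[of "p x"]] that by (auto simp: h_def)
  have "inj_on h A"
  proof (rule inj_onI)
    fix x y assume *: "x \<in> A" "y \<in> A" "h x = h y"
    then have "p x = p y" using img by metis
    then show "x = y"
      using bij_betw_imp_inj_on[OF k[of "p x"]] * by (auto simp: h_def inj_on_def)
  qed
  moreover have "B \<subseteq> h ` A"
  proof
    fix y assume "y \<in> B"
    then have "y \<in> k (q y) ` {x\<in>A. p x = q y}"
      using bij_betw_imp_surj_on[OF k[of "q y"]] by auto
    then obtain x where "x \<in> A" "p x = q y" "y = k (q y) x" by auto
    then have "x \<in> A" "y = h x" by (auto simp: h_def)
    then show "y \<in> h ` A" by blast
  qed
  ultimately have "bij_betw h A B" using img by (auto simp: bij_betw_def)
  with img show ?thesis by (intro exI[of _ h]) simp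
qed

text \<open>An isomorphism of spans over fixed feet is a family of bijections between the sets of wires with
  given ends, and such a family exists iff these sets have the same number of elements.\<close>

lemma span_iso_iff_wires:
  assumes "finite (apex R)" "finite (apex R')"
  shows "span_iso R R' \<longleftrightarrow> wires R = wires R'"
proof
  assume "span_iso R R'"
  then obtain h where h: "bij_betw h (apex R) (apex R')"
    and leg: "\<forall>w \<in> apex R. sleg R' (h w) = sleg R w \<and> tleg R' (h w) = tleg R w"
    by (auto simp: span_iso_def)
  have "wires R a b = wires R' a b" for a b
  proof -
    have "h ` {w \<in> apex R. sleg R w = a \<and> tleg R w = b} = {w \<in> apex R'. sleg R' w = a \<and> tleg R' w = b}"
      (is "h ` ?A = ?B")
    proof (intro equalityI subsetI)
      fix y assume "y \<in> h ` ?A"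
      then show "y \<in> ?B" using leg bij_betwE[OF h] by force
    next
      fix y assume y: "y \<in> ?B"
      then obtain x where "x \<in> apex R" "y = h x"
        using bij_betw_imp_surj_on[OF h] by blast
      then show "y \<in> h ` ?A" using leg y by force
    qed
    moreover have "inj_on h {w \<in> apex R. sleg R w = a \<and> tleg R w = b}"
      using bij_betw_imp_inj_on[OF h] by (rule inj_on_subset) auto
    ultimately show ?thesis unfolding wires_def by (auto dest: card_image)
  qed
  then show "wires R = wires R'" by blast
next
  assume eq: "wires R = wires R'"
  have fibre: "card {w\<in>apex R. (sleg R w, tleg R w) = c} = card {w\<in>apex R'. (sleg R' w, tleg R' w) = c}" for c
    using fun_cong[OF fun_cong[OF eq], of "fst c" "snd c"]
    unfolding wires_def prod_eq_iff fst_conv snd_conv .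
  obtain h where h: "bij_betw h (apex R) (apex R')"
    and "\<forall>w \<in> apex R. (sleg R' (h w), tleg R' (h w)) = (sleg R w, tleg R w)"
    using fibrewise_bij[OF assms fibre] by blast
  then have "\<forall>w \<in> apex R. sleg R' (h w) = sleg R w \<and> tleg R' (h w) = tleg R w"
    by simp
  with h show "span_iso R R'"
    unfolding span_iso_def by blast
qed

lemma wires_pos_iff: "finite (apex R) \<Longrightarrow> wires R a b \<noteq> 0 \<longleftrightarrow> (a, b) \<in> ends R"
  by (auto simp: wires_def ends_def)

lemma wires_zero: "(a, b) \<notin> ends R \<Longrightarrow> wires R a b = 0"
  unfolding wires_def ends_def by (rule card_eq_0_iff[THEN iffD2]) auto

lemma ends_subset: "is_span A B R \<Longrightarrow> ends R \<subseteq> A \<times> B"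
  by (auto simp: is_span_def ends_def)

lemma ends_cong:
  assumes "is_span A B R" "is_span A B R'" "wires R = wires R'"
  shows "ends R = ends R'"
proof -
  have "finite (apex R)" "finite (apex R')" using assms by (simp_all add: is_span_def)
  then have "(a, b) \<in> ends R \<longleftrightarrow> (a, b) \<in> ends R'" for a b
    by (simp only: wires_pos_iff[symmetric] assms(3))
  then show ?thesis by auto
qed

lemma wires_ext:
  assumes "is_span A B R" "is_span A B R'"
    and "\<And>a b. a \<in> A \<Longrightarrow> b \<in> B \<Longrightarrow> wires R a b = wires R' a b"
  shows "wires R = wires R'"
proof (intro ext)
  fix a b
  show "wires R a b = wires R' a b"
  proof (cases "a \<in> A \<and> b \<in> B")
    case False
    then have "(a, b) \<notin> ends R" "(a, b) \<notin> ends R'"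
      using ends_subset[OF assms(1)] ends_subset[OF assms(2)] by auto
    then show ?thesis by (simp add: wires_zero)
  qed (use assms in auto)
qed

lemma is_span_comp: "is_span A B R \<Longrightarrow> is_span B C S \<Longrightarrow> is_span A C (span_comp R S)"
proof -
  assume *: "is_span A B R" "is_span B C S"
  have "apex (span_comp R S) \<subseteq> (\<lambda>(r, s). Pr r s) ` (apex R \<times> apex S)"
    by (auto simp: span_comp_def)
  then have "finite (apex (span_comp R S))"
    by (rule finite_subset) (use * in \<open>simp add: is_span_def\<close>)
  with * show ?thesis by (auto simp: is_span_def span_comp_def Pi_iff)
qed

lemma is_span_plus: "is_span A B R \<Longrightarrow> is_span A B S \<Longrightarrow> is_span A B (span_plus R S)"
  by (simp add: is_span_def span_plus_def Pi_iff)

lemma is_span_par: "is_span A B R \<Longrightarrow> is_span A' B' S \<Longrightarrow>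
    is_span (usum A A') (usum B B') (span_par R S)"
  by (simp add: is_span_def span_par_def Pi_iff)

lemma is_span_empty: "is_span A B empty_span"
  by (auto simp: is_span_def empty_span_def)

lemma wires_empty [simp]: "wires empty_span a b = 0"
  by (simp add: wires_def empty_span_def)

lemma ends_comp: "ends (span_comp R S) = ends R O ends S"
proof (intro equalityI subsetI)
  fix p assume "p \<in> ends (span_comp R S)"
  then obtain r s where "r \<in> apex R" "s \<in> apex S" "tleg R r = sleg S s" "p = (sleg R r, tleg S s)"
    by (auto simp: ends_def span_comp_def)
  then have "(sleg R r, tleg R r) \<in> ends R" "(tleg R r, tleg S s) \<in> ends S"
    by (auto simp: ends_def)
  with \<open>p = _\<close> show "p \<in> ends R O ends S" by auto
next
  fix p assume "p \<in> ends R O ends S"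
  then obtain r s where *: "r \<in> apex R" "s \<in> apex S" "tleg R r = sleg S s" "p = (sleg R r, tleg S s)"
    by (auto simp: ends_def)
  then have "Pr r s \<in> apex (span_comp R S)" by (auto simp: span_comp_def)
  moreover have "p = (\<lambda>w. (sleg (span_comp R S) w, tleg (span_comp R S) w)) (Pr r s)"
    using * by (simp add: span_comp_def)
  ultimately show "p \<in> ends (span_comp R S)" unfolding ends_def by (rule image_eqI[rotated])
qed

lemma ends_plus: "ends (span_plus R S) = ends R \<union> ends S"
  by (simp add: ends_def span_plus_def usum_def image_Un image_image)

lemma ends_par: "ends (span_par R S) = map_prod In1 In1 ` ends R \<union> map_prod In2 In2 ` ends S"
  by (simp add: ends_def span_par_def usum_def image_Un image_image)

text \<open>A wire of the composite is a pair of wires that meet at some \<open>b \<in> B\<close>; sorting the pairs by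
  \<open>b\<close> gives the entries of the matrix product.\<close>

lemma wires_comp:
  assumes R: "is_span A B R" and S: "is_span B C S" and "finite B"
  shows "wires (span_comp R S) = mmult B (wires R) (wires S)"
proof (intro ext)
  fix a c
  let ?F = "\<lambda>b. {r \<in> apex R. sleg R r = a \<and> tleg R r = b} \<times> {s \<in> apex S. sleg S s = b \<and> tleg S s = c}"
  have fin: "finite (?F b)" for b
    using R S by (auto simp: is_span_def)
  have "{w \<in> apex (span_comp R S). sleg (span_comp R S) w = a \<and> tleg (span_comp R S) w = c}
      = (\<lambda>(r, s). Pr r s) ` (\<Union>b\<in>B. ?F b)"
    using R by (auto simp: span_comp_def is_span_def image_iff dest: funcset_mem)
  then have "wires (span_comp R S) a c = card (\<Union>b\<in>B. ?F b)"
    unfolding wires_def by (simp add: card_image inj_on_def split_beta prod_eq_iff)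
  also have "\<dots> = (\<Sum>b\<in>B. card (?F b))"
    using \<open>finite B\<close> fin by (subst card_UN_disjoint) auto
  also have "\<dots> = mmult B (wires R) (wires S) a c"
    by (simp add: mmult_def wires_def card_cartesian_product)
  finally show "wires (span_comp R S) a c = mmult B (wires R) (wires S) a c" .
qed

lemma wires_plus:
  assumes "finite (apex R)" "finite (apex S)"
  shows "wires (span_plus R S) a b = wires R a b + wires S a b"
proof -
  have "{w \<in> apex (span_plus R S). sleg (span_plus R S) w = a \<and> tleg (span_plus R S) w = b}
    = usum {w \<in> apex R. sleg R w = a \<and> tleg R w = b} {w \<in> apex S. sleg S w = a \<and> tleg S w = b}"
    by (auto simp: span_plus_def usum_def)
  then show ?thesis
    using assms unfolding wires_def by (simp add: card_usum)
qed

lemma wires_par: "wires (span_par R S) = mblock (wires R) (wires S)"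
proof (intro ext)
  fix a b
  let ?W = "{w \<in> apex (span_par R S). sleg (span_par R S) w = a \<and> tleg (span_par R S) w = b}"
  have W: "?W = In1 ` {w \<in> apex R. In1 (sleg R w) = a \<and> In1 (tleg R w) = b}
      \<union> In2 ` {w \<in> apex S. In2 (sleg S w) = a \<and> In2 (tleg S w) = b}"
    by (auto simp: span_par_def usum_def)
  show "wires (span_par R S) a b = mblock (wires R) (wires S) a b"
    unfolding wires_def[of "span_par R S"] W
    by (cases a; cases b) (simp_all add: mblock_def card_image wires_def)
qed

lemma mmult_assoc:
  assumes "finite B" "finite C"
  shows "mmult C (mmult B L M) N = mmult B L (mmult C M N)"
  unfolding mmult_def fun_eq_iff
  by (simp add: sum_distrib_left sum_distrib_right mult.assoc sum.swap[of _ C B])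

lemma mmult_add:
  "mmult B L (\<lambda>a b. M a b + N a b) = (\<lambda>a b. mmult B L M a b + mmult B L N a b)"
  "mmult B (\<lambda>a b. M a b + N a b) L = (\<lambda>a b. mmult B M L a b + mmult B N L a b)"
  by (simp_all add: mmult_def fun_eq_iff algebra_simps sum.distrib)

lemma mmult_mblock:
  assumes "finite B" "finite B'"
  shows "mmult (usum B B') (mblock M M') (mblock N N') = mblock (mmult B M N) (mmult B' M' N')"
proof (intro ext)
  fix a c 
  show "mmult (usum B B') (mblock M M') (mblock N N') a c = mblock (mmult B M N) (mmult B' M' N') a c"
    using assms by (cases a; cases c) (simp_all add: mmult_def sum_usum mblock_def)
qed

lemma mblock_add:
  "mblock (\<lambda>a b. M a b + M' a b) (\<lambda>a b. N a b + N' a b) = (\<lambda>a b. mblock M N a b + mblock M' N' a b)"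
proof (intro ext)
  fix a c
  show "mblock (\<lambda>a b. M a b + M' a b) (\<lambda>a b. N a b + N' a b) a c = mblock M N a c + mblock M' N' a c"
    by (cases a; cases c) (simp_all add: mblock_def)
qed


section \<open>Vectors and the linear maps of spans\<close>

lemma RR_ext: "x \<in> RR A \<Longrightarrow> y \<in> RR A \<Longrightarrow> (\<And>a. a \<in> A \<Longrightarrow> x a = y a) \<Longrightarrow> x = y"
  unfolding RR_def by (rule PiE_ext)

lemma pull_in_RR [simp]: "pull A f x \<in> RR A"
  by (simp add: RR_def pull_def)

lemma push_in_RR [simp]: "push A B g x \<in> RR B"
  by (simp add: RR_def push_def)

lemma vec_in_RR [simp]: "vadd A x y \<in> RR A" "vsub A x y \<in> RR A" "restrict x A \<in> RR A"
  by (simp_all add: RR_def vadd_def vsub_def)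

lemma span_map_in_RR [simp]: "span_map R B x \<in> RR B"
  by (simp add: span_map_def)

lemma vjoin_in_RR [simp]: "vjoin A B x y \<in> RR (usum A B)"
  by (simp add: RR_def vjoin_def)

lemma pull_apply [simp]: "a \<in> A \<Longrightarrow> pull A f x a = x (f a)"
  by (simp add: pull_def)

lemma vadd_apply [simp]: "a \<in> A \<Longrightarrow> vadd A x y a = x a + y a"
  by (simp add: vadd_def)

lemma vsub_apply [simp]: "a \<in> A \<Longrightarrow> vsub A x y a = x a - y a"
  by (simp add: vsub_def)

lemma vjoin_apply [simp]: "a \<in> A \<Longrightarrow> vjoin A B x y (In1 a) = x a" "b \<in> B \<Longrightarrow> vjoin A B x y (In2 b) = y b"
  by (simp_all add: vjoin_def)

lemma pull_id: "x \<in> RR A \<Longrightarrow> (\<And>a. a \<in> A \<Longrightarrow> f a = a) \<Longrightarrow> pull A f x = x"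
  by (rule RR_ext[of _ A]) auto

lemma pull_pull: "g \<in> B \<rightarrow> A \<Longrightarrow> pull B g (pull A f x) = pull B (f \<circ> g) x"
  by (rule RR_ext[of _ B]) (auto dest: funcset_mem)

lemma vjoin_pull: "x \<in> RR (usum A B) \<Longrightarrow> vjoin A B (pull A In1 x) (pull B In2 x) = x"
  by (rule RR_ext[of _ "usum A B"]) (auto elim: usumE)

lemma pull_In1_vjoin [simp]: "x \<in> RR A \<Longrightarrow> pull A In1 (vjoin A B x y) = x"
  by (rule RR_ext[of _ A]) auto

lemma pull_In2_vjoin [simp]: "y \<in> RR B \<Longrightarrow> pull B In2 (vjoin A B x y) = y"
  by (rule RR_ext[of _ B]) auto

lemma RR_usum_eqI:
  assumes "x \<in> RR (usum A B)" "y \<in> RR (usum A B)" "pull A In1 x = pull A In1 y" "pull B In2 x = pull B In2 y"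
  shows "x = y"
  using assms by (metis vjoin_pull)

text \<open>Grouping the sum over the wires into \<open>b\<close> by their sources.\<close>

lemma span_map_wires:
  assumes "is_span A B R" "finite A" "b \<in> B"
  shows "span_map R B x b = (\<Sum>a\<in>A. real (wires R a b) * x a)"
proof -
  let ?S = "\<lambda>a. {w \<in> apex R. sleg R w = a \<and> tleg R w = b}"
  have fin: "finite (apex R)" and leg: "sleg R \<in> apex R \<rightarrow> A" using assms by (auto simp: is_span_def)
  have "span_map R B x b = (\<Sum>w \<in> {w \<in> apex R. tleg R w = b}. x (sleg R w))"
    using assms by (simp add: span_map_def push_def pull_def)
  also have "\<dots> = (\<Sum>a\<in>A. \<Sum>w \<in> {w \<in> {w \<in> apex R. tleg R w = b}. sleg R w = a}. x (sleg R w))"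
    using fin leg assms by (intro sum.group[symmetric]) auto
  also have "\<dots> = (\<Sum>a\<in>A. real (wires R a b) * x a)"
  proof (rule sum.cong[OF refl])
    fix a
    have "{w \<in> {w \<in> apex R. tleg R w = b}. sleg R w = a} = ?S a" by auto
    then show "(\<Sum>w \<in> {w \<in> {w \<in> apex R. tleg R w = b}. sleg R w = a}. x (sleg R w)) = real (wires R a b) * x a"
      by (simp add: wires_def)
  qed
  finally show ?thesis .
qed

text \<open>The value at \<open>b\<close> only reads the sources of wires into \<open>b\<close>; all locality arguments about linear
  maps reduce to this.\<close>

lemma span_map_cong:
  assumes "is_span A B R" "b \<in> B" "\<And>a. (a, b) \<in> ends R \<Longrightarrow> x a = y a"
  shows "span_map R B x b = span_map R B y b"
  using assms by (auto simp: span_map_def push_def pull_def ends_def intro!: sum.cong)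

text \<open>Naturality of \<open>R\<^sup>*\<close> in the feet of the span, in terms of matrices.  The
  relabelling of the source reindexes the sum that defines \<open>R\<^sup>*\<close>, hence is a bijection.\<close>

lemma span_map_transport:
  assumes R: "is_span A B R" and R': "is_span A' B' R'" and "finite A" "finite A'"
    and b: "bij_betw b A A'" and c: "c \<in> B \<rightarrow> B'"
    and w: "\<And>x y. x \<in> A \<Longrightarrow> y \<in> B \<Longrightarrow> wires R' (b x) (c y) = wires R x y"
  shows "span_map R B (pull A b x) = pull B c (span_map R' B' x)"
proof (rule RR_ext[of _ B])
  fix y assume y: "y \<in> B"
  then have "pull B c (span_map R' B' x) y = (\<Sum>a\<in>A'. real (wires R' a (c y)) * x a)"
    using c R' \<open>finite A'\<close> by (simp add: span_map_wires Pi_iff)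
  also have "\<dots> = (\<Sum>a\<in>A. real (wires R' (b a) (c y)) * x (b a))"
    using b by (subst sum.reindex_bij_betw[OF b]) auto
  also have "\<dots> = span_map R B (pull A b x) y"
    using R y \<open>finite A\<close> w by (simp add: span_map_wires)
  finally show "span_map R B (pull A b x) y = pull B c (span_map R' B' x) y" by simp
qed auto

lemma span_map_comp:
  assumes R: "is_span A B R" and S: "is_span B C S" and fin: "finite A" "finite B"
  shows "span_map (span_comp R S) C x = span_map S C (span_map R B x)"
proof (rule RR_ext[of _ C])
  fix c assume "c \<in> C"
  have "span_map (span_comp R S) C x c = (\<Sum>a\<in>A. \<Sum>b\<in>B. real (wires R a b) * real (wires S b c) * x a)"
    using fin \<open>c \<in> C\<close>
    by (simp add: span_map_wires[OF is_span_comp[OF R S]] wires_comp[OF R S] mmult_def sum_distrib_right)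
  also have "\<dots> = (\<Sum>b\<in>B. \<Sum>a\<in>A. real (wires R a b) * real (wires S b c) * x a)"
    by (rule sum.swap)
  also have "\<dots> = (\<Sum>b\<in>B. real (wires S b c) * span_map R B x b)"
    using fin by (simp add: span_map_wires[OF R] sum_distrib_left mult_ac)
  also have "\<dots> = span_map S C (span_map R B x) c"
    using fin \<open>c \<in> C\<close> by (simp add: span_map_wires[OF S])
  finally show "span_map (span_comp R S) C x c = span_map S C (span_map R B x) c" .
qed auto

lemma span_map_plus:
  assumes R: "is_span A B R" and S: "is_span A B S" and fin: "finite A"
  shows "span_map (span_plus R S) B x = vadd B (span_map R B x) (span_map S B x)"
proof (rule RR_ext[of _ B])
  fix b assume b: "b \<in> B"
  have "finite (apex R)" "finite (apex S)" using R S by (auto simp: is_span_def)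
  then show "span_map (span_plus R S) B x b = vadd B (span_map R B x) (span_map S B x) b"
    using b fin by (simp add: span_map_wires[OF is_span_plus[OF R S]] span_map_wires[OF R]
      span_map_wires[OF S] wires_plus algebra_simps sum.distrib)
qed auto

lemma span_map_empty: "b \<in> B \<Longrightarrow> span_map empty_span B x b = 0"
  by (simp add: span_map_def empty_span_def push_def)

lemma span_map_par:
  assumes R: "is_span A B R" and S: "is_span A' B' S" and fin: "finite A" "finite A'"
  shows "pull B In1 (span_map (span_par R S) (usum B B') x) = span_map R B (pull A In1 x)"
    "pull B' In2 (span_map (span_par R S) (usum B B') x) = span_map S B' (pull A' In2 x)"
proof -
  show "pull B In1 (span_map (span_par R S) (usum B B') x) = span_map R B (pull A In1 x)"
    by (rule RR_ext[of _ B])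
      (use fin in \<open>auto simp: sum_usum wires_par span_map_wires[OF is_span_par[OF R S]] span_map_wires[OF R]\<close>)
  show "pull B' In2 (span_map (span_par R S) (usum B B') x) = span_map S B' (pull A' In2 x)"
    by (rule RR_ext[of _ B'])
      (use fin in \<open>auto simp: sum_usum wires_par span_map_wires[OF is_span_par[OF R S]] span_map_wires[OF S]\<close>)
qed

lemma span_map_vadd:
  assumes R: "is_span A B R" and "finite A"
  shows "span_map R B (vadd A x y) = vadd B (span_map R B x) (span_map R B y)"
  using assms by (auto intro!: RR_ext[of _ B] simp: span_map_wires algebra_simps sum.distrib)


section \<open>Walks, reachability and feedback\<close>

text \<open>Walks are only used through their end points, which turns the path conditions of the definitions
  into relational algebra.\<close>

lemma awalk_iff_rtrancl:
  assumes "wf_digraph G" "u \<in> verts G"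
  shows "(\<exists>p. pre_digraph.awalk G u p v) \<longleftrightarrow> (u, v) \<in> (arcs_ends G)\<^sup>*"
proof -
  interpret wf_digraph G by fact
  have "(\<exists>p. awalk u p v) \<longleftrightarrow> (\<exists>p. p = [] \<and> awalk u p v) \<or> (\<exists>p. p \<noteq> [] \<and> awalk u p v)" by blast
  also have "\<dots> \<longleftrightarrow> u = v \<or> (u, v) \<in> (arcs_ends G)\<^sup>+"
    using assms(2) by (auto simp: awalk_Nil_iff reachable1_awalk)
  finally show ?thesis by (simp add: rtrancl_eq_or_trancl) blast
qed

lemma acyclic_graph_iff:
  assumes "wf_digraph G"
  shows "acyclic_graph G \<longleftrightarrow> acyclic (arcs_ends G)"
proof -
  interpret wf_digraph G by fact
  have "(\<exists>p. cycle p) \<longleftrightarrow> (\<exists>u. (u, u) \<in> (arcs_ends G)\<^sup>+)"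
  proof
    assume "\<exists>p. cycle p"
    then show "\<exists>u. (u, u) \<in> (arcs_ends G)\<^sup>+"
      unfolding cycle_def reachable1_awalk by blast
  next
    assume "\<exists>u. (u, u) \<in> (arcs_ends G)\<^sup>+"
    then obtain p where "closed_w p"
      unfolding closed_w_def reachable1_awalk by blast
    then show "\<exists>p. cycle p" by (rule closed_w_imp_cycle)
  qed
  then show ?thesis unfolding acyclic_graph_def acyclic_def by blast
qed

text \<open>\<open>P\<close> is an inner relation with entries \<open>I\<close> and exits \<open>K\<close>, \<open>W\<close> is feedback from exits to
  entries, and \<open>Q\<close> is an outer relation which contains the feedback and every passage from an entry
  through \<open>P\<close> to an exit.  A path of the closed-up system that starts at an entry is a sequence of
  complete passages joined by feedback, which is a path of \<open>Q\<close>, and one last passage that has not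
  left \<open>P\<close> yet.\<close>

lemma feedback_reach:
  fixes P :: "'v rel" and I :: "('y \<times> 'v) set" and K :: "('v \<times> 'y) set" and W Q :: "'y rel"
  assumes W: "W \<subseteq> Q" and inner: "I O P\<^sup>* O K \<subseteq> Q"
    and I: "(y, x) \<in> I" and path: "(x, z) \<in> (P \<union> K O W O I)\<^sup>*"
  shows "(y, z) \<in> Q\<^sup>* O I O P\<^sup>*"
  using path
proof (induction rule: rtrancl_induct)
  case base
  show ?case using I by blast
next
  case (step z z')
  then obtain y' where y': "(y, y') \<in> Q\<^sup>*" "(y', z) \<in> I O P\<^sup>*" by blast
  from step.hyps(2) show ?case
  proof
    assume "(z, z') \<in> P"
    then have "(y', z') \<in> I O P\<^sup>*" using y'(2) by (blast intro: rtrancl_into_rtrancl)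
    then show ?thesis using y'(1) by blast
  next
    assume "(z, z') \<in> K O W O I"
    then obtain k w where k: "(z, k) \<in> K" "(k, w) \<in> W" "(w, z') \<in> I" by blast
    then have "(y', k) \<in> Q" using inner y'(2) by blast
    moreover have "(k, w) \<in> Q" using k W by blast
    ultimately have "(y, w) \<in> Q\<^sup>*" using y'(1) by (meson rtrancl_into_rtrancl)
    then show ?thesis using k(3) by blast
  qed
qed

lemma feedback_through:
  fixes P :: "'v rel" and I :: "('y \<times> 'v) set" and K :: "('v \<times> 'y) set" and W Q :: "'y rel"
  assumes W: "W \<subseteq> Q" and inner: "I O P\<^sup>* O K \<subseteq> Q"
    and I: "(y, x) \<in> I" and path: "(x, z) \<in> (P \<union> K O W O I)\<^sup>*" and K: "(z, k) \<in> K"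
  shows "(y, k) \<in> Q\<^sup>+"
proof -
  obtain y' where "(y, y') \<in> Q\<^sup>*" "(y', z) \<in> I O P\<^sup>*"
    using feedback_reach[OF W inner I path] by blast
  moreover from this K have "(y', k) \<in> Q" using inner by blast
  ultimately show ?thesis by (meson rtrancl_into_trancl1)
qed

text \<open>A cycle that avoids the feedback lies in \<open>P\<close>.  Otherwise cut it at a feedback step from \<open>k\<close> to
  \<open>w\<close>: the rest of the cycle leads from the entry \<open>w\<close> to the exit \<open>k\<close>, hence is a path of \<open>Q\<close>,
  and the step closes it to a cycle of \<open>Q\<close>.\<close>

lemma feedback_acyclic:
  fixes P :: "'v rel" and I :: "('y \<times> 'v) set" and K :: "('v \<times> 'y) set" and W Q :: "'y rel"
  assumes W: "W \<subseteq> Q" and inner: "I O P\<^sup>* O K \<subseteq> Q" and "acyclic P" "acyclic Q"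
  shows "acyclic (P \<union> K O W O I)"
proof (rule acyclicI, rule allI, rule notI)
  let ?R = "P \<union> K O W O I"
  have split: "(x, z) \<in> P\<^sup>+ \<or> (\<exists>k w. (x, k) \<in> ?R\<^sup>* O K \<and> (k, w) \<in> W \<and> (w, z) \<in> I O ?R\<^sup>*)"
    if "(x, z) \<in> ?R\<^sup>+" for x z
    using that
  proof (induction rule: trancl_induct)
    case (base z)
    then show ?case by blast
  next
    case (step z z')
    have zz: "(z, z') \<in> ?R" by fact
    from step.IH show ?case
    proof
      assume xz: "(x, z) \<in> P\<^sup>+"
      then have "(x, z) \<in> ?R\<^sup>*" by (metis Un_upper1 subsetD trancl_into_rtrancl trancl_mono)
      with zz xz show ?case by (blast intro: trancl_into_trancl)
    next
      assume "\<exists>k w. (x, k) \<in> ?R\<^sup>* O K \<and> (k, w) \<in> W \<and> (w, z) \<in> I O ?R\<^sup>*"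
      then obtain k w v where "(x, k) \<in> ?R\<^sup>* O K" "(k, w) \<in> W" "(w, v) \<in> I" "(v, z) \<in> ?R\<^sup>*" by blast
      moreover have "(v, z') \<in> ?R\<^sup>*" using calculation zz by (meson rtrancl_into_rtrancl)
      ultimately show ?case by blast
    qed
  qed
  fix x assume "(x, x) \<in> ?R\<^sup>+"
  from split[OF this] show False
  proof
    assume "(x, x) \<in> P\<^sup>+"
    then show False using \<open>acyclic P\<close> by (simp add: acyclic_def)
  next
    assume "\<exists>k w. (x, k) \<in> ?R\<^sup>* O K \<and> (k, w) \<in> W \<and> (w, x) \<in> I O ?R\<^sup>*"
    then obtain k w v z where *: "(x, z) \<in> ?R\<^sup>*" "(z, k) \<in> K" "(k, w) \<in> W" "(w, v) \<in> I" "(v, x) \<in> ?R\<^sup>*"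
      by blast
    then have "(v, z) \<in> ?R\<^sup>*" by (meson rtrancl_trans)
    then have "(w, k) \<in> Q\<^sup>+" using feedback_through[OF W inner] * by blast
    moreover have "(k, w) \<in> Q" using * W by blast
    ultimately have "(w, w) \<in> Q\<^sup>+" by (meson trancl_into_trancl)
    then show False using \<open>acyclic Q\<close> by (simp add: acyclic_def)
  qed
qed

text \<open>A disjoint union of two relations has no paths between the summands.\<close>

lemma trancl_disjoint_images:
  assumes "inj i" "inj j" "\<And>a b. i a \<noteq> j b"
    and "(x, y) \<in> (map_prod i i ` r \<union> map_prod j j ` s)\<^sup>+"
  shows "(\<exists>a b. x = i a \<and> y = i b \<and> (a, b) \<in> r\<^sup>+) \<or> (\<exists>a b. x = j a \<and> y = j b \<and> (a, b) \<in> s\<^sup>+)"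
  using assms(4)
proof (induction rule: trancl_induct)
  case (base y)
  then show ?case by blast
next
  case (step y z)
  from step.hyps(2) consider a b where "y = i a" "z = i b" "(a, b) \<in> r" | a b where "y = j a" "z = j b" "(a, b) \<in> s"
    by auto
  then show ?case
  proof cases
    case 1
    then show ?thesis using step.IH assms(1) assms(3) by (metis injD trancl_into_trancl)
  next
    case 2
    then show ?thesis using step.IH assms(2) assms(3) by (metis injD trancl_into_trancl)
  qed
qed

lemma acyclic_disjoint_images:
  assumes "inj i" "inj j" "\<And>a b. i a \<noteq> j b" "acyclic r" "acyclic s"
  shows "acyclic (map_prod i i ` r \<union> map_prod j j ` s)"
proof (rule acyclicI, rule allI, rule notI)
  fix x assume "(x, x) \<in> (map_prod i i ` r \<union> map_prod j j ` s)\<^sup>+"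
  from trancl_disjoint_images[OF assms(1-3) this] show False
    using assms(1,2,4,5) by (auto simp: acyclic_def dest: injD)
qed

lemma rtrancl_disjoint_images:
  assumes "inj i" "inj j" "\<And>a b. i a \<noteq> j b"
  shows "(i a, y) \<in> (map_prod i i ` r \<union> map_prod j j ` s)\<^sup>* \<Longrightarrow> \<exists>b. y = i b \<and> (a, b) \<in> r\<^sup>*"
    "(j c, y) \<in> (map_prod i i ` r \<union> map_prod j j ` s)\<^sup>* \<Longrightarrow> \<exists>d. y = j d \<and> (c, d) \<in> s\<^sup>*"
proof -
  assume "(i a, y) \<in> (map_prod i i ` r \<union> map_prod j j ` s)\<^sup>*"
  then have "y = i a \<or> (i a, y) \<in> (map_prod i i ` r \<union> map_prod j j ` s)\<^sup>+"
    by (auto simp: rtrancl_eq_or_trancl)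
  then show "\<exists>b. y = i b \<and> (a, b) \<in> r\<^sup>*"
    using trancl_disjoint_images[OF assms, of "i a" y r s] assms
    by (metis injD rtrancl.rtrancl_refl trancl_into_rtrancl)
next
  assume "(j c, y) \<in> (map_prod i i ` r \<union> map_prod j j ` s)\<^sup>*"
  then have "y = j c \<or> (j c, y) \<in> (map_prod i i ` r \<union> map_prod j j ` s)\<^sup>+"
    by (auto simp: rtrancl_eq_or_trancl)
  then show "\<exists>d. y = j d \<and> (c, d) \<in> s\<^sup>*"
    using trancl_disjoint_images[OF assms, of "j c" y r s] assms
    by (metis injD rtrancl.rtrancl_refl trancl_into_rtrancl)
qed


section \<open>Wiring diagrams and their composition\<close>

text \<open>The functors are defined on classes as unions over all representatives; such a union collapses when
  every representative gives the same class.\<close>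

lemma UN_equiv_class_eq:
  assumes "equiv A r" "a \<in> A" "\<And>b. (a, b) \<in> r \<Longrightarrow> g b = c"
  shows "(\<Union>b\<in>r `` {a}. g b) = c"
proof -
  have "a \<in> r `` {a}" using assms(1,2) by (rule equiv_class_self)
  then show ?thesis using assms(3) by blast
qed

lemma UN2_equiv_class_eq:
  assumes "equiv A r" "equiv B s" "a \<in> A" "b \<in> B"
    and "\<And>a' b'. (a, a') \<in> r \<Longrightarrow> (b, b') \<in> s \<Longrightarrow> g a' b' = c"
  shows "(\<Union>a'\<in>r `` {a}. \<Union>b'\<in>s `` {b}. g a' b') = c"
  by (intro UN_equiv_class_eq[OF assms(1,3)] UN_equiv_class_eq[OF assms(2,4)] assms(5))

lemma dboxesD: "X \<in> dboxes \<Longrightarrow> finite (ins X)" "X \<in> dboxes \<Longrightarrow> finite (outs X)"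
   "X \<in> dboxes \<Longrightarrow> dep X \<subseteq> ins X \<times> outs X"
  by (simp_all add: dboxes_def)

lemma wiringsD: "f \<in> wirings X Y \<Longrightarrow> is_span (ins Y) (ins X) (win f)"
  "f \<in> wirings X Y \<Longrightarrow> is_span (outs X) (ins X) (wtr f)"
  "f \<in> wirings X Y \<Longrightarrow> is_span (outs X) (outs Y) (wout f)"
  by (simp_all add: wirings_def)

lemma wiring_rel_iff: "(f, g) \<in> wiring_rel X Y \<longleftrightarrow> f \<in> wirings X Y \<and> g \<in> wirings X Y \<and>
    wires (win f) = wires (win g) \<and> wires (wtr f) = wires (wtr g) \<and> wires (wout f) = wires (wout g)"
proof (cases "f \<in> wirings X Y \<and> g \<in> wirings X Y")
  case True
  then have "finite (apex (win f))" "finite (apex (win g))" "finite (apex (wtr f))"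
    "finite (apex (wtr g))" "finite (apex (wout f))" "finite (apex (wout g))"
    by (simp_all add: wirings_def is_span_def)
  then show ?thesis using True by (simp add: wiring_rel_def span_iso_iff_wires)
qed (auto simp: wiring_rel_def)

lemma equiv_wiring_rel: "equiv (wirings X Y) (wiring_rel X Y)"
  by (rule equivI) (auto simp: wiring_rel_iff refl_on_def intro!: symI transI)

lemma wiring_class_eqI: "(f, g) \<in> wiring_rel X Y \<Longrightarrow> wiring_class X Y f = wiring_class X Y g"
  unfolding wiring_class_def using equiv_wiring_rel by (rule equiv_class_eq)

lemma map_prod_relcomp:
  assumes "inj h"
  shows "(map_prod f h ` R) O (map_prod h g ` S) = map_prod f g ` (R O S)"
proof (intro equalityI subsetI)
  fix p assume "p \<in> (map_prod f h ` R) O (map_prod h g ` S)"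
  then obtain a b b' c where *: "(a, b) \<in> R" "(b', c) \<in> S" "h b = h b'" "p = (f a, g c)" by auto
  then have "(a, c) \<in> R O S" using injD[OF assms] by blast
  then show "p \<in> map_prod f g ` (R O S)" using * by (intro image_eqI[of _ _ "(a, c)"]) simp_all
next
  fix p assume "p \<in> map_prod f g ` (R O S)"
  then obtain a b c where *: "(a, b) \<in> R" "(b, c) \<in> S" "p = (f a, g c)" by auto
  then have "(f a, h b) \<in> map_prod f h ` R" "(h b, g c) \<in> map_prod h g ` S"
    by (auto intro: image_eqI[of _ _ "(a, b)"] image_eqI[of _ _ "(b, c)"])
  then show "p \<in> (map_prod f h ` R) O (map_prod h g ` S)" using * by blast
qed

text \<open>The edges of the graph \<open>f(W) +\<^sub>X d\<^sub>X\<close> as a relation on the ports, inputs on the left and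
  outputs on the right.\<close>

definition trel :: "'a dbox \<Rightarrow> 'a wiring \<Rightarrow> ('a univ + 'a univ) rel" where
  "trel X f = map_prod Inr Inl ` ends (wtr f) \<union> map_prod Inl Inr ` dep X"

lemma arcs_ends_trace_graph: "arcs_ends (trace_graph X f) = trel X f"
  by (simp add: arcs_ends_conv trace_graph_def trel_def ends_def Plus_def image_Un image_image map_prod_def split_beta)

lemma wf_trace_graph:
  assumes "X \<in> dboxes" "f \<in> wirings X Y"
  shows "wf_digraph (trace_graph X f)"
proof
  fix e assume "e \<in> arcs (trace_graph X f)"
  then show "tail (trace_graph X f) e \<in> verts (trace_graph X f)"
    and "head (trace_graph X f) e \<in> verts (trace_graph X f)"
    using assms by (auto simp: trace_graph_def dboxes_def wirings_def is_span_def Pi_iff)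
qed

text \<open>The representatives of the morphisms of \<open>dDWD\<close>, with the graph conditions in relational form.\<close>

definition dwiring :: "'a dbox \<Rightarrow> 'a dbox \<Rightarrow> 'a wiring \<Rightarrow> bool" where
  "dwiring X Y f \<longleftrightarrow> X \<in> dboxes \<and> Y \<in> dboxes \<and> f \<in> wirings X Y \<and> acyclic (trel X f) \<and>
     (\<forall>y x k z. (y, x) \<in> ends (win f) \<longrightarrow> (Inl x, Inr k) \<in> (trel X f)\<^sup>* \<longrightarrow> (k, z) \<in> ends (wout f) \<longrightarrow>
        (y, z) \<in> dep Y)"

lemma dwiringD: "dwiring X Y f \<Longrightarrow> X \<in> dboxes" "dwiring X Y f \<Longrightarrow> Y \<in> dboxes"
   "dwiring X Y f \<Longrightarrow> f \<in> wirings X Y" "dwiring X Y f \<Longrightarrow> acyclic (trel X f)"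
   "dwiring X Y f \<Longrightarrow> (y, x) \<in> ends (win f) \<Longrightarrow> (Inl x, Inr k) \<in> (trel X f)\<^sup>* \<Longrightarrow> (k, z) \<in> ends (wout f)
      \<Longrightarrow> (y, z) \<in> dep Y"
  by (simp_all add: dwiring_def)

lemma dwiring_span:
  assumes "dwiring X Y f"
  shows "is_span (ins Y) (ins X) (win f)" "is_span (outs X) (ins X) (wtr f)" "is_span (outs X) (outs Y) (wout f)"
  using wiringsD[OF dwiringD(3)[OF assms]] .

lemma dwiring_finite:
  assumes "dwiring X Y f"
  shows "finite (ins X)" "finite (outs X)" "finite (ins Y)" "finite (outs Y)"
  using dboxesD(1,2)[OF dwiringD(1)[OF assms]] dboxesD(1,2)[OF dwiringD(2)[OF assms]] .

lemma dwiring_iff: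
  "dwiring X Y f \<longleftrightarrow> X \<in> dboxes \<and> Y \<in> dboxes \<and> f \<in> wirings X Y \<and>
     dep_image X f \<subseteq> dep Y \<and> acyclic_graph (trace_graph X f)"
proof (cases "X \<in> dboxes \<and> Y \<in> dboxes \<and> f \<in> wirings X Y")
  case True
  then have wf: "wf_digraph (trace_graph X f)" using wf_trace_graph by blast
  have walk: "(\<exists>p. pre_digraph.awalk (trace_graph X f) (Inl x) p (Inr k)) \<longleftrightarrow> (Inl x, Inr k) \<in> (trel X f)\<^sup>*"
    if "(y, x) \<in> ends (win f)" for x y k
  proof -
    have "Inl x \<in> verts (trace_graph X f)"
      using that ends_subset[OF wiringsD(1)[of f X Y]] True by (auto simp: trace_graph_def)
    then show ?thesis using awalk_iff_rtrancl[OF wf] by (simp add: arcs_ends_trace_graph)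
  qed
  have "dep_image X f = {(y, z). \<exists>x k. (y, x) \<in> ends (win f) \<and>
      (\<exists>p. pre_digraph.awalk (trace_graph X f) (Inl x) p (Inr k)) \<and> (k, z) \<in> ends (wout f)}"
    by (fastforce simp: dep_image_def ends_def)
  also have "\<dots> = {(y, z). \<exists>x k. (y, x) \<in> ends (win f) \<and> (Inl x, Inr k) \<in> (trel X f)\<^sup>* \<and> (k, z) \<in> ends (wout f)}"
    using walk by blast
  finally have image: "dep_image X f = \<dots>" .
  have "dep_image X f \<subseteq> dep Y \<longleftrightarrow> (\<forall>y x k z. (y, x) \<in> ends (win f) \<longrightarrow>
      (Inl x, Inr k) \<in> (trel X f)\<^sup>* \<longrightarrow> (k, z) \<in> ends (wout f) \<longrightarrow> (y, z) \<in> dep Y)"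
    unfolding image by blast
  then show ?thesis
    using True by (simp add: dwiring_def acyclic_graph_iff[OF wf] arcs_ends_trace_graph conj_commute)
qed (auto simp: dwiring_def)

lemma wiring_rel_ends:
  assumes "(f, g) \<in> wiring_rel X Y"
  shows "ends (win f) = ends (win g)" "ends (wtr f) = ends (wtr g)" "ends (wout f) = ends (wout g)"
proof -
  have f: "f \<in> wirings X Y" and g: "g \<in> wirings X Y" and eq: "wires (win f) = wires (win g)"
    "wires (wtr f) = wires (wtr g)" "wires (wout f) = wires (wout g)"
    using assms by (simp_all add: wiring_rel_iff)
  show "ends (win f) = ends (win g)" "ends (wtr f) = ends (wtr g)" "ends (wout f) = ends (wout g)"
    by (rule ends_cong[OF wiringsD(1)[OF f] wiringsD(1)[OF g] eq(1)]
      ends_cong[OF wiringsD(2)[OF f] wiringsD(2)[OF g] eq(2)]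
      ends_cong[OF wiringsD(3)[OF f] wiringsD(3)[OF g] eq(3)])+
qed

lemma dwiring_cong: "dwiring X Y f \<Longrightarrow> (f, g) \<in> wiring_rel X Y \<Longrightarrow> dwiring X Y g"
  using wiring_rel_ends[of f g X Y] by (simp add: dwiring_def trel_def wiring_rel_iff)

definition arrow :: "'a dbox \<Rightarrow> 'a dbox \<Rightarrow> 'a wiring \<Rightarrow> 'a darrow" where
  "arrow X Y f = (X, Y, wiring_class X Y f)"

lemma arrow_eqI: "(f, g) \<in> wiring_rel X Y \<Longrightarrow> arrow X Y f = arrow X Y g"
  by (simp add: arrow_def wiring_class_eqI)

lemma dDWD_simps [simp]:
  "Obj dDWD = dboxes" "Comp dDWD = dcomp" "TensorO dDWD = dtensor" "TensorA dDWD = dtensor_arrow"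
  "UnitO dDWD = dunit" "Ident dDWD X = darrow_of_bij X X id id"
  "Assoc dDWD X Y Z = darrow_of_bij (dtensor (dtensor X Y) Z) (dtensor X (dtensor Y Z)) uassoc uassoc"
  "LUnit dDWD X = darrow_of_bij (dtensor dunit X) X ucodiag ucodiag"
  "RUnit dDWD X = darrow_of_bij (dtensor X dunit) X ucodiag ucodiag"
  by (simp_all add: dDWD_def)

lemma in_hom_dDWD: "a \<in> hom dDWD X Y \<longleftrightarrow> (\<exists>f. dwiring X Y f \<and> a = arrow X Y f)"
  by (auto simp: hom_def dDWD_def darrows_def dwiring_iff arrow_def)

lemma wiring_comp_in: "f \<in> wirings X Y \<Longrightarrow> g \<in> wirings Y Z \<Longrightarrow> wiring_comp g f \<in> wirings X Z"
  by (auto simp: wirings_def wiring_comp_def intro!: is_span_comp is_span_plus)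

lemma wires_wiring_comp:
  assumes "f \<in> wirings X Y" "g \<in> wirings Y Z" "finite (ins Y)" "finite (outs Y)"
  shows "wires (win (wiring_comp g f)) = mmult (ins Y) (wires (win g)) (wires (win f))"
    "wires (wtr (wiring_comp g f)) = (\<lambda>a b. wires (wtr f) a b +
       mmult (ins Y) (mmult (outs Y) (wires (wout f)) (wires (wtr g))) (wires (win f)) a b)"
    "wires (wout (wiring_comp g f)) = mmult (outs Y) (wires (wout f)) (wires (wout g))"
proof -
  note f = wiringsD[OF assms(1)] and g = wiringsD[OF assms(2)]
  note c1 = is_span_comp[OF f(3) g(2)]
  note c2 = is_span_comp[OF c1 f(1)]
  have fin: "finite (apex (wtr f))" "finite (apex (span_comp (span_comp (wout f) (wtr g)) (win f)))"
    using f c2 by (simp_all add: is_span_def)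
  show "wires (win (wiring_comp g f)) = mmult (ins Y) (wires (win g)) (wires (win f))"
    using assms(3) by (simp add: wiring_comp_def wires_comp[OF g(1) f(1)])
  show "wires (wout (wiring_comp g f)) = mmult (outs Y) (wires (wout f)) (wires (wout g))"
    using assms(4) by (simp add: wiring_comp_def wires_comp[OF f(3) g(3)])
  show "wires (wtr (wiring_comp g f)) = (\<lambda>a b. wires (wtr f) a b +
       mmult (ins Y) (mmult (outs Y) (wires (wout f)) (wires (wtr g))) (wires (win f)) a b)"
    using assms(3,4) fin
    by (simp add: wiring_comp_def fun_eq_iff wires_plus wires_comp[OF c1 f(1)] wires_comp[OF f(3) g(2)])
qed

lemma wiring_comp_cong:
  assumes "(f, f') \<in> wiring_rel X Y" "(g, g') \<in> wiring_rel Y Z" "finite (ins Y)" "finite (outs Y)"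
  shows "(wiring_comp g f, wiring_comp g' f') \<in> wiring_rel X Z"
  using assms wiring_comp_in[of f X Y g Z] wiring_comp_in[of f' X Y g' Z]
  by (simp add: wiring_rel_iff wires_wiring_comp[of _ X Y _ Z])

text \<open>Feedback with the trace of \<open>f\<close> as the inner relation and the trace of \<open>g\<close> as the outer one.  The
  dependency of \<open>Y\<close> bounds the passages through \<open>f\<close>, which is the hypothesis on the outer relation.\<close>

lemma dwiring_comp:
  fixes X :: "'a dbox"
  assumes f: "dwiring X Y f" and g: "dwiring Y Z g"
  shows "dwiring X Z (wiring_comp g f)"
proof -
  define I :: "(('a univ + 'a univ) \<times> ('a univ + 'a univ)) set" where "I = map_prod Inl Inl ` ends (win f)"
  define K :: "(('a univ + 'a univ) \<times> ('a univ + 'a univ)) set" where "K = map_prod Inr Inr ` ends (wout f)"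
  define W :: "(('a univ + 'a univ) \<times> ('a univ + 'a univ)) set" where "W = map_prod Inr Inl ` ends (wtr g)"
  have tr: "trel X (wiring_comp g f) = trel X f \<union> K O W O I"
  proof -
    have "K O W O I = map_prod Inr Inl ` (ends (wout f) O ends (wtr g) O ends (win f))"
      by (simp add: I_def K_def W_def map_prod_relcomp)
    then show ?thesis
      by (simp add: trel_def wiring_comp_def ends_plus ends_comp image_Un O_assoc Un_ac)
  qed
  have WQ: "W \<subseteq> trel Y g" by (auto simp: W_def trel_def)
  have inner: "I O (trel X f)\<^sup>* O K \<subseteq> trel Y g"
    using dwiringD(5)[OF f] by (auto simp: I_def K_def trel_def)
  have "acyclic (trel X (wiring_comp g f))"
    unfolding tr using WQ inner dwiringD(4)[OF f] dwiringD(4)[OF g] by (rule feedback_acyclic)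
  moreover have "(y, z) \<in> dep Z" if y: "(y, x) \<in> ends (win (wiring_comp g f))"
    and p: "(Inl x, Inr k) \<in> (trel X (wiring_comp g f))\<^sup>*"
    and z: "(k, z) \<in> ends (wout (wiring_comp g f))" for x y z k
  proof -
    from y obtain y' where y': "(y, y') \<in> ends (win g)" "(y', x) \<in> ends (win f)"
      by (auto simp: wiring_comp_def ends_comp)
    from z obtain z' where z': "(k, z') \<in> ends (wout f)" "(z', z) \<in> ends (wout g)"
      by (auto simp: wiring_comp_def ends_comp)
    have "(Inl y', Inl x) \<in> I" "(Inr k, Inr z') \<in> K" using y' z' by (auto simp: I_def K_def)
    then have "(Inl y', Inr z') \<in> (trel Y g)\<^sup>+"
      using feedback_through[OF WQ inner] p[unfolded tr] by blast
    then show ?thesis using dwiringD(5)[OF g y'(1) _ z'(2)] by (blast intro: trancl_into_rtrancl)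
  qed
  ultimately show ?thesis
    using f g by (auto simp: dwiring_def wiring_comp_in)
qed

lemma dcomp_arrow:
  assumes "dwiring X Y f" "dwiring Y Z g"
  shows "dcomp (arrow Y Z g) (arrow X Y f) = arrow X Z (wiring_comp g f)"
proof -
  note fin = dboxesD[OF dwiringD(2)[OF assms(1)]]
  have "(\<Union>g'\<in>wiring_rel Y Z `` {g}. \<Union>f'\<in>wiring_rel X Y `` {f}. wiring_class X Z (wiring_comp g' f'))
    = wiring_class X Z (wiring_comp g f)"
  proof (rule UN2_equiv_class_eq[OF equiv_wiring_rel equiv_wiring_rel])
    fix g' f' assume "(g, g') \<in> wiring_rel Y Z" "(f, f') \<in> wiring_rel X Y"
    then have "(wiring_comp g f, wiring_comp g' f') \<in> wiring_rel X Z"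
      using fin by (simp add: wiring_comp_cong)
    then show "wiring_class X Z (wiring_comp g' f') = wiring_class X Z (wiring_comp g f)"
      by (rule wiring_class_eqI[symmetric])
  qed (use assms in \<open>simp_all add: dwiringD\<close>)
  then show ?thesis by (simp add: dcomp_def arrow_def wiring_class_def)
qed

text \<open>Associativity and bilinearity of the matrix product.\<close>

lemma wiring_comp_assoc:
  assumes f: "f \<in> wirings W X" and g: "g \<in> wirings X Y" and h: "h \<in> wirings Y Z"
    and fin: "finite (ins X)" "finite (outs X)" "finite (ins Y)" "finite (outs Y)"
  shows "(wiring_comp h (wiring_comp g f), wiring_comp (wiring_comp h g) f) \<in> wiring_rel W Z"
  using fin wires_wiring_comp[OF f g] wires_wiring_comp[OF g h]
    wires_wiring_comp[OF wiring_comp_in[OF f g] h] wires_wiring_comp[OF f wiring_comp_in[OF g h]]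
    wiring_comp_in[OF wiring_comp_in[OF f g] h] wiring_comp_in[OF f wiring_comp_in[OF g h]]
  by (simp add: wiring_rel_iff mmult_assoc mmult_add add.assoc)


section \<open>Wiring diagrams of bijections\<close>

text \<open>The input and output matrices are the graphs of the two port maps, and there is no trace.\<close>

lemma wires_of_bij [simp]:
  "wires (win (wiring_of_bij X b c)) y x = (if x \<in> ins X \<and> b x = y then 1 else 0)"
  "wires (wtr (wiring_of_bij X b c)) y x = 0"
  "wires (wout (wiring_of_bij X b c)) k z = (if k \<in> outs X \<and> c k = z then 1 else 0)"
proof -
  have "{w \<in> ins X. b w = y \<and> w = x} = (if x \<in> ins X \<and> b x = y then {x} else {})" by auto
  then show "wires (win (wiring_of_bij X b c)) y x = (if x \<in> ins X \<and> b x = y then 1 else 0)"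
    by (simp add: wiring_of_bij_def wires_def)
  have "{w \<in> outs X. w = k \<and> c w = z} = (if k \<in> outs X \<and> c k = z then {k} else {})" by auto
  then show "wires (wout (wiring_of_bij X b c)) k z = (if k \<in> outs X \<and> c k = z then 1 else 0)"
    by (simp add: wiring_of_bij_def wires_def)
qed (simp add: wiring_of_bij_def)

lemma ends_of_bij: "ends (win (wiring_of_bij X b c)) = (\<lambda>x. (b x, x)) ` ins X"
  "ends (wtr (wiring_of_bij X b c)) = {}"
  "ends (wout (wiring_of_bij X b c)) = (\<lambda>k. (k, c k)) ` outs X"
  by (simp_all add: ends_def wiring_of_bij_def empty_span_def)

lemma wiring_of_bij_in:
  assumes "X \<in> dboxes" "b \<in> ins X \<rightarrow> ins Y" "c \<in> outs X \<rightarrow> outs Y"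
  shows "wiring_of_bij X b c \<in> wirings X Y"
  using assms by (simp add: wirings_def wiring_of_bij_def is_span_def dboxes_def is_span_empty[unfolded is_span_def])

lemma mmult_delta_right:
  assumes "finite B" "b0 \<in> B" "\<And>b. b \<in> B \<Longrightarrow> N b c = (if b = b0 then 1 else 0)"
  shows "mmult B M N a c = M a b0"
proof -
  have "mmult B M N a c = (\<Sum>b\<in>B. if b = b0 then M a b else 0)"
    unfolding mmult_def by (rule sum.cong) (simp_all add: assms(3))
  then show ?thesis using assms(1,2) by simp
qed

lemma mmult_delta_left:
  assumes "finite B" "b0 \<in> B" "\<And>b. b \<in> B \<Longrightarrow> M a b = (if b = b0 then 1 else 0)"
  shows "mmult B M N a c = N b0 c"
proof -
  have "mmult B M N a c = (\<Sum>b\<in>B. if b = b0 then N b c else 0)"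
    unfolding mmult_def by (rule sum.cong) (simp_all add: assms(3))
  then show ?thesis using assms(1,2) by simp
qed

lemma wiring_relI:
  assumes "f \<in> wirings X Y" "g \<in> wirings X Y"
    and "\<And>y x. y \<in> ins Y \<Longrightarrow> x \<in> ins X \<Longrightarrow> wires (win f) y x = wires (win g) y x"
    and "\<And>k x. k \<in> outs X \<Longrightarrow> x \<in> ins X \<Longrightarrow> wires (wtr f) k x = wires (wtr g) k x"
    and "\<And>k z. k \<in> outs X \<Longrightarrow> z \<in> outs Y \<Longrightarrow> wires (wout f) k z = wires (wout g) k z"
  shows "(f, g) \<in> wiring_rel X Y"
  unfolding wiring_rel_iff
  using assms wires_ext[OF wiringsD(1)[OF assms(1)] wiringsD(1)[OF assms(2)]]
    wires_ext[OF wiringsD(2)[OF assms(1)] wiringsD(2)[OF assms(2)]]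
    wires_ext[OF wiringsD(3)[OF assms(1)] wiringsD(3)[OF assms(2)]] by blast

text \<open>\<open>f\<close> and \<open>f'\<close> have the same matrices up to the relabellings \<open>b\<close>, \<open>c\<close> of the ports of their
  source and \<open>b'\<close>, \<open>c'\<close> of the ports of their target.\<close>

definition wiring_square :: "('a univ \<Rightarrow> 'a univ) \<Rightarrow> ('a univ \<Rightarrow> 'a univ) \<Rightarrow>
    ('a univ \<Rightarrow> 'a univ) \<Rightarrow> ('a univ \<Rightarrow> 'a univ) \<Rightarrow>
    'a dbox \<Rightarrow> 'a dbox \<Rightarrow> 'a wiring \<Rightarrow> 'a dbox \<Rightarrow> 'a dbox \<Rightarrow> 'a wiring \<Rightarrow> bool" where
  "wiring_square b c b' c' X Y f X' Y' f' \<longleftrightarrow>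
     bij_betw b (ins X) (ins X') \<and> bij_betw c (outs X) (outs X') \<and>
     bij_betw b' (ins Y) (ins Y') \<and> bij_betw c' (outs Y) (outs Y') \<and>
     (\<forall>y\<in>ins Y. \<forall>x\<in>ins X. wires (win f') (b' y) (b x) = wires (win f) y x) \<and>
     (\<forall>k\<in>outs X. \<forall>x\<in>ins X. wires (wtr f') (c k) (b x) = wires (wtr f) k x) \<and>
     (\<forall>k\<in>outs X. \<forall>z\<in>outs Y. wires (wout f') (c k) (c' z) = wires (wout f) k z)"

text \<open>Composing with a diagram of port maps on the inside relabels the ports, since one factor of each
  matrix product has a single nonzero entry in the row or column in question.\<close>

lemma wires_comp_of_bij:
  assumes box: "X \<in> dboxes" "X' \<in> dboxes" and b: "b \<in> ins X \<rightarrow> ins X'" and c: "c \<in> outs X \<rightarrow> outs X'"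
    and f: "f \<in> wirings X' Y"
  shows "x \<in> ins X \<Longrightarrow> wires (win (wiring_comp f (wiring_of_bij X b c))) y x = wires (win f) y (b x)"
    "k \<in> outs X \<Longrightarrow> x \<in> ins X \<Longrightarrow> wires (wtr (wiring_comp f (wiring_of_bij X b c))) k x = wires (wtr f) (c k) (b x)"
    "k \<in> outs X \<Longrightarrow> wires (wout (wiring_comp f (wiring_of_bij X b c))) k z = wires (wout f) (c k) z"
proof -
  note fin = dboxesD(1,2)[OF box(2)]
  note w = wires_wiring_comp[OF wiring_of_bij_in[OF box(1) b c] f fin]
  have bx: "b x \<in> ins X'" if "x \<in> ins X" for x using b that by blast
  have ck: "c k \<in> outs X'" if "k \<in> outs X" for k using c that by blast
  have left: "mmult (outs X') (wires (wout (wiring_of_bij X b c))) M k z = M (c k) z" if "k \<in> outs X" for M k z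
    using fin ck that by (intro mmult_delta_left) auto
  have right: "mmult (ins X') M (wires (win (wiring_of_bij X b c))) y x = M y (b x)" if "x \<in> ins X" for M y x
    using fin bx that by (intro mmult_delta_right) auto
  show "x \<in> ins X \<Longrightarrow> wires (win (wiring_comp f (wiring_of_bij X b c))) y x = wires (win f) y (b x)"
    "k \<in> outs X \<Longrightarrow> x \<in> ins X \<Longrightarrow> wires (wtr (wiring_comp f (wiring_of_bij X b c))) k x = wires (wtr f) (c k) (b x)"
    "k \<in> outs X \<Longrightarrow> wires (wout (wiring_comp f (wiring_of_bij X b c))) k z = wires (wout f) (c k) z"
    by (simp_all add: w left right)
qed

lemma wires_of_bij_comp:
  assumes f: "f \<in> wirings X Y" and box: "Y \<in> dboxes" and bij: "bij_betw b (ins Y) (ins Y')" "bij_betw c (outs Y) (outs Y')"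
  shows "y \<in> ins Y \<Longrightarrow> wires (win (wiring_comp (wiring_of_bij Y b c) f)) (b y) x = wires (win f) y x"
    "wires (wtr (wiring_comp (wiring_of_bij Y b c) f)) k x = wires (wtr f) k x"
    "z \<in> outs Y \<Longrightarrow> wires (wout (wiring_comp (wiring_of_bij Y b c) f)) k (c z) = wires (wout f) k z"
proof -
  note fin = dboxesD(1,2)[OF box]
  note w = wires_wiring_comp[OF f wiring_of_bij_in[OF box bij[THEN bij_betw_imp_funcset]] fin]
  show "y \<in> ins Y \<Longrightarrow> wires (win (wiring_comp (wiring_of_bij Y b c) f)) (b y) x = wires (win f) y x"
    unfolding w using fin bij by (intro mmult_delta_left) (auto simp: bij_betw_def inj_on_def)
  show "z \<in> outs Y \<Longrightarrow> wires (wout (wiring_comp (wiring_of_bij Y b c) f)) k (c z) = wires (wout f) k z"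
    unfolding w using fin bij by (intro mmult_delta_right) (auto simp: bij_betw_def inj_on_def)
  show "wires (wtr (wiring_comp (wiring_of_bij Y b c) f)) k x = wires (wtr f) k x"
    unfolding w by (simp add: mmult_def)
qed

text \<open>A square of relabellings is a commuting square of wiring diagrams.\<close>

lemma wiring_square_comp:
  assumes sq: "wiring_square b c b' c' X Y f X' Y' f'"
    and f: "f \<in> wirings X Y" "f' \<in> wirings X' Y'"
    and box: "X \<in> dboxes" "X' \<in> dboxes" "Y \<in> dboxes"
  shows "(wiring_comp f' (wiring_of_bij X b c), wiring_comp (wiring_of_bij Y b' c') f) \<in> wiring_rel X Y'"
proof (rule wiring_relI)
  have bij: "bij_betw b (ins X) (ins X')" "bij_betw c (outs X) (outs X')"
     "bij_betw b' (ins Y) (ins Y')" "bij_betw c' (outs Y) (outs Y')"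
    using sq by (simp_all add: wiring_square_def)
  note bc = bij(1,2)[THEN bij_betw_imp_funcset] and bc' = bij(3,4)[THEN bij_betw_imp_funcset]
  note pre = wires_comp_of_bij[OF box(1,2) bc f(2)] and post = wires_of_bij_comp[OF f(1) box(3) bij(3,4)]
  show "wiring_comp f' (wiring_of_bij X b c) \<in> wirings X Y'" "wiring_comp (wiring_of_bij Y b' c') f \<in> wirings X Y'"
    by (rule wiring_comp_in[OF wiring_of_bij_in[OF box(1) bc] f(2)] wiring_comp_in[OF f(1) wiring_of_bij_in[OF box(3) bc']])+
  show "wires (win (wiring_comp f' (wiring_of_bij X b c))) z x = wires (win (wiring_comp (wiring_of_bij Y b' c') f)) z x"
    if "z \<in> ins Y'" "x \<in> ins X" for z x
  proof -
    have "z \<in> b' ` ins Y" using that by (simp add: bij_betw_imp_surj_on[OF bij(3)])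
    then obtain y where "z = b' y" "y \<in> ins Y" by (rule imageE)
    then show ?thesis using that sq by (simp add: pre post wiring_square_def)
  qed
  show "wires (wtr (wiring_comp f' (wiring_of_bij X b c))) k x = wires (wtr (wiring_comp (wiring_of_bij Y b' c') f)) k x"
    if "k \<in> outs X" "x \<in> ins X" for k x
    using that sq by (simp add: pre post wiring_square_def)
  show "wires (wout (wiring_comp f' (wiring_of_bij X b c))) k z = wires (wout (wiring_comp (wiring_of_bij Y b' c') f)) k z"
    if "k \<in> outs X" "z \<in> outs Y'" for k z
  proof -
    have "z \<in> c' ` outs Y" using that by (simp add: bij_betw_imp_surj_on[OF bij(4)])
    then obtain y where "z = c' y" "y \<in> outs Y" by (rule imageE)
    then show ?thesis using that sq by (simp add: pre post wiring_square_def)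
  qed
qed

lemma wiring_square_refl:
  assumes "wires (win f') = wires (win f)" "wires (wtr f') = wires (wtr f)" "wires (wout f') = wires (wout f)"
  shows "wiring_square id id id id X Y f X Y f'"
  by (simp add: wiring_square_def assms)

lemma wiring_comp_ident_left:
  assumes f: "f \<in> wirings X Y" and Y: "Y \<in> dboxes"
  shows "(wiring_comp (wiring_of_bij Y id id) f, f) \<in> wiring_rel X Y"
proof (rule wiring_relI)
  show "wiring_comp (wiring_of_bij Y id id) f \<in> wirings X Y"
    by (rule wiring_comp_in[OF f]) (rule wiring_of_bij_in[OF Y]; simp)
qed (use f wires_of_bij_comp[OF f Y bij_betw_id bij_betw_id] in simp_all)

lemma wiring_of_bij_comp:
  assumes X: "X \<in> dboxes" and Y: "Y \<in> dboxes"
    and b: "b \<in> ins X \<rightarrow> ins Y" and c: "c \<in> outs X \<rightarrow> outs Y" and b': "b' \<in> ins Y \<rightarrow> ins Z" and c': "c' \<in> outs Y \<rightarrow> outs Z"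
  shows "(wiring_comp (wiring_of_bij Y b' c') (wiring_of_bij X b c), wiring_of_bij X (b' \<circ> b) (c' \<circ> c)) \<in> wiring_rel X Z"
proof (rule wiring_relI)
  note B = wiring_of_bij_in[OF X b c] wiring_of_bij_in[OF Y b' c']
  note pre = wires_comp_of_bij[OF X Y b c B(2)]
  show "wiring_comp (wiring_of_bij Y b' c') (wiring_of_bij X b c) \<in> wirings X Z" by (rule wiring_comp_in[OF B])
  show "wiring_of_bij X (b' \<circ> b) (c' \<circ> c) \<in> wirings X Z"
    using b c b' c' by (intro wiring_of_bij_in[OF X]) auto
  have bx: "b x \<in> ins Y" if "x \<in> ins X" for x using b that by blast
  have ck: "c k \<in> outs Y" if "k \<in> outs X" for k using c that by blast
  show "wires (win (wiring_comp (wiring_of_bij Y b' c') (wiring_of_bij X b c))) z x =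
      wires (win (wiring_of_bij X (b' \<circ> b) (c' \<circ> c))) z x" if "x \<in> ins X" for z x
    using that bx by (simp add: pre)
  show "wires (wtr (wiring_comp (wiring_of_bij Y b' c') (wiring_of_bij X b c))) k x =
      wires (wtr (wiring_of_bij X (b' \<circ> b) (c' \<circ> c))) k x" if "k \<in> outs X" "x \<in> ins X" for k x
    using that by (simp add: pre)
  show "wires (wout (wiring_comp (wiring_of_bij Y b' c') (wiring_of_bij X b c))) k z =
      wires (wout (wiring_of_bij X (b' \<circ> b) (c' \<circ> c))) k z" if "k \<in> outs X" for k z
    using that ck by (simp add: pre)
qed

text \<open>Relabellings of ports that match the dependencies exactly, so that they are invertible in \<open>dDWD\<close>.\<close>

definition box_iso :: "'a dbox \<Rightarrow> 'a dbox \<Rightarrow> ('a univ \<Rightarrow> 'a univ) \<Rightarrow> ('a univ \<Rightarrow> 'a univ) \<Rightarrow> bool" where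
  "box_iso X Y b c \<longleftrightarrow> X \<in> dboxes \<and> Y \<in> dboxes \<and> bij_betw b (ins X) (ins Y) \<and>
     bij_betw c (outs X) (outs Y) \<and> map_prod b c ` dep X = dep Y"

lemma box_isoD: "box_iso X Y b c \<Longrightarrow> X \<in> dboxes" "box_iso X Y b c \<Longrightarrow> Y \<in> dboxes"
  "box_iso X Y b c \<Longrightarrow> b \<in> ins X \<rightarrow> ins Y" "box_iso X Y b c \<Longrightarrow> c \<in> outs X \<rightarrow> outs Y"
  "box_iso X Y b c \<Longrightarrow> wiring_of_bij X b c \<in> wirings X Y"
  by (auto simp: box_iso_def intro!: wiring_of_bij_in bij_betw_imp_funcset)

lemma box_iso_ident: "X \<in> dboxes \<Longrightarrow> box_iso X X id id"
  by (simp add: box_iso_def map_prod_ident prod.map_id)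

lemma box_iso_comp:
  assumes "box_iso X Y b c" "box_iso Y Z b' c'"
  shows "box_iso X Z (b' \<circ> b) (c' \<circ> c)"
proof -
  have "map_prod (b' \<circ> b) (c' \<circ> c) ` dep X = map_prod b' c' ` map_prod b c ` dep X"
    by (simp add: image_image prod.map_comp comp_def split_beta map_prod_def)
  then show ?thesis using assms by (auto simp: box_iso_def intro: bij_betw_trans)
qed

lemma box_iso_inverse:
  assumes "box_iso X Y b c"
  shows "box_iso Y X (inv_into (ins X) b) (inv_into (outs X) c)"
proof -
  have bij: "bij_betw b (ins X) (ins Y)" "bij_betw c (outs X) (outs Y)" and d: "map_prod b c ` dep X = dep Y"
    and dX: "dep X \<subseteq> ins X \<times> outs X"
    using assms by (auto simp: box_iso_def dboxes_def)
  have "map_prod (inv_into (ins X) b) (inv_into (outs X) c) ` dep Y =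
     (\<lambda>p. (inv_into (ins X) b (b (fst p)), inv_into (outs X) c (c (snd p)))) ` dep X"
    unfolding d[symmetric] image_image by (simp add: map_prod_def split_beta)
  also have "\<dots> = (\<lambda>p. p) ` dep X"
    by (rule image_cong) (use dX bij in \<open>auto simp: bij_betw_inv_into_left\<close>)
  finally show ?thesis
    using assms by (simp add: box_iso_def bij_betw_inv_into)
qed

text \<open>This square reduces the action of any relabelling to the action of an identity.\<close>

lemma wiring_square_of_bij:
  assumes "box_iso X Y b c"
  shows "wiring_square b c id id X Y (wiring_of_bij X b c) Y Y (wiring_of_bij Y id id)"
  using assms box_isoD(3,4)[OF assms] by (simp add: wiring_square_def box_iso_def Pi_iff)

text \<open>The trace graph of a relabelling consists of dependency edges only.  They lead from inputs to
  outputs, so no two of them can be composed.\<close>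

lemma dwiring_of_bij:
  assumes iso: "box_iso X Y b c"
  shows "dwiring X Y (wiring_of_bij X b c)"
proof -
  let ?T = "trel X (wiring_of_bij X b c)"
  have T: "?T = map_prod Inl Inr ` dep X" by (simp add: trel_def ends_of_bij)
  have trancl: "?T\<^sup>+ = ?T" by (rule trancl_id) (auto simp: T trans_def)
  then have "acyclic ?T" by (auto simp: acyclic_def T)
  moreover have "(x, k) \<in> dep X" if "(Inl x, Inr k) \<in> ?T\<^sup>*" for x k
    using that trancl by (auto simp: rtrancl_eq_or_trancl T)
  ultimately show ?thesis
    using iso box_isoD[OF iso] by (fastforce simp: dwiring_def box_iso_def ends_of_bij)
qed

lemma darrow_of_bij_arrow: "darrow_of_bij X Y b c = arrow X Y (wiring_of_bij X b c)"
  by (simp add: darrow_of_bij_def arrow_def)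

lemma darrow_of_bij_hom: "box_iso X Y b c \<Longrightarrow> darrow_of_bij X Y b c \<in> hom dDWD X Y"
  using dwiring_of_bij[of X Y b c] unfolding in_hom_dDWD darrow_of_bij_arrow by blast

lemma darrow_of_bij_cong:
  assumes "box_iso X Y b c" "\<And>x. x \<in> ins X \<Longrightarrow> b x = b' x" "\<And>k. k \<in> outs X \<Longrightarrow> c k = c' k"
  shows "darrow_of_bij X Y b c = darrow_of_bij X Y b' c'"
  unfolding darrow_of_bij_arrow
proof (rule arrow_eqI, rule wiring_relI)
  have "b' \<in> ins X \<rightarrow> ins Y" "c' \<in> outs X \<rightarrow> outs Y"
    using box_isoD(3,4)[OF assms(1)] assms(2,3) by (simp_all add: Pi_iff)
  then show "wiring_of_bij X b' c' \<in> wirings X Y"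
    using box_isoD(1)[OF assms(1)] by (rule wiring_of_bij_in[rotated])
qed (use assms box_isoD(5)[OF assms(1)] in auto)

lemma dcomp_of_bij:
  assumes "box_iso X Y b c" "box_iso Y Z b' c'"
  shows "dcomp (darrow_of_bij Y Z b' c') (darrow_of_bij X Y b c) = darrow_of_bij X Z (b' \<circ> b) (c' \<circ> c)"
  using assms dcomp_arrow[OF dwiring_of_bij dwiring_of_bij] wiring_of_bij_comp[of X Y b c b' Z c'] box_isoD
  by (metis darrow_of_bij_arrow arrow_eqI)

lemma darrow_of_bij_iso:
  assumes "box_iso X Y b c"
  shows "iso_arrow dDWD (darrow_of_bij X Y b c)"
proof -
  note inv = box_iso_inverse[OF assms]
  have bij: "bij_betw b (ins X) (ins Y)" "bij_betw c (outs X) (outs Y)" using assms by (simp_all add: box_iso_def)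
  have "dcomp (darrow_of_bij Y X (inv_into (ins X) b) (inv_into (outs X) c)) (darrow_of_bij X Y b c)
    = darrow_of_bij X X id id"
    unfolding dcomp_of_bij[OF assms inv]
    by (rule darrow_of_bij_cong[OF box_iso_comp[OF assms inv]]) (use bij in \<open>simp_all add: bij_betw_inv_into_left\<close>)
  moreover have "dcomp (darrow_of_bij X Y b c) (darrow_of_bij Y X (inv_into (ins X) b) (inv_into (outs X) c))
    = darrow_of_bij Y Y id id"
    unfolding dcomp_of_bij[OF inv assms]
    by (rule darrow_of_bij_cong[OF box_iso_comp[OF inv assms]]) (use bij in \<open>simp_all add: bij_betw_inv_into_right\<close>)
  moreover have "Dom dDWD (darrow_of_bij X Y b c) = X" "Cod dDWD (darrow_of_bij X Y b c) = Y"
     "darrow_of_bij X Y b c \<in> Arr dDWD"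
    using darrow_of_bij_hom[OF assms] by (simp_all add: hom_def)
  ultimately show ?thesis
    using darrow_of_bij_hom[OF inv] by (auto simp: iso_arrow_def)
qed

lemma dcomp_square:
  assumes sq: "wiring_square b c b' c' X Y f X' Y' f'" and f: "dwiring X Y f" "dwiring X' Y' f'"
    and iso: "box_iso X X' b c" "box_iso Y Y' b' c'"
  shows "dcomp (arrow X' Y' f') (darrow_of_bij X X' b c) = dcomp (darrow_of_bij Y Y' b' c') (arrow X Y f)"
  unfolding darrow_of_bij_arrow dcomp_arrow[OF dwiring_of_bij[OF iso(1)] f(2)] dcomp_arrow[OF f(1) dwiring_of_bij[OF iso(2)]]
  by (rule arrow_eqI, rule wiring_square_comp[OF sq]) (use f in \<open>simp_all add: dwiringD\<close>)


section \<open>Disjoint unions of wiring diagrams\<close>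

lemma dtensor_sel [simp]: "ins (dtensor X Y) = usum (ins X) (ins Y)" "outs (dtensor X Y) = usum (outs X) (outs Y)"
  "dep (dtensor X Y) = map_prod In1 In1 ` dep X \<union> map_prod In2 In2 ` dep Y"
  by (simp_all add: dtensor_def)

lemma dunit_sel [simp]: "ins dunit = {}" "outs dunit = {}" "dep dunit = {}"
  by (simp_all add: dunit_def)

lemma dtensor_dboxes: "X \<in> dboxes \<Longrightarrow> Y \<in> dboxes \<Longrightarrow> dtensor X Y \<in> dboxes"
  by (auto simp: dboxes_def)

lemma dunit_dboxes: "dunit \<in> dboxes"
  by (simp add: dboxes_def)

lemma wiring_par_in: "f \<in> wirings X Y \<Longrightarrow> g \<in> wirings X' Y' \<Longrightarrow>
    wiring_par f g \<in> wirings (dtensor X X') (dtensor Y Y')"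
  by (simp add: wirings_def wiring_par_def is_span_par)

lemma wires_wiring_par [simp]:
  "wires (win (wiring_par f g)) = mblock (wires (win f)) (wires (win g))"
  "wires (wtr (wiring_par f g)) = mblock (wires (wtr f)) (wires (wtr g))"
  "wires (wout (wiring_par f g)) = mblock (wires (wout f)) (wires (wout g))"
  by (simp_all add: wiring_par_def wires_par)

text \<open>The trace graph of a disjoint union is a disjoint union, so both conditions can be checked on the
  summands.\<close>

lemma dwiring_par:
  assumes f: "dwiring X Y f" and g: "dwiring X' Y' g"
  shows "dwiring (dtensor X X') (dtensor Y Y') (wiring_par f g)"
proof -
  let ?i = "map_sum In1 In1 :: 'a univ + 'a univ \<Rightarrow> 'a univ + 'a univ"
  let ?j = "map_sum In2 In2 :: 'a univ + 'a univ \<Rightarrow> 'a univ + 'a univ"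
  have ij: "inj ?i" "inj ?j" "\<And>a b. ?i a \<noteq> ?j b"
    by (auto simp: inj_on_def map_sum_def split: sum.splits)
  have tr: "trel (dtensor X X') (wiring_par f g) = map_prod ?i ?i ` trel X f \<union> map_prod ?j ?j ` trel X' g"
    by (auto simp: trel_def wiring_par_def ends_par image_Un image_image map_prod_def split_beta)
  have "acyclic (trel (dtensor X X') (wiring_par f g))"
    unfolding tr by (rule acyclic_disjoint_images) (use ij f g in \<open>auto dest: dwiringD\<close>)
  moreover have "(y, z) \<in> dep (dtensor Y Y')" if y: "(y, x) \<in> ends (win (wiring_par f g))"
    and p: "(Inl x, Inr k) \<in> (trel (dtensor X X') (wiring_par f g))\<^sup>*"
    and z: "(k, z) \<in> ends (wout (wiring_par f g))" for x y z k
  proof -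
    have z': "(\<exists>k1 z1. k = In1 k1 \<and> z = In1 z1 \<and> (k1, z1) \<in> ends (wout f)) \<or>
        (\<exists>k2 z2. k = In2 k2 \<and> z = In2 z2 \<and> (k2, z2) \<in> ends (wout g))"
      using z by (auto simp: wiring_par_def ends_par)
    consider y1 x1 where "y = In1 y1" "x = In1 x1" "(y1, x1) \<in> ends (win f)"
      | y2 x2 where "y = In2 y2" "x = In2 x2" "(y2, x2) \<in> ends (win g)"
      using y by (auto simp: wiring_par_def ends_par)
    then show ?thesis
    proof cases
      case 1
      obtain b where b: "Inr k = ?i b" "(Inl x1, b) \<in> (trel X f)\<^sup>*"
        using rtrancl_disjoint_images(1)[OF ij, of "Inl x1" "Inr k" "trel X f" "trel X' g"] p 1 by (auto simp: tr)
      then obtain k1 where "b = Inr k1" "k = In1 k1" by (cases b) auto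
      then show ?thesis using z' 1 b dwiringD(5)[OF f 1(3), of k1] by (auto intro: image_eqI[of _ _ "(_, _)"])
    next
      case 2
      obtain b where b: "Inr k = ?j b" "(Inl x2, b) \<in> (trel X' g)\<^sup>*"
        using rtrancl_disjoint_images(2)[OF ij, of "Inl x2" "Inr k" "trel X f" "trel X' g"] p 2 by (auto simp: tr)
      then obtain k1 where "b = Inr k1" "k = In2 k1" by (cases b) auto
      then show ?thesis using z' 2 b dwiringD(5)[OF g 2(3), of k1] by (auto intro: image_eqI[of _ _ "(_, _)"])
    qed
  qed
  ultimately show ?thesis
    using f g unfolding dwiring_def by (blast intro: dtensor_dboxes wiring_par_in)
qed

lemma dtensor_arrow_arrow:
  assumes "dwiring X Y f" "dwiring X' Y' g"
  shows "dtensor_arrow (arrow X Y f) (arrow X' Y' g) = arrow (dtensor X X') (dtensor Y Y') (wiring_par f g)"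
proof -
  have "(\<Union>f'\<in>wiring_rel X Y `` {f}. \<Union>g'\<in>wiring_rel X' Y' `` {g}.
      wiring_class (dtensor X X') (dtensor Y Y') (wiring_par f' g'))
    = wiring_class (dtensor X X') (dtensor Y Y') (wiring_par f g)"
  proof (rule UN2_equiv_class_eq[OF equiv_wiring_rel equiv_wiring_rel])
    fix f' g' assume "(f, f') \<in> wiring_rel X Y" "(g, g') \<in> wiring_rel X' Y'"
    then have "(wiring_par f g, wiring_par f' g') \<in> wiring_rel (dtensor X X') (dtensor Y Y')"
      by (simp add: wiring_rel_iff wiring_par_in)
    then show "wiring_class (dtensor X X') (dtensor Y Y') (wiring_par f' g') =
       wiring_class (dtensor X X') (dtensor Y Y') (wiring_par f g)"
      by (rule wiring_class_eqI[symmetric])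
  qed (use assms in \<open>simp_all add: dwiringD\<close>)
  then show ?thesis by (simp add: dtensor_arrow_def arrow_def wiring_class_def)
qed

lemma wiring_par_comp:
  fixes X Y Z X' Y' Z' :: "'a dbox"
  assumes f: "f \<in> wirings X Y" "g \<in> wirings Y Z" and f': "f' \<in> wirings X' Y'" "g' \<in> wirings Y' Z'"
    and fin: "finite (ins Y)" "finite (outs Y)" "finite (ins Y')" "finite (outs Y')"
  shows "(wiring_par (wiring_comp g f) (wiring_comp g' f'), wiring_comp (wiring_par g g') (wiring_par f f'))
     \<in> wiring_rel (dtensor X X') (dtensor Z Z')"
  using wires_wiring_comp[OF f fin(1,2)] wires_wiring_comp[OF f' fin(3,4)]
    wires_wiring_comp[OF wiring_par_in[OF f(1) f'(1)] wiring_par_in[OF f(2) f'(2)]]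
    wiring_comp_in[OF wiring_par_in[OF f(1) f'(1)] wiring_par_in[OF f(2) f'(2)]]
    wiring_par_in[OF wiring_comp_in[OF f] wiring_comp_in[OF f']] fin
  by (simp add: wiring_rel_iff mmult_mblock mblock_add)

lemma bij_betw_umap:
  assumes "bij_betw f A B" "bij_betw g A' B'"
  shows "bij_betw (umap f g) (usum A A') (usum B B')"
  unfolding bij_betw_def
proof
  show "inj_on (umap f g) (usum A A')"
    using assms by (simp add: bij_betw_def inj_on_def)
  have "umap f g ` usum A A' = usum (f ` A) (g ` A')"
    by (simp add: usum_def image_Un image_image)
  then show "umap f g ` usum A A' = usum B B'"
    using assms by (simp add: bij_betw_def)
qed

lemma bij_betw_uassoc: "bij_betw uassoc (usum (usum A B) C) (usum A (usum B C))"
  unfolding bij_betw_def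
  by (simp add: inj_on_def) (simp add: usum_def image_Un image_image Un_assoc)

lemma bij_betw_ucodiag: "bij_betw ucodiag (usum {} A) A" "bij_betw ucodiag (usum A {}) A"
  unfolding bij_betw_def by (simp_all add: inj_on_def) (simp_all add: usum_def image_Un image_image)

lemma box_iso_umap:
  assumes "box_iso X Y b c" "box_iso X' Y' b' c'"
  shows "box_iso (dtensor X X') (dtensor Y Y') (umap b b') (umap c c')"
proof -
  have d: "map_prod b c ` dep X = dep Y" "map_prod b' c' ` dep X' = dep Y'"
    using assms by (simp_all add: box_iso_def)
  have "map_prod (umap b b') (umap c c') ` dep (dtensor X X') = dep (dtensor Y Y')"
    by (simp add: d[symmetric] image_Un image_image map_prod_def split_beta)
  then show ?thesis using assms by (simp add: box_iso_def dtensor_dboxes bij_betw_umap)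
qed

lemma box_iso_uassoc:
  assumes "X \<in> dboxes" "Y \<in> dboxes" "Z \<in> dboxes"
  shows "box_iso (dtensor (dtensor X Y) Z) (dtensor X (dtensor Y Z)) uassoc uassoc"
proof -
  have "map_prod uassoc uassoc ` dep (dtensor (dtensor X Y) Z) = dep (dtensor X (dtensor Y Z))"
    by (simp add: image_Un image_image map_prod_def split_beta Un_assoc)
  then show ?thesis using assms by (simp add: box_iso_def dtensor_dboxes bij_betw_uassoc)
qed

lemma box_iso_ucodiag:
  assumes "X \<in> dboxes"
  shows "box_iso (dtensor dunit X) X ucodiag ucodiag" "box_iso (dtensor X dunit) X ucodiag ucodiag"
proof -
  have "map_prod ucodiag ucodiag ` dep (dtensor dunit X) = dep X"
    "map_prod ucodiag ucodiag ` dep (dtensor X dunit) = dep X"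
    by (simp_all add: image_Un image_image map_prod_def split_beta)
  then show "box_iso (dtensor dunit X) X ucodiag ucodiag" "box_iso (dtensor X dunit) X ucodiag ucodiag"
    using assms by (simp_all add: box_iso_def dtensor_dboxes dunit_dboxes bij_betw_ucodiag)
qed

lemma wiring_par_of_bij:
  assumes "box_iso X Y b c" "box_iso X' Y' b' c'"
  shows "dtensor_arrow (darrow_of_bij X Y b c) (darrow_of_bij X' Y' b' c') =
    darrow_of_bij (dtensor X X') (dtensor Y Y') (umap b b') (umap c c')"
  unfolding darrow_of_bij_arrow dtensor_arrow_arrow[OF dwiring_of_bij[OF assms(1)] dwiring_of_bij[OF assms(2)]]
proof (rule arrow_eqI, rule wiring_relI)
  show "wiring_par (wiring_of_bij X b c) (wiring_of_bij X' b' c') \<in> wirings (dtensor X X') (dtensor Y Y')"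
    by (rule wiring_par_in[OF box_isoD(5)[OF assms(1)] box_isoD(5)[OF assms(2)]])
  show "wiring_of_bij (dtensor X X') (umap b b') (umap c c') \<in> wirings (dtensor X X') (dtensor Y Y')"
    by (rule box_isoD(5)[OF box_iso_umap[OF assms]])
qed (auto simp: mblock_def split: univ.splits elim!: usumE)

lemma wiring_square_uassoc:
  "wiring_square uassoc uassoc uassoc uassoc
    (dtensor (dtensor X Y) Z) (dtensor (dtensor X' Y') Z') (wiring_par (wiring_par f g) h)
    (dtensor X (dtensor Y Z)) (dtensor X' (dtensor Y' Z')) (wiring_par f (wiring_par g h))"
  by (simp add: wiring_square_def bij_betw_uassoc)

lemma wiring_square_lunit:
  "wiring_square ucodiag ucodiag ucodiag ucodiag
    (dtensor dunit X) (dtensor dunit Y) (wiring_par g f) X Y f"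
  by (simp add: wiring_square_def bij_betw_ucodiag)

lemma wiring_square_runit:
  "wiring_square ucodiag ucodiag ucodiag ucodiag
    (dtensor X dunit) (dtensor Y dunit) (wiring_par f g) X Y f"
  by (simp add: wiring_square_def bij_betw_ucodiag)


section \<open>The monoidal category of wiring diagrams with dependencies\<close>

text \<open>The right unit law is the left one transported along the trivial square.\<close>

theorem category_dDWD: "category (dDWD :: ('a dbox, 'a darrow) moncat)"
proof
  fix f :: "'a darrow" assume "f \<in> Arr dDWD"
  then show "Dom dDWD f \<in> Obj dDWD" "Cod dDWD f \<in> Obj dDWD"
    by (auto simp: dDWD_def darrows_def)
next
  fix X :: "'a dbox" assume "X \<in> Obj dDWD"
  then show "Ident dDWD X \<in> hom dDWD X X"
    by (simp add: darrow_of_bij_hom box_iso_ident)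
next
  fix X Y Z :: "'a dbox" and f g assume "f \<in> hom dDWD X Y" "g \<in> hom dDWD Y Z"
  then show "Comp dDWD g f \<in> hom dDWD X Z"
    by (auto simp: in_hom_dDWD dcomp_arrow intro: dwiring_comp)
next
  fix X Y :: "'a dbox" and f assume "f \<in> hom dDWD X Y"
  then obtain w where w: "dwiring X Y w" "f = arrow X Y w" by (auto simp: in_hom_dDWD)
  note box = dwiringD(1,2)[OF w(1)]
  note iso = box_iso_ident[OF box(1)] box_iso_ident[OF box(2)]
  have left: "dcomp (darrow_of_bij Y Y id id) f = f"
    unfolding w(2) darrow_of_bij_arrow dcomp_arrow[OF w(1) dwiring_of_bij[OF iso(2)]]
    by (rule arrow_eqI, rule wiring_comp_ident_left[OF dwiringD(3)[OF w(1)] box(2)])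
  then show "Comp dDWD (Ident dDWD Y) f = f" by simp
  have "wiring_square id id id id X Y w X Y w" by (rule wiring_square_refl) simp_all
  from dcomp_square[OF this w(1) w(1) iso] left w(2)
  show "Comp dDWD f (Ident dDWD X) = f" by simp
next
  fix W X Y Z :: "'a dbox" and f g h
  assume "f \<in> hom dDWD W X" "g \<in> hom dDWD X Y" "h \<in> hom dDWD Y Z"
  then obtain u v w where u: "dwiring W X u" "f = arrow W X u" and v: "dwiring X Y v" "g = arrow X Y v"
    and w: "dwiring Y Z w" "h = arrow Y Z w" by (auto simp: in_hom_dDWD)
  have "arrow W Z (wiring_comp w (wiring_comp v u)) = arrow W Z (wiring_comp (wiring_comp w v) u)"
    by (rule arrow_eqI, rule wiring_comp_assoc) (use u v w in \<open>auto dest: dwiringD intro: dboxesD\<close>)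
  then show "Comp dDWD h (Comp dDWD g f) = Comp dDWD (Comp dDWD h g) f"
    using u v w by (simp add: dcomp_arrow dwiring_comp)
qed

text \<open>Associators and unitors are relabellings.  Naturality is \<open>dcomp_square\<close> for the relabelling squares,
  and pentagon and triangle compare two relabellings pointwise on ports.\<close>

theorem monoidal_category_dDWD: "monoidal_category (dDWD :: ('a dbox, 'a darrow) moncat)"
proof (intro monoidal_category.intro category_dDWD monoidal_category_axioms.intro)
  show "UnitO dDWD \<in> Obj dDWD" by (simp add: dunit_dboxes)
next
  fix X Y :: "'a dbox" assume XY: "X \<in> Obj dDWD" "Y \<in> Obj dDWD"
  then show "TensorO dDWD X Y \<in> Obj dDWD" by (simp add: dtensor_dboxes)
  then have iso: "box_iso X X id id" "box_iso Y Y id id" "box_iso (dtensor X Y) (dtensor X Y) id id"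
    using XY by (simp_all add: box_iso_ident)
  have "darrow_of_bij (dtensor X Y) (dtensor X Y) id id
    = darrow_of_bij (dtensor X Y) (dtensor X Y) (umap id id) (umap id id)"
    by (rule darrow_of_bij_cong[OF iso(3)]) (auto elim!: usumE)
  then show "TensorA dDWD (Ident dDWD X) (Ident dDWD Y) = Ident dDWD (TensorO dDWD X Y)"
    by (simp add: wiring_par_of_bij[OF iso(1,2)])
next
  fix X Y X' Y' :: "'a dbox" and f f' assume "f \<in> hom dDWD X Y" "f' \<in> hom dDWD X' Y'"
  then show "TensorA dDWD f f' \<in> hom dDWD (TensorO dDWD X X') (TensorO dDWD Y Y')"
    by (auto simp: in_hom_dDWD dtensor_arrow_arrow intro: dwiring_par)
next
  fix X Y Z X' Y' Z' :: "'a dbox" and f g f' g'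
  assume "f \<in> hom dDWD X Y" "g \<in> hom dDWD Y Z" "f' \<in> hom dDWD X' Y'" "g' \<in> hom dDWD Y' Z'"
  then obtain u v u' v' where u: "dwiring X Y u" "f = arrow X Y u" and v: "dwiring Y Z v" "g = arrow Y Z v"
    and u': "dwiring X' Y' u'" "f' = arrow X' Y' u'" and v': "dwiring Y' Z' v'" "g' = arrow Y' Z' v'"
    by (auto simp: in_hom_dDWD)
  have "arrow (dtensor X X') (dtensor Z Z') (wiring_par (wiring_comp v u) (wiring_comp v' u'))
    = arrow (dtensor X X') (dtensor Z Z') (wiring_comp (wiring_par v v') (wiring_par u u'))"
    by (rule arrow_eqI, rule wiring_par_comp) (use u v u' v' in \<open>auto dest: dwiringD intro: dboxesD\<close>)
  then show "TensorA dDWD (Comp dDWD g f) (Comp dDWD g' f') = Comp dDWD (TensorA dDWD g g') (TensorA dDWD f f')"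
    using u v u' v' by (simp add: dcomp_arrow dwiring_comp dtensor_arrow_arrow dwiring_par)
next
  fix X Y Z :: "'a dbox" assume "X \<in> Obj dDWD" "Y \<in> Obj dDWD" "Z \<in> Obj dDWD"
  then have iso: "box_iso (dtensor (dtensor X Y) Z) (dtensor X (dtensor Y Z)) uassoc uassoc"
    by (simp add: box_iso_uassoc)
  from darrow_of_bij_hom[OF this]
  show "Assoc dDWD X Y Z \<in> hom dDWD (TensorO dDWD (TensorO dDWD X Y) Z) (TensorO dDWD X (TensorO dDWD Y Z))"
    by simp
  from darrow_of_bij_iso[OF iso] show "iso_arrow dDWD (Assoc dDWD X Y Z)" by simp
next
  fix X Y Z X' Y' Z' :: "'a dbox" and f g h
  assume "f \<in> hom dDWD X X'" "g \<in> hom dDWD Y Y'" "h \<in> hom dDWD Z Z'"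
  then obtain u v w where u: "dwiring X X' u" "f = arrow X X' u" and v: "dwiring Y Y' v" "g = arrow Y Y' v"
    and w: "dwiring Z Z' w" "h = arrow Z Z' w" by (auto simp: in_hom_dDWD)
  note box = dwiringD(1,2)[OF u(1)] dwiringD(1,2)[OF v(1)] dwiringD(1,2)[OF w(1)]
  from dcomp_square[OF wiring_square_uassoc
      dwiring_par[OF dwiring_par[OF u(1) v(1)] w(1)] dwiring_par[OF u(1) dwiring_par[OF v(1) w(1)]]
      box_iso_uassoc[OF box(1,3,5)] box_iso_uassoc[OF box(2,4,6)]]
  show "Comp dDWD (Assoc dDWD X' Y' Z') (TensorA dDWD (TensorA dDWD f g) h) =
    Comp dDWD (TensorA dDWD f (TensorA dDWD g h)) (Assoc dDWD X Y Z)"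
    using u v w by (simp add: dtensor_arrow_arrow dwiring_par)
next
  fix X :: "'a dbox" assume "X \<in> Obj dDWD"
  then have iso: "box_iso (dtensor dunit X) X ucodiag ucodiag" "box_iso (dtensor X dunit) X ucodiag ucodiag"
    by (simp_all add: box_iso_ucodiag)
  show "LUnit dDWD X \<in> hom dDWD (TensorO dDWD (UnitO dDWD) X) X"
    using darrow_of_bij_hom[OF iso(1)] by simp
  show "iso_arrow dDWD (LUnit dDWD X)" using darrow_of_bij_iso[OF iso(1)] by simp
  show "RUnit dDWD X \<in> hom dDWD (TensorO dDWD X (UnitO dDWD)) X"
    using darrow_of_bij_hom[OF iso(2)] by simp
  show "iso_arrow dDWD (RUnit dDWD X)" using darrow_of_bij_iso[OF iso(2)] by simp
next
  fix X Y :: "'a dbox" and f assume "f \<in> hom dDWD X Y"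
  then obtain w where w: "dwiring X Y w" "f = arrow X Y w" by (auto simp: in_hom_dDWD)
  note box = dwiringD(1,2)[OF w(1)]
  note unit = dwiring_of_bij[OF box_iso_ident[OF dunit_dboxes]]
  from dcomp_square[OF wiring_square_lunit dwiring_par[OF unit w(1)] w(1)
      box_iso_ucodiag(1)[OF box(1)] box_iso_ucodiag(1)[OF box(2)]]
  show "Comp dDWD (LUnit dDWD Y) (TensorA dDWD (Ident dDWD (UnitO dDWD)) f) = Comp dDWD f (LUnit dDWD X)"
    unfolding w(2) by (simp add: darrow_of_bij_arrow dtensor_arrow_arrow[OF unit w(1)])
  from dcomp_square[OF wiring_square_runit dwiring_par[OF w(1) unit] w(1)
      box_iso_ucodiag(2)[OF box(1)] box_iso_ucodiag(2)[OF box(2)]]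
  show "Comp dDWD (RUnit dDWD Y) (TensorA dDWD f (Ident dDWD (UnitO dDWD))) = Comp dDWD f (RUnit dDWD X)"
    unfolding w(2) by (simp add: darrow_of_bij_arrow dtensor_arrow_arrow[OF w(1) unit])
next
  fix W X Y Z :: "'a dbox" assume "W \<in> Obj dDWD" "X \<in> Obj dDWD" "Y \<in> Obj dDWD" "Z \<in> Obj dDWD"
  then have box: "W \<in> dboxes" "X \<in> dboxes" "Y \<in> dboxes" "Z \<in> dboxes" "dtensor X Y \<in> dboxes"
    "dtensor Y Z \<in> dboxes" "dtensor W X \<in> dboxes" by (simp_all add: dtensor_dboxes)
  note a1 = box_iso_umap[OF box_iso_uassoc[OF box(1-3)] box_iso_ident[OF box(4)]]
    and a2 = box_iso_uassoc[OF box(1,5,4)]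
    and a3 = box_iso_umap[OF box_iso_ident[OF box(1)] box_iso_uassoc[OF box(2-4)]]
    and a4 = box_iso_uassoc[OF box(7,3,4)] and a5 = box_iso_uassoc[OF box(1,2,6)]
  show "Comp dDWD (TensorA dDWD (Ident dDWD W) (Assoc dDWD X Y Z))
      (Comp dDWD (Assoc dDWD W (TensorO dDWD X Y) Z) (TensorA dDWD (Assoc dDWD W X Y) (Ident dDWD Z))) =
    Comp dDWD (Assoc dDWD W X (TensorO dDWD Y Z)) (Assoc dDWD (TensorO dDWD W X) Y Z)"
    unfolding dDWD_simps wiring_par_of_bij[OF box_iso_uassoc[OF box(1-3)] box_iso_ident[OF box(4)]]
      wiring_par_of_bij[OF box_iso_ident[OF box(1)] box_iso_uassoc[OF box(2-4)]]
      dcomp_of_bij[OF a1 a2] dcomp_of_bij[OF box_iso_comp[OF a1 a2] a3] dcomp_of_bij[OF a4 a5]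
    by (rule darrow_of_bij_cong[OF box_iso_comp[OF box_iso_comp[OF a1 a2] a3]]) (auto elim!: usumE)
next
  fix X Y :: "'a dbox" assume "X \<in> Obj dDWD" "Y \<in> Obj dDWD"
  then have box: "X \<in> dboxes" "Y \<in> dboxes" by simp_all
  note a1 = box_iso_uassoc[OF box(1) dunit_dboxes box(2)]
    and a2 = box_iso_umap[OF box_iso_ident[OF box(1)] box_iso_ucodiag(1)[OF box(2)]]
  show "Comp dDWD (TensorA dDWD (Ident dDWD X) (LUnit dDWD Y)) (Assoc dDWD X (UnitO dDWD) Y) =
    TensorA dDWD (RUnit dDWD X) (Ident dDWD Y)"
    unfolding dDWD_simps wiring_par_of_bij[OF box_iso_ident[OF box(1)] box_iso_ucodiag(1)[OF box(2)]]
      wiring_par_of_bij[OF box_iso_ucodiag(2)[OF box(1)] box_iso_ident[OF box(2)]] dcomp_of_bij[OF a1 a2]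
    by (rule darrow_of_bij_cong[OF box_iso_comp[OF a1 a2]]) (auto elim!: usumE)
qed


section \<open>Lax monoidal functors from actions of wiring diagrams\<close>

text \<open>What \<open>SF\<close> and \<open>Mealy\<close> have in common: machines \<open>Mach X\<close> with interface \<open>X\<close>, on which wiring
  diagrams act up to the equivalence \<open>rel\<close>.  Machines with different interfaces are compared by
  \<open>iso b c\<close>, an isomorphism over the relabellings \<open>b\<close> of inputs and \<open>c\<close> of outputs; it is
  what makes associativity and unitality of \<open>par\<close> expressible before the coherence arrows act.\<close>

locale wiring_action =
  fixes Mach :: "'a dbox \<Rightarrow> 'e set" and rel :: "'a dbox \<Rightarrow> ('e \<times> 'e) set"
    and iso :: "('a univ \<Rightarrow> 'a univ) \<Rightarrow> ('a univ \<Rightarrow> 'a univ) \<Rightarrow> 'a dbox \<Rightarrow> 'a dbox \<Rightarrow> 'e \<Rightarrow> 'e \<Rightarrow> bool"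
    and act :: "'a dbox \<Rightarrow> 'a dbox \<Rightarrow> 'a wiring \<Rightarrow> 'e \<Rightarrow> 'e"
    and par :: "'a dbox \<Rightarrow> 'a dbox \<Rightarrow> 'e \<Rightarrow> 'e \<Rightarrow> 'e" and unit :: 'e
  assumes equiv_rel: "equiv (Mach X) (rel X)"
    and rel_iff: "(m, n) \<in> rel X \<longleftrightarrow> m \<in> Mach X \<and> n \<in> Mach X \<and> iso id id X X m n"
    and act_in: "dwiring X Y f \<Longrightarrow> m \<in> Mach X \<Longrightarrow> act X Y f m \<in> Mach Y"
    and act_iso: "wiring_square b c b' c' X Y f X' Y' f' \<Longrightarrow> dwiring X Y f \<Longrightarrow> dwiring X' Y' f' \<Longrightarrow>
      m \<in> Mach X \<Longrightarrow> m' \<in> Mach X' \<Longrightarrow> iso b c X X' m m' \<Longrightarrow> iso b' c' Y Y' (act X Y f m) (act X' Y' f' m')"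
    and act_ident: "X \<in> dboxes \<Longrightarrow> m \<in> Mach X \<Longrightarrow> (act X X (wiring_of_bij X id id) m, m) \<in> rel X"
    and act_comp: "dwiring X Y f \<Longrightarrow> dwiring Y Z g \<Longrightarrow> m \<in> Mach X \<Longrightarrow>
      (act X Z (wiring_comp g f) m, act Y Z g (act X Y f m)) \<in> rel Z"
    and par_in: "m \<in> Mach X \<Longrightarrow> n \<in> Mach Y \<Longrightarrow> par X Y m n \<in> Mach (dtensor X Y)"
    and par_cong: "(m, m') \<in> rel X \<Longrightarrow> (n, n') \<in> rel Y \<Longrightarrow> (par X Y m n, par X Y m' n') \<in> rel (dtensor X Y)"
    and par_natural: "dwiring X X' f \<Longrightarrow> dwiring Y Y' g \<Longrightarrow> m \<in> Mach X \<Longrightarrow> n \<in> Mach Y \<Longrightarrow>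
      (act (dtensor X Y) (dtensor X' Y') (wiring_par f g) (par X Y m n),
       par X' Y' (act X X' f m) (act Y Y' g n)) \<in> rel (dtensor X' Y')"
    and par_assoc: "iso uassoc uassoc (dtensor (dtensor X Y) Z) (dtensor X (dtensor Y Z))
      (par (dtensor X Y) Z (par X Y m n) k) (par X (dtensor Y Z) m (par Y Z n k))"
    and unit_in: "unit \<in> Mach dunit"
    and par_lunit: "iso ucodiag ucodiag (dtensor dunit X) X (par dunit X unit m) m"
    and par_runit: "iso ucodiag ucodiag (dtensor X dunit) X (par X dunit m unit) m"
begin

definition cls :: "'a dbox \<Rightarrow> 'e \<Rightarrow> 'e set" where
  "cls X m = rel X `` {m}"

definition class_functor :: "('a dbox, 'a darrow, 'e set) lax_data" where
  "class_functor = \<lparr>FObj = (\<lambda>X. Mach X // rel X),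
     FArr = (\<lambda>(X, Y, fs) M. \<Union>f\<in>fs. \<Union>m\<in>M. cls Y (act X Y f m)),
     Laxator = (\<lambda>X Y (M, N). \<Union>m\<in>M. \<Union>n\<in>N. cls (dtensor X Y) (par X Y m n)),
     LaxUnit = cls dunit unit\<rparr>"

lemma cls_eqI: "(m, n) \<in> rel X \<Longrightarrow> cls X m = cls X n"
  unfolding cls_def using equiv_rel by (rule equiv_class_eq)

lemma act_cong:
  assumes f: "dwiring X Y f" and ff: "(f, f') \<in> wiring_rel X Y" and mm: "(m, m') \<in> rel X"
  shows "(act X Y f m, act X Y f' m') \<in> rel Y"
proof -
  have f': "dwiring X Y f'" using f ff by (rule dwiring_cong)
  have "wiring_square id id id id X Y f X Y f'"
    using ff by (intro wiring_square_refl) (simp_all add: wiring_rel_iff)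
  from act_iso[OF this f f'] show ?thesis
    using mm act_in[OF f] act_in[OF f'] by (simp add: rel_iff)
qed

text \<open>Transport the action of the relabelling along \<open>iso\<close> to the action of the identity on \<open>n\<close>.  This
  gives the coherence laws of the laxator from the isomorphisms for \<open>par\<close>.\<close>

lemma act_of_bij:
  assumes box: "box_iso X Y b c" and m: "m \<in> Mach X" and n: "n \<in> Mach Y" and iso: "iso b c X Y m n"
  shows "(act X Y (wiring_of_bij X b c) m, n) \<in> rel Y"
proof -
  note Y = box_isoD(2)[OF box]
  note dw = dwiring_of_bij[OF box] dwiring_of_bij[OF box_iso_ident[OF Y]]
  have "(act X Y (wiring_of_bij X b c) m, act Y Y (wiring_of_bij Y id id) n) \<in> rel Y"
    using act_iso[OF wiring_square_of_bij[OF box] dw m n iso] act_in[OF dw(1) m] act_in[OF dw(2) n]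
    by (simp add: rel_iff)
  then show ?thesis using act_ident[OF Y n] equiv_rel by (meson equivE transD)
qed

lemma act_class:
  assumes f: "dwiring X Y f" and m: "m \<in> Mach X"
  shows "FArr class_functor (arrow X Y f) (cls X m) = cls Y (act X Y f m)"
proof -
  have "(\<Union>f'\<in>wiring_rel X Y `` {f}. \<Union>m'\<in>rel X `` {m}. cls Y (act X Y f' m')) = cls Y (act X Y f m)"
    by (rule UN2_equiv_class_eq[OF equiv_wiring_rel equiv_rel dwiringD(3)[OF f] m])
      (rule cls_eqI[OF act_cong[OF f], symmetric])
  then show ?thesis by (simp add: class_functor_def arrow_def wiring_class_def cls_def)
qed

lemma par_class:
  assumes m: "m \<in> Mach X" and n: "n \<in> Mach Y"
  shows "Laxator class_functor X Y (cls X m, cls Y n) = cls (dtensor X Y) (par X Y m n)"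
proof -
  have "(\<Union>m'\<in>rel X `` {m}. \<Union>n'\<in>rel Y `` {n}. cls (dtensor X Y) (par X Y m' n')) = cls (dtensor X Y) (par X Y m n)"
    by (rule UN2_equiv_class_eq[OF equiv_rel equiv_rel m n]) (rule cls_eqI[OF par_cong, symmetric])
  then show ?thesis by (simp add: class_functor_def cls_def)
qed

lemma FObjI: "m \<in> Mach X \<Longrightarrow> cls X m \<in> FObj class_functor X"
  by (auto simp: class_functor_def quotient_def cls_def)

lemma FObjE:
  assumes "M \<in> FObj class_functor X"
  obtains m where "m \<in> Mach X" "M = cls X m"
  using assms by (auto simp: class_functor_def quotient_def cls_def)

lemma LaxUnit: "LaxUnit class_functor = cls dunit unit"
  by (simp add: class_functor_def)

theorem lax_monoidal: "lax_monoidal_functor_to_Set (dDWD :: ('a dbox, 'a darrow) moncat) class_functor"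
proof (intro lax_monoidal_functor_to_Set.intro monoidal_category_dDWD lax_monoidal_functor_to_Set_axioms.intro)
  fix X Y :: "'a dbox" and f assume "f \<in> hom dDWD X Y"
  then show "FArr class_functor f \<in> FObj class_functor X \<rightarrow> FObj class_functor Y"
    by (auto simp: in_hom_dDWD act_class elim!: FObjE intro!: FObjI act_in)
next
  fix X :: "'a dbox" and M assume "X \<in> Obj dDWD" "M \<in> FObj class_functor X"
  then obtain m where "X \<in> dboxes" "m \<in> Mach X" "M = cls X m" by (auto elim: FObjE)
  then show "FArr class_functor (Ident dDWD X) M = M"
    by (simp add: darrow_of_bij_arrow act_class[OF dwiring_of_bij[OF box_iso_ident]] cls_eqI[OF act_ident])
next
  fix X Y Z :: "'a dbox" and f g M assume "f \<in> hom dDWD X Y" "g \<in> hom dDWD Y Z" "M \<in> FObj class_functor X"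
  then obtain u v m where "dwiring X Y u" "f = arrow X Y u" "dwiring Y Z v" "g = arrow Y Z v"
    "m \<in> Mach X" "M = cls X m" by (auto simp: in_hom_dDWD elim: FObjE)
  then show "FArr class_functor (Comp dDWD g f) M = FArr class_functor g (FArr class_functor f M)"
    by (simp add: dcomp_arrow dwiring_comp act_class act_in cls_eqI[OF act_comp])
next
  fix X Y :: "'a dbox"
  show "Laxator class_functor X Y \<in> FObj class_functor X \<times> FObj class_functor Y \<rightarrow> FObj class_functor (TensorO dDWD X Y)"
    by (auto simp: par_class elim!: FObjE intro!: FObjI par_in)
next
  fix X X' Y Y' :: "'a dbox" and f g M N
  assume "f \<in> hom dDWD X X'" "g \<in> hom dDWD Y Y'" "M \<in> FObj class_functor X" "N \<in> FObj class_functor Y"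
  then obtain u v m n where "dwiring X X' u" "f = arrow X X' u" "dwiring Y Y' v" "g = arrow Y Y' v"
    "m \<in> Mach X" "M = cls X m" "n \<in> Mach Y" "N = cls Y n"
    by (auto simp: in_hom_dDWD elim!: FObjE)
  then show "FArr class_functor (TensorA dDWD f g) (Laxator class_functor X Y (M, N)) = Laxator class_functor X' Y' (FArr class_functor f M, FArr class_functor g N)"
    by (simp add: dtensor_arrow_arrow dwiring_par act_class par_class act_in par_in cls_eqI[OF par_natural])
next
  show "LaxUnit class_functor \<in> FObj class_functor (UnitO (dDWD :: ('a dbox, 'a darrow) moncat))"
    by (simp add: LaxUnit FObjI unit_in)
next
  fix X Y Z :: "'a dbox" and L M N
  assume "X \<in> Obj dDWD" "Y \<in> Obj dDWD" "Z \<in> Obj dDWD" "L \<in> FObj class_functor X" "M \<in> FObj class_functor Y" "N \<in> FObj class_functor Z"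
  then obtain l m n where X: "X \<in> dboxes" "Y \<in> dboxes" "Z \<in> dboxes" and l: "l \<in> Mach X" "L = cls X l"
    and m: "m \<in> Mach Y" "M = cls Y m" and n: "n \<in> Mach Z" "N = cls Z n"
    by (auto elim!: FObjE)
  note box = box_iso_uassoc[OF X]
  note M1 = par_in[OF par_in[OF l(1) m(1)] n(1)] and M2 = par_in[OF l(1) par_in[OF m(1) n(1)]]
  show "FArr class_functor (Assoc dDWD X Y Z) (Laxator class_functor (TensorO dDWD X Y) Z (Laxator class_functor X Y (L, M), N)) =
    Laxator class_functor X (TensorO dDWD Y Z) (L, Laxator class_functor Y Z (M, N))"
    using l m n by (simp add: darrow_of_bij_arrow par_class par_in act_class[OF dwiring_of_bij[OF box] M1]
      cls_eqI[OF act_of_bij[OF box M1 M2 par_assoc]])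
next
  fix X :: "'a dbox" and M assume "X \<in> Obj dDWD" "M \<in> FObj class_functor X"
  then obtain m where X: "X \<in> dboxes" and m: "m \<in> Mach X" "M = cls X m" by (auto elim!: FObjE)
  note box = box_iso_ucodiag[OF X] and M1 = par_in[OF unit_in m(1)] and M2 = par_in[OF m(1) unit_in]
  show "FArr class_functor (LUnit dDWD X) (Laxator class_functor (UnitO dDWD) X (LaxUnit class_functor, M)) = M"
    using m by (simp add: darrow_of_bij_arrow LaxUnit par_class unit_in act_class[OF dwiring_of_bij[OF box(1)] M1]
      cls_eqI[OF act_of_bij[OF box(1) M1 m(1) par_lunit]])
  show "FArr class_functor (RUnit dDWD X) (Laxator class_functor X (UnitO dDWD) (M, LaxUnit class_functor)) = M"
    using m by (simp add: darrow_of_bij_arrow LaxUnit par_class unit_in act_class[OF dwiring_of_bij[OF box(2)] M2]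
      cls_eqI[OF act_of_bij[OF box(2) M2 m(1) par_runit]])
qed

end


section \<open>Fixed points of acyclic systems\<close>

text \<open>Well-founded recursion computes the solution one vertex at a time, and well-founded induction shows
  that any two solutions agree.\<close>

lemma acyclic_unique_fixpoint:
  fixes \<Phi> :: "('v \<Rightarrow> real) \<Rightarrow> ('v \<Rightarrow> real)"
  assumes wf: "wf E" and map: "\<And>x. x \<in> RR V \<Longrightarrow> \<Phi> x \<in> RR V"
    and local: "\<And>v x x'. v \<in> V \<Longrightarrow> x \<in> RR V \<Longrightarrow> x' \<in> RR V \<Longrightarrow>
      (\<And>u. u \<in> V \<Longrightarrow> (u, v) \<in> E \<Longrightarrow> x u = x' u) \<Longrightarrow> \<Phi> x v = \<Phi> x' v"
  shows "\<exists>!x. x \<in> RR V \<and> \<Phi> x = x"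
proof (rule ex_ex1I)
  define F where "F = (\<lambda>g v. \<Phi> (restrict g V) v)"
  define g where "g = wfrec E F"
  have "\<Phi> (restrict g V) v = g v" if "v \<in> V" for v
  proof -
    have "g v = \<Phi> (restrict (cut g E v) V) v"
      unfolding g_def by (subst wfrec[OF wf]) (simp add: F_def)
    also have "\<dots> = \<Phi> (restrict g V) v"
      by (rule local[OF that]) (simp_all add: cut_apply)
    finally show ?thesis by simp
  qed
  then have "\<Phi> (restrict g V) = restrict g V"
    by (intro RR_ext[of _ V]) (simp_all add: map)
  then show "\<exists>x. x \<in> RR V \<and> \<Phi> x = x" by (intro exI[of _ "restrict g V"]) simp
next
  fix x y assume x: "x \<in> RR V \<and> \<Phi> x = x" and y: "y \<in> RR V \<and> \<Phi> y = y"
  have "v \<in> V \<longrightarrow> x v = y v" for v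
    using wf
  proof (induction v rule: wf_induct_rule)
    case (less v)
    show ?case
    proof
      assume "v \<in> V"
      then have "\<Phi> x v = \<Phi> y v" using local x y less.IH by blast
      then show "x v = y v" using x y by simp
    qed
  qed
  then show "x = y" using x y by (intro RR_ext[of _ V]) simp_all
qed

lemma pull_inverse:
  assumes "bij_betw h A B"
  shows "x \<in> RR A \<Longrightarrow> pull A h (pull B (inv_into A h) x) = x"
    "y \<in> RR B \<Longrightarrow> pull B (inv_into A h) (pull A h y) = y"
proof -
  have h: "h a \<in> B" if "a \<in> A" for a using assms that by (auto simp: bij_betw_def)
  have i: "inv_into A h b \<in> A" if "b \<in> B" for b using assms that by (auto simp: bij_betw_def inv_into_into)
  show "pull A h (pull B (inv_into A h) x) = x" if "x \<in> RR A"
    by (rule RR_ext[of _ A]) (use that assms h in \<open>simp_all add: bij_betw_inv_into_left\<close>)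
  show "pull B (inv_into A h) (pull A h y) = y" if "y \<in> RR B"
    by (rule RR_ext[of _ B]) (use that assms i in \<open>simp_all add: bij_betw_inv_into_right\<close>)
qed

lemma pull_vadd: "f \<in> A \<rightarrow> B \<Longrightarrow> pull A f (vadd B x y) = vadd A (pull A f x) (pull A f y)"
  by (rule RR_ext[of _ A]) (simp_all add: Pi_iff)


section \<open>The lax monoidal functor of Mealy machines\<close>

lemma mealysI:
  assumes "finite (states m)"
    and "\<And>a x. a \<in> RR (ins X) \<Longrightarrow> x \<in> RR (states m) \<Longrightarrow> upd m a x \<in> RR (states m)"
    and "\<And>a x. a \<in> RR (ins X) \<Longrightarrow> x \<in> RR (states m) \<Longrightarrow> rdt m a x \<in> RR (outs X)"
    and "\<And>a a' x k. a \<in> RR (ins X) \<Longrightarrow> a' \<in> RR (ins X) \<Longrightarrow> x \<in> RR (states m) \<Longrightarrow> k \<in> outs X \<Longrightarrow>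
      (\<And>i. (i, k) \<in> dep X \<Longrightarrow> a i = a' i) \<Longrightarrow> rdt m a x k = rdt m a' x k"
  shows "m \<in> mealys X"
proof -
  have "respects_span (ins X) (outs X) (dep X) fst snd (\<lambda>a. rdt m a x)" if "x \<in> RR (states m)" for x
    unfolding respects_span_def
  proof (intro ballI impI)
    fix k a a' assume a: "k \<in> outs X" "a \<in> RR (ins X)" "a' \<in> RR (ins X)"
      and eq: "\<forall>i\<in>fst ` {e \<in> dep X. snd e = k}. a i = a' i"
    have "a i = a' i" if "(i, k) \<in> dep X" for i
      using eq that by (auto intro: image_eqI[of _ _ "(i, k)"])
    with a that show "rdt m a x k = rdt m a' x k" by (intro assms(4))
  qed
  then show ?thesis using assms(1-3) by (simp add: mealys_def Pi_iff)
qed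

lemma mealysD:
  assumes "m \<in> mealys X"
  shows "finite (states m)"
    and "a \<in> RR (ins X) \<Longrightarrow> x \<in> RR (states m) \<Longrightarrow> upd m a x \<in> RR (states m)"
    and "a \<in> RR (ins X) \<Longrightarrow> x \<in> RR (states m) \<Longrightarrow> rdt m a x \<in> RR (outs X)"
    and "a \<in> RR (ins X) \<Longrightarrow> a' \<in> RR (ins X) \<Longrightarrow> x \<in> RR (states m) \<Longrightarrow> k \<in> outs X \<Longrightarrow>
      (\<And>i. (i, k) \<in> dep X \<Longrightarrow> a i = a' i) \<Longrightarrow> rdt m a x k = rdt m a' x k"
proof -
  show "finite (states m)" using assms by (simp add: mealys_def)
  show "a \<in> RR (ins X) \<Longrightarrow> x \<in> RR (states m) \<Longrightarrow> upd m a x \<in> RR (states m)"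
    "a \<in> RR (ins X) \<Longrightarrow> x \<in> RR (states m) \<Longrightarrow> rdt m a x \<in> RR (outs X)"
    using assms by (simp_all add: mealys_def Pi_iff)
  assume a: "a \<in> RR (ins X)" "a' \<in> RR (ins X)" "k \<in> outs X" and x: "x \<in> RR (states m)"
    and eq: "\<And>i. (i, k) \<in> dep X \<Longrightarrow> a i = a' i"
  have "respects_span (ins X) (outs X) (dep X) fst snd (\<lambda>a. rdt m a x)"
    using assms x by (simp add: mealys_def)
  moreover have "\<forall>i\<in>fst ` {e \<in> dep X. snd e = k}. a i = a' i" using eq by auto
  ultimately show "rdt m a x k = rdt m a' x k"
    using a unfolding respects_span_def by blast
qed

text \<open>Eliminating the outputs from the feedback system of a Mealy machine leaves a system for the inputs
  alone, in which an input depends on another one through a dependency followed by a trace wire.\<close>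

definition loop_rel :: "'a dbox \<Rightarrow> 'a wiring \<Rightarrow> 'a univ rel" where
  "loop_rel X f = dep X O ends (wtr f)"

lemma wf_loop_rel:
  assumes "dwiring X Y f"
  shows "wf (loop_rel X f)"
proof (rule finite_acyclic_wf)
  note X = dwiringD(1)[OF assms]
  have "loop_rel X f \<subseteq> ins X \<times> ins X"
    using dboxesD(3)[OF X] ends_subset[OF dwiring_span(2)[OF assms]]
    by (auto simp: loop_rel_def)
  then show "finite (loop_rel X f)"
    using dboxesD(1)[OF X] by (meson finite_SigmaI finite_subset)
  have "(Inl i, Inl j) \<in> (trel X f)\<^sup>+" if "(i, j) \<in> (loop_rel X f)\<^sup>+" for i j
    using that
  proof (induction rule: trancl_induct)
    case (base j)
    then obtain k where "(Inl i, Inr k) \<in> trel X f" "(Inr k, Inl j) \<in> trel X f"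
      by (auto simp: loop_rel_def trel_def)
    then show ?case by (meson trancl.simps)
  next
    case (step j j')
    then obtain k where "(Inl j, Inr k) \<in> trel X f" "(Inr k, Inl j') \<in> trel X f"
      by (auto simp: loop_rel_def trel_def)
    then show ?case using step.IH by (meson trancl.simps)
  qed
  then show "acyclic (loop_rel X f)"
    using dwiringD(4)[OF assms] by (auto simp: acyclic_def)
qed

text \<open>A fixed point is determined by its input part, which solves the system with graph \<open>loop_rel\<close>.\<close>

lemma mealy_fix_ex1:
  assumes f: "dwiring X Y f" and m: "m \<in> mealys X" and a: "a \<in> RR (ins X)" and x: "x \<in> RR (states m)"
  shows "\<exists>!z. z \<in> RR (ins X) \<times> RR (outs X) \<and>
     (vadd (ins X) (span_map (wtr f) (ins X) (snd z)) a, rdt m (fst z) x) = z"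
proof -
  note wtr = dwiring_span(2)[OF f]
  define \<Phi> where "\<Phi> p = vadd (ins X) (span_map (wtr f) (ins X) (rdt m p x)) a" for p
  have "\<exists>!p. p \<in> RR (ins X) \<and> \<Phi> p = p"
  proof (rule acyclic_unique_fixpoint[OF wf_loop_rel[OF f]])
    fix v p p' assume v: "v \<in> ins X" and p: "p \<in> RR (ins X)" "p' \<in> RR (ins X)"
      and eq: "\<And>u. u \<in> ins X \<Longrightarrow> (u, v) \<in> loop_rel X f \<Longrightarrow> p u = p' u"
    have "span_map (wtr f) (ins X) (rdt m p x) v = span_map (wtr f) (ins X) (rdt m p' x) v"
    proof (rule span_map_cong[OF wtr v])
      fix k assume k: "(k, v) \<in> ends (wtr f)"
      then have "k \<in> outs X" using ends_subset[OF wtr] by blast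
      with p x show "rdt m p x k = rdt m p' x k"
      proof (rule mealysD(4)[OF m])
        fix i assume "(i, k) \<in> dep X"
        then show "p i = p' i"
          using k dboxesD(3)[OF dwiringD(1)[OF f]] by (intro eq) (auto simp: loop_rel_def)
      qed
    qed
    then show "\<Phi> p v = \<Phi> p' v" using v by (simp add: \<Phi>_def)
  qed (simp add: \<Phi>_def)
  then obtain p where p: "p \<in> RR (ins X)" "\<Phi> p = p" and uniq: "\<And>p'. p' \<in> RR (ins X) \<Longrightarrow> \<Phi> p' = p' \<Longrightarrow> p' = p"
    by blast
  show ?thesis
  proof (rule ex1I[of _ "(p, rdt m p x)"])
    show "(p, rdt m p x) \<in> RR (ins X) \<times> RR (outs X) \<and>
      (vadd (ins X) (span_map (wtr f) (ins X) (snd (p, rdt m p x))) a, rdt m (fst (p, rdt m p x)) x) = (p, rdt m p x)"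
      using p mealysD(3)[OF m p(1) x] by (simp add: \<Phi>_def)
    fix z assume z: "z \<in> RR (ins X) \<times> RR (outs X) \<and>
     (vadd (ins X) (span_map (wtr f) (ins X) (snd z)) a, rdt m (fst z) x) = z"
    obtain p' q' where [simp]: "z = (p', q')" by (cases z)
    have "p' = p" using z by (intro uniq) (auto simp: \<Phi>_def)
    then show "z = (p, rdt m p x)" using z by auto
  qed
qed

lemma mealy_fix_obtain:
  assumes "dwiring X Y f" "m \<in> mealys X" "a \<in> RR (ins X)" "x \<in> RR (states m)"
  obtains p q where "mealy_fix X f m a x = (p, q)" "p \<in> RR (ins X)" "q \<in> RR (outs X)"
    "p = vadd (ins X) (span_map (wtr f) (ins X) q) a" "q = rdt m p x"
proof -
  obtain p q where pq: "mealy_fix X f m a x = (p, q)" by (cases "mealy_fix X f m a x")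
  from theI'[OF mealy_fix_ex1[OF assms]]
  have "(p, q) \<in> RR (ins X) \<times> RR (outs X) \<and>
     (vadd (ins X) (span_map (wtr f) (ins X) q) a, rdt m p x) = (p, q)"
    unfolding mealy_fix_def[symmetric] pq by simp
  then have "p \<in> RR (ins X)" "q \<in> RR (outs X)" "vadd (ins X) (span_map (wtr f) (ins X) q) a = p" "rdt m p x = q"
    by simp_all
  then show ?thesis by (rule that[OF pq _ _ sym sym])
qed

lemma mealy_fix_eqI:
  assumes "dwiring X Y f" "m \<in> mealys X" "a \<in> RR (ins X)" "x \<in> RR (states m)"
    and "p \<in> RR (ins X)" "p = vadd (ins X) (span_map (wtr f) (ins X) q) a" "q = rdt m p x"
  shows "mealy_fix X f m a x = (p, q)"
  unfolding mealy_fix_def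
  by (rule the1_equality[OF mealy_fix_ex1[OF assms(1-4)]])
    (use assms(5) assms(6,7)[symmetric] mealysD(3)[OF assms(2,5,4)] in simp)

lemma mealy_act_sel [simp]: "states (mealy_act X Y f m) = states m"
  "upd (mealy_act X Y f m) y x = upd m (fst (mealy_fix X f m (span_map (win f) (ins X) y) x)) x"
  "rdt (mealy_act X Y f m) y x = span_map (wout f) (outs Y) (snd (mealy_fix X f m (span_map (win f) (ins X) y) x))"
  by (simp_all add: mealy_act_def)

text \<open>The point is that the new readout respects \<open>d\<^sub>Y\<close>.  Two outer inputs that agree on the ports on
  which \<open>j\<close> depends lead to the same inner inputs on all ports with a path to \<open>j\<close>: by induction
  along \<open>loop_rel\<close>, the predecessors of such a port again have a path to \<open>j\<close>, and \<open>j\<close>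
  depends on every outer port that is wired to it.\<close>

lemma mealy_act_mealys:
  assumes f: "dwiring X Y f" and m: "m \<in> mealys X"
  shows "mealy_act X Y f m \<in> mealys Y"
proof (rule mealysI)
  show "finite (states (mealy_act X Y f m))" using mealysD(1)[OF m] by simp
  fix y x assume x: "x \<in> RR (states (mealy_act X Y f m))"
  show "rdt (mealy_act X Y f m) y x \<in> RR (outs Y)" by simp
  have x': "x \<in> RR (states m)" using x by simp
  obtain p q where "mealy_fix X f m (span_map (win f) (ins X) y) x = (p, q)" "p \<in> RR (ins X)"
    using mealy_fix_obtain[OF f m span_map_in_RR x'] by metis
  then show "upd (mealy_act X Y f m) y x \<in> RR (states (mealy_act X Y f m))"
    using mealysD(2)[OF m, of p x] x' by simp
next
  note wtr = dwiring_span(2)[OF f] and win = dwiring_span(1)[OF f]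
    and wout = dwiring_span(3)[OF f]
  note dX = dboxesD(3)[OF dwiringD(1)[OF f]]
  fix y y' x j assume y: "y \<in> RR (ins Y)" "y' \<in> RR (ins Y)" and x: "x \<in> RR (states (mealy_act X Y f m))"
    and j: "j \<in> outs Y" and eq: "\<And>i. (i, j) \<in> dep Y \<Longrightarrow> y i = y' i"
  have x': "x \<in> RR (states m)" using x by simp
  obtain p q where pq: "mealy_fix X f m (span_map (win f) (ins X) y) x = (p, q)" "p \<in> RR (ins X)"
     "p = vadd (ins X) (span_map (wtr f) (ins X) q) (span_map (win f) (ins X) y)" "q = rdt m p x"
    using mealy_fix_obtain[OF f m span_map_in_RR x'] by metis
  obtain p' q' where pq': "mealy_fix X f m (span_map (win f) (ins X) y') x = (p', q')" "p' \<in> RR (ins X)"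
     "p' = vadd (ins X) (span_map (wtr f) (ins X) q') (span_map (win f) (ins X) y')" "q' = rdt m p' x"
    using mealy_fix_obtain[OF f m span_map_in_RR x'] by metis
  have agree: "i \<in> ins X \<longrightarrow> (\<forall>k. (Inl i, Inr k) \<in> (trel X f)\<^sup>* \<longrightarrow> (k, j) \<in> ends (wout f) \<longrightarrow> p i = p' i)" for i
    using wf_loop_rel[OF f]
  proof (induction i rule: wf_induct_rule)
    case (less i)
    show ?case
    proof (intro impI allI)
      fix k assume i: "i \<in> ins X" and path: "(Inl i, Inr k) \<in> (trel X f)\<^sup>*" and k: "(k, j) \<in> ends (wout f)"
      have "span_map (win f) (ins X) y i = span_map (win f) (ins X) y' i"
        by (rule span_map_cong[OF win i]) (rule eq[OF dwiringD(5)[OF f _ path k]])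
      moreover have "span_map (wtr f) (ins X) q i = span_map (wtr f) (ins X) q' i"
      proof (rule span_map_cong[OF wtr i])
        fix k' assume k': "(k', i) \<in> ends (wtr f)"
        then have "k' \<in> outs X" using ends_subset[OF wtr] by blast
        with pq(2) pq'(2) x' show "q k' = q' k'" unfolding pq(4) pq'(4)
        proof (rule mealysD(4)[OF m])
          fix i' assume i': "(i', k') \<in> dep X"
          then have "(Inl i', Inr k') \<in> trel X f" "(Inr k', Inl i) \<in> trel X f"
            using k' by (auto simp: trel_def)
          then have "(Inl i', Inr k) \<in> (trel X f)\<^sup>*" using path
            by (meson converse_rtrancl_into_rtrancl)
          moreover have "(i', i) \<in> loop_rel X f" "i' \<in> ins X" using i' k' dX by (auto simp: loop_rel_def)
          ultimately show "p i' = p' i'" using less.IH k by blast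
        qed
      qed
      ultimately show "p i = p' i" by (subst pq(3), subst pq'(3)) (simp add: i)
    qed
  qed
  have "span_map (wout f) (outs Y) q j = span_map (wout f) (outs Y) q' j"
  proof (rule span_map_cong[OF wout j])
    fix k assume k: "(k, j) \<in> ends (wout f)"
    then have "k \<in> outs X" using ends_subset[OF wout] by blast
    with pq(2) pq'(2) x' show "q k = q' k" unfolding pq(4) pq'(4)
    proof (rule mealysD(4)[OF m])
      fix i assume "(i, k) \<in> dep X"
      then have "(Inl i, Inr k) \<in> (trel X f)\<^sup>*" "i \<in> ins X" using dX by (auto simp: trel_def)
      then show "p i = p' i" using agree k by blast
    qed
  qed
  then show "rdt (mealy_act X Y f m) y x j = rdt (mealy_act X Y f m) y' x j"
    using pq(1) pq'(1) by simp
qed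

definition mealy_iso :: "('a univ \<Rightarrow> 'a univ) \<Rightarrow> ('a univ \<Rightarrow> 'a univ) \<Rightarrow> ('a univ \<Rightarrow> 'a univ) \<Rightarrow>
    'a dbox \<Rightarrow> 'a dbox \<Rightarrow> 'a mealy \<Rightarrow> 'a mealy \<Rightarrow> bool" where
  "mealy_iso b c h X X' m m' \<longleftrightarrow> bij_betw h (states m) (states m') \<and>
     (\<forall>a \<in> RR (ins X'). \<forall>x \<in> RR (states m').
        upd m (pull (ins X) b a) (pull (states m) h x) = pull (states m) h (upd m' a x) \<and>
        rdt m (pull (ins X) b a) (pull (states m) h x) = pull (outs X) c (rdt m' a x))"

lemma mealy_rel_iff: "(m, m') \<in> mealy_rel X \<longleftrightarrow>
    m \<in> mealys X \<and> m' \<in> mealys X \<and> (\<exists>h. mealy_iso id id h X X m m')"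
proof (cases "m \<in> mealys X \<and> m' \<in> mealys X")
  case True
  then have "pull (outs X) id (rdt m' a x) = rdt m' a x" if "a \<in> RR (ins X)" "x \<in> RR (states m')" for a x
    using that by (simp add: pull_id mealysD(3))
  then show ?thesis using True by (auto simp: mealy_rel_def mealy_iso_def pull_id)
qed (auto simp: mealy_rel_def)

lemma mealy_rel_sameI:
  assumes m: "m \<in> mealys X" and m': "m' \<in> mealys X" and st: "states m = states m'"
    and eq: "\<And>a x. a \<in> RR (ins X) \<Longrightarrow> x \<in> RR (states m) \<Longrightarrow> upd m a x = upd m' a x \<and> rdt m a x = rdt m' a x"
  shows "(m, m') \<in> mealy_rel X"
proof -
  have "mealy_iso id id id X X m m'"
    unfolding mealy_iso_def using eq mealysD(2,3)[OF m'] st by (simp add: pull_id)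
  then show ?thesis using m m' by (auto simp: mealy_rel_iff)
qed

lemma equiv_mealy_rel: "equiv (mealys X) (mealy_rel X)"
proof (rule equivI)
  show "mealy_rel X \<subseteq> mealys X \<times> mealys X" by (auto simp: mealy_rel_def)
  show "refl_on (mealys X) (mealy_rel X)"
    by (rule refl_onI) (simp add: mealy_rel_sameI)
  show "sym (mealy_rel X)"
  proof (rule symI)
    fix m m' assume "(m, m') \<in> mealy_rel X"
    then obtain h where m: "m \<in> mealys X" "m' \<in> mealys X" and h: "mealy_iso id id h X X m m'"
      by (auto simp: mealy_rel_iff)
    let ?g = "inv_into (states m) h"
    have bij: "bij_betw h (states m) (states m')" using h by (simp add: mealy_iso_def)
    have "mealy_iso id id ?g X X m' m"
      unfolding mealy_iso_def
    proof (intro conjI ballI)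
      show "bij_betw ?g (states m') (states m)" using bij by (rule bij_betw_inv_into)
      fix a x assume a: "a \<in> RR (ins X)" and x: "x \<in> RR (states m)"
      let ?x = "pull (states m') ?g x"
      have "upd m (pull (ins X) id a) (pull (states m) h ?x) = pull (states m) h (upd m' a ?x)"
        "rdt m (pull (ins X) id a) (pull (states m) h ?x) = pull (outs X) id (rdt m' a ?x)"
        using h a by (simp_all add: mealy_iso_def)
      then have "upd m a x = pull (states m) h (upd m' a ?x)" "rdt m a x = rdt m' a ?x"
        using a x m by (simp_all add: pull_id pull_inverse(1)[OF bij] mealysD(3)[OF m(2)])
      then show "upd m' (pull (ins X) id a) ?x = pull (states m') ?g (upd m a x)"
        "rdt m' (pull (ins X) id a) ?x = pull (outs X) id (rdt m a x)"
        using a m by (simp_all add: pull_id pull_inverse(2)[OF bij] mealysD(2,3)[OF m(2)])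
    qed
    then show "(m', m) \<in> mealy_rel X" using m by (auto simp: mealy_rel_iff)
  qed
  show "trans (mealy_rel X)"
  proof (rule transI)
    fix m n k assume "(m, n) \<in> mealy_rel X" "(n, k) \<in> mealy_rel X"
    then obtain h g where m: "m \<in> mealys X" "n \<in> mealys X" "k \<in> mealys X"
      and h: "mealy_iso id id h X X m n" and g: "mealy_iso id id g X X n k"
      by (auto simp: mealy_rel_iff)
    have bij: "bij_betw h (states m) (states n)" "bij_betw g (states n) (states k)"
      using h g by (simp_all add: mealy_iso_def)
    have hf: "h \<in> states m \<rightarrow> states n" using bij(1) by (rule bij_betw_imp_funcset)
    have "mealy_iso id id (g \<circ> h) X X m k"
      unfolding mealy_iso_def
    proof (intro conjI ballI)
      show "bij_betw (g \<circ> h) (states m) (states k)" using bij by (rule bij_betw_trans)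
      fix a x assume a: "a \<in> RR (ins X)" and x: "x \<in> RR (states k)"
      have p: "pull (states m) (g \<circ> h) y = pull (states m) h (pull (states n) g y)" for y
        by (rule pull_pull[OF hf, symmetric])
      show "upd m (pull (ins X) id a) (pull (states m) (g \<circ> h) x) = pull (states m) (g \<circ> h) (upd k a x)"
        "rdt m (pull (ins X) id a) (pull (states m) (g \<circ> h) x) = pull (outs X) id (rdt k a x)"
        using h g a x m unfolding p mealy_iso_def by (simp_all add: pull_id mealysD(3)[OF m(3)])
    qed
    then show "(m, k) \<in> mealy_rel X" using m by (auto simp: mealy_rel_iff)
  qed
qed

text \<open>Pulling back a fixed point along the relabellings gives a fixed point, hence by uniqueness the fixed
  point of the other system.\<close>

lemma mealy_act_transport:
  assumes sq: "wiring_square b c b' c' X Y f X' Y' f'"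
    and f: "dwiring X Y f" and f': "dwiring X' Y' f'"
    and m: "m \<in> mealys X" and m': "m' \<in> mealys X'" and iso: "mealy_iso b c h X X' m m'"
  shows "mealy_iso b' c' h Y Y' (mealy_act X Y f m) (mealy_act X' Y' f' m')"
proof -
  note w = dwiring_span[OF f] and w' = dwiring_span[OF f']
  note fin = dwiring_finite(1,2)[OF f] dwiring_finite(1,2)[OF f']
    dwiring_finite(3,4)[OF f] dwiring_finite(3,4)[OF f']
  have bij: "bij_betw b (ins X) (ins X')" "bij_betw c (outs X) (outs X')"
     "bij_betw b' (ins Y) (ins Y')" "bij_betw c' (outs Y) (outs Y')"
    and eq: "\<And>y x. y \<in> ins Y \<Longrightarrow> x \<in> ins X \<Longrightarrow> wires (win f') (b' y) (b x) = wires (win f) y x"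
     "\<And>k x. k \<in> outs X \<Longrightarrow> x \<in> ins X \<Longrightarrow> wires (wtr f') (c k) (b x) = wires (wtr f) k x"
     "\<And>k z. k \<in> outs X \<Longrightarrow> z \<in> outs Y \<Longrightarrow> wires (wout f') (c k) (c' z) = wires (wout f) k z"
    using sq by (simp_all add: wiring_square_def)
  note maps = bij[THEN bij_betw_imp_funcset]
  have h: "bij_betw h (states m) (states m')" using iso by (simp add: mealy_iso_def)
  have iso': "upd m (pull (ins X) b a) (pull (states m) h x) = pull (states m) h (upd m' a x)"
    "rdt m (pull (ins X) b a) (pull (states m) h x) = pull (outs X) c (rdt m' a x)"
    if "a \<in> RR (ins X')" "x \<in> RR (states m')" for a x
    using iso that by (simp_all add: mealy_iso_def)
  show ?thesis
    unfolding mealy_iso_def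
  proof (intro conjI ballI)
    show "bij_betw h (states (mealy_act X Y f m)) (states (mealy_act X' Y' f' m'))" using h by simp
    fix y x assume y: "y \<in> RR (ins Y')" and x: "x \<in> RR (states (mealy_act X' Y' f' m'))"
    have x': "x \<in> RR (states m')" using x by simp
    obtain p q where pq: "mealy_fix X' f' m' (span_map (win f') (ins X') y) x = (p, q)" "p \<in> RR (ins X')"
      "p = vadd (ins X') (span_map (wtr f') (ins X') q) (span_map (win f') (ins X') y)" "q = rdt m' p x"
      using mealy_fix_obtain[OF f' m' span_map_in_RR x'] by metis
    have fixp: "mealy_fix X f m (span_map (win f) (ins X) (pull (ins Y) b' y)) (pull (states m) h x)
        = (pull (ins X) b p, pull (outs X) c q)"
    proof (rule mealy_fix_eqI[OF f m])
      show "pull (outs X) c q = rdt m (pull (ins X) b p) (pull (states m) h x)"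
        using iso'(2)[OF pq(2) x'] pq(4) by simp
      show "pull (ins X) b p = vadd (ins X) (span_map (wtr f) (ins X) (pull (outs X) c q))
          (span_map (win f) (ins X) (pull (ins Y) b' y))"
        by (subst pq(3)) (simp add: pull_vadd[OF maps(1)]
          span_map_transport[OF w(2) w'(2) fin(2,4) bij(2) maps(1) eq(2)]
          span_map_transport[OF w(1) w'(1) fin(5,7) bij(3) maps(1) eq(1)])
    qed simp_all
    show "upd (mealy_act X Y f m) (pull (ins Y) b' y) (pull (states (mealy_act X Y f m)) h x) =
       pull (states (mealy_act X Y f m)) h (upd (mealy_act X' Y' f' m') y x)"
      using iso'(1)[OF pq(2) x'] by (simp add: fixp pq(1))
    show "rdt (mealy_act X Y f m) (pull (ins Y) b' y) (pull (states (mealy_act X Y f m)) h x) =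
       pull (outs Y) c' (rdt (mealy_act X' Y' f' m') y x)"
      by (simp add: fixp pq(1) span_map_transport[OF w(3) w'(3) fin(2,4) bij(2) maps(4) eq(3)])
  qed
qed

lemma span_map_of_bij:
  "span_map (win (wiring_of_bij X b c)) (ins X) x = pull (ins X) b x"
  "span_map (wout (wiring_of_bij X b id)) (outs X) x = pull (outs X) id x"
  "v \<in> V \<Longrightarrow> span_map (wtr (wiring_of_bij X b c)) V x v = 0"
proof -
  have s: "{a. a \<in> A \<and> a = v} = (if v \<in> A then {v} else {})" for A :: "'z set" and v by auto
  show "span_map (win (wiring_of_bij X b c)) (ins X) x = pull (ins X) b x"
    by (rule RR_ext[of _ "ins X"]) (simp_all add: span_map_def wiring_of_bij_def push_def s)
  show "span_map (wout (wiring_of_bij X b id)) (outs X) x = pull (outs X) id x"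
    by (rule RR_ext[of _ "outs X"]) (simp_all add: span_map_def wiring_of_bij_def push_def s)
  show "v \<in> V \<Longrightarrow> span_map (wtr (wiring_of_bij X b c)) V x v = 0"
    by (simp add: wiring_of_bij_def span_map_empty)
qed

lemma mealy_act_ident:
  assumes X: "X \<in> dboxes" and m: "m \<in> mealys X"
  shows "(mealy_act X X (wiring_of_bij X id id) m, m) \<in> mealy_rel X"
proof (rule mealy_rel_sameI)
  note dw = dwiring_of_bij[OF box_iso_ident[OF X]]
  show "mealy_act X X (wiring_of_bij X id id) m \<in> mealys X"
    by (rule mealy_act_mealys[OF dw m])
  fix a x assume a: "a \<in> RR (ins X)" and "x \<in> RR (states (mealy_act X X (wiring_of_bij X id id) m))"
  then have x: "x \<in> RR (states m)" by simp
  have "mealy_fix X (wiring_of_bij X id id) m a x = (a, rdt m a x)"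
  proof (rule mealy_fix_eqI[OF dw m a x a])
    show "a = vadd (ins X) (span_map (wtr (wiring_of_bij X id id)) (ins X) (rdt m a x)) a"
      by (rule RR_ext[of _ "ins X"]) (simp_all add: a span_map_of_bij(3))
  qed simp
  then show "upd (mealy_act X X (wiring_of_bij X id id) m) a x = upd m a x \<and>
      rdt (mealy_act X X (wiring_of_bij X id id) m) a x = rdt m a x"
    using a mealysD(3)[OF m a x] by (simp add: span_map_of_bij pull_id)
qed (use m in simp_all)

text \<open>Solve for \<open>g\<close> first, obtaining \<open>(yi, yo)\<close>, and then for \<open>f\<close> at the input \<open>yi\<close>, obtaining
  \<open>(p, q)\<close>.  The trace of \<open>g \<circ> f\<close> is the trace of \<open>f\<close> plus the feedback through \<open>g\<close>, so
  \<open>(p, q)\<close> solves the system of the composite.\<close>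

lemma mealy_act_comp:
  assumes f: "dwiring X Y f" and g: "dwiring Y Z g" and m: "m \<in> mealys X"
  shows "(mealy_act X Z (wiring_comp g f) m, mealy_act Y Z g (mealy_act X Y f m)) \<in> mealy_rel Z"
proof (rule mealy_rel_sameI)
  note gf = dwiring_comp[OF f g]
  let ?m = "mealy_act X Y f m"
  have m': "?m \<in> mealys Y" by (rule mealy_act_mealys[OF f m])
  show "mealy_act X Z (wiring_comp g f) m \<in> mealys Z" by (rule mealy_act_mealys[OF gf m])
  show "mealy_act Y Z g ?m \<in> mealys Z" by (rule mealy_act_mealys[OF g m'])
  note wf = dwiring_span[OF f] and wg = dwiring_span[OF g]
  note fin = dwiring_finite[OF f] dwiring_finite(3,4)[OF g]
  fix z x assume z: "z \<in> RR (ins Z)" and "x \<in> RR (states (mealy_act X Z (wiring_comp g f) m))"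
  then have x: "x \<in> RR (states m)" and x': "x \<in> RR (states ?m)" by simp_all
  obtain yi yo where y: "mealy_fix Y g ?m (span_map (win g) (ins Y) z) x = (yi, yo)" "yi \<in> RR (ins Y)"
    "yi = vadd (ins Y) (span_map (wtr g) (ins Y) yo) (span_map (win g) (ins Y) z)" "yo = rdt ?m yi x"
    using mealy_fix_obtain[OF g m' span_map_in_RR x'] by metis
  obtain p q where pq: "mealy_fix X f m (span_map (win f) (ins X) yi) x = (p, q)" "p \<in> RR (ins X)"
    "p = vadd (ins X) (span_map (wtr f) (ins X) q) (span_map (win f) (ins X) yi)" "q = rdt m p x"
    using mealy_fix_obtain[OF f m span_map_in_RR x] by metis
  \<comment> \<open>The two contributions of \<open>g\<close> to the input of \<open>f\<close>, through \<open>yi\<close>, are the feedback part of the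
    trace of the composite and its input wires.\<close>
  have yo: "yo = span_map (wout f) (outs Y) q" using y(4) pq(1) by simp
  have "span_map (wtr (wiring_comp g f)) (ins X) q =
      vadd (ins X) (span_map (wtr f) (ins X) q) (span_map (win f) (ins X) (span_map (wtr g) (ins Y) yo))"
    using fin unfolding wiring_comp_def yo
    by (simp add: span_map_plus[OF wf(2) is_span_comp[OF is_span_comp[OF wf(3) wg(2)] wf(1)]]
       span_map_comp[OF is_span_comp[OF wf(3) wg(2)] wf(1)] span_map_comp[OF wf(3) wg(2)])
  moreover have "span_map (win f) (ins X) yi = vadd (ins X) (span_map (win f) (ins X) (span_map (wtr g) (ins Y) yo))
      (span_map (win (wiring_comp g f)) (ins X) z)"
    using fin by (subst y(3)) (simp add: wiring_comp_def span_map_vadd[OF wf(1)] span_map_comp[OF wg(1) wf(1)])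
  ultimately have "p = vadd (ins X) (span_map (wtr (wiring_comp g f)) (ins X) q) (span_map (win (wiring_comp g f)) (ins X) z)"
    by (subst pq(3)) (auto intro!: RR_ext[of _ "ins X"])
  from this have fixp: "mealy_fix X (wiring_comp g f) m (span_map (win (wiring_comp g f)) (ins X) z) x = (p, q)"
    by (rule mealy_fix_eqI[OF gf m span_map_in_RR x pq(2) _ pq(4)])
  have "span_map (wout (wiring_comp g f)) (outs Z) q = span_map (wout g) (outs Z) yo"
    unfolding yo using fin by (simp add: wiring_comp_def span_map_comp[OF wf(3) wg(3)])
  then show "upd (mealy_act X Z (wiring_comp g f) m) z x = upd (mealy_act Y Z g ?m) z x \<and>
    rdt (mealy_act X Z (wiring_comp g f) m) z x = rdt (mealy_act Y Z g ?m) z x"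
    using fixp y(1) pq(1) by simp
qed simp


lemma mealy_par_sel [simp]: "states (mealy_par X Y m n) = usum (states m) (states n)"
  "upd (mealy_par X Y m n) a x = vjoin (states m) (states n)
     (upd m (pull (ins X) In1 a) (pull (states m) In1 x)) (upd n (pull (ins Y) In2 a) (pull (states n) In2 x))"
  "rdt (mealy_par X Y m n) a x = vjoin (outs X) (outs Y)
     (rdt m (pull (ins X) In1 a) (pull (states m) In1 x)) (rdt n (pull (ins Y) In2 a) (pull (states n) In2 x))"
  by (simp_all add: mealy_par_def)

lemma mealy_unit_sel [simp]: "states mealy_unit = {}" "upd mealy_unit a x = (\<lambda>v\<in>{}. 0)"
   "rdt mealy_unit a x = (\<lambda>v\<in>{}. 0)"
  by (simp_all add: mealy_unit_def)

lemma mealy_par_mealys: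
  assumes m: "m \<in> mealys X" and n: "n \<in> mealys Y"
  shows "mealy_par X Y m n \<in> mealys (dtensor X Y)"
proof (rule mealysI)
  show "finite (states (mealy_par X Y m n))" using mealysD(1)[OF m] mealysD(1)[OF n] by simp
next
  fix a a' x k assume a: "a \<in> RR (ins (dtensor X Y))" "a' \<in> RR (ins (dtensor X Y))"
    and k: "k \<in> outs (dtensor X Y)" and eq: "\<And>i. (i, k) \<in> dep (dtensor X Y) \<Longrightarrow> a i = a' i"
  show "rdt (mealy_par X Y m n) a x k = rdt (mealy_par X Y m n) a' x k"
    using k unfolding dtensor_sel
  proof (cases rule: usumE)
    case (1 k1)
    have "rdt m (pull (ins X) In1 a) (pull (states m) In1 x) k1 = rdt m (pull (ins X) In1 a') (pull (states m) In1 x) k1"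
    proof (rule mealysD(4)[OF m])
      fix i assume "(i, k1) \<in> dep X"
      then have "a (In1 i) = a' (In1 i)" using 1 by (intro eq) (auto intro: image_eqI[of _ _ "(i, k1)"])
      then show "pull (ins X) In1 a i = pull (ins X) In1 a' i" by (simp add: pull_def)
    qed (use 1 in simp_all)
    then show ?thesis using 1 by simp
  next
    case (2 k2)
    have "rdt n (pull (ins Y) In2 a) (pull (states n) In2 x) k2 = rdt n (pull (ins Y) In2 a') (pull (states n) In2 x) k2"
    proof (rule mealysD(4)[OF n])
      fix i assume "(i, k2) \<in> dep Y"
      then have "a (In2 i) = a' (In2 i)" using 2 by (intro eq) (auto intro: image_eqI[of _ _ "(i, k2)"])
      then show "pull (ins Y) In2 a i = pull (ins Y) In2 a' i" by (simp add: pull_def)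
    qed (use 2 in simp_all)
    then show ?thesis using 2 by simp
  qed
qed simp_all

lemma mealy_unit_mealys: "mealy_unit \<in> mealys dunit"
  by (rule mealysI) simp_all

lemma pull_umap:
  assumes "f \<in> A \<rightarrow> A'" "g \<in> B \<rightarrow> B'"
  shows "pull A In1 (pull (usum A B) (umap f g) x) = pull A f (pull A' In1 x)"
    "pull B In2 (pull (usum A B) (umap f g) x) = pull B g (pull B' In2 x)"
    "pull (usum A B) (umap f g) (vjoin A' B' u v) = vjoin A B (pull A f u) (pull B g v)"
  using assms by (auto simp: pull_def vjoin_def restrict_def fun_eq_iff Pi_iff elim!: usumE)

lemma mealy_par_cong:
  assumes "(m, m') \<in> mealy_rel X" "(n, n') \<in> mealy_rel Y"
  shows "(mealy_par X Y m n, mealy_par X Y m' n') \<in> mealy_rel (dtensor X Y)"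
proof -
  obtain h g where m: "m \<in> mealys X" "m' \<in> mealys X" and h: "mealy_iso id id h X X m m'"
    and n: "n \<in> mealys Y" "n' \<in> mealys Y" and g: "mealy_iso id id g Y Y n n'"
    using assms by (auto simp: mealy_rel_iff)
  have bij: "bij_betw h (states m) (states m')" "bij_betw g (states n) (states n')"
    using h g by (simp_all add: mealy_iso_def)
  note pu = pull_umap[OF bij[THEN bij_betw_imp_funcset]]
  have H: "upd m a (pull (states m) h x) = pull (states m) h (upd m' a x) \<and> rdt m a (pull (states m) h x) = rdt m' a x"
    if "a \<in> RR (ins X)" "x \<in> RR (states m')" for a x
    using h that mealysD(3)[OF m(2) that] by (simp add: mealy_iso_def pull_id)
  have G: "upd n a (pull (states n) g x) = pull (states n) g (upd n' a x) \<and> rdt n a (pull (states n) g x) = rdt n' a x"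
    if "a \<in> RR (ins Y)" "x \<in> RR (states n')" for a x
    using g that mealysD(3)[OF n(2) that] by (simp add: mealy_iso_def pull_id)
  have "mealy_iso id id (umap h g) (dtensor X Y) (dtensor X Y) (mealy_par X Y m n) (mealy_par X Y m' n')"
    unfolding mealy_iso_def
  proof (intro conjI ballI)
    show "bij_betw (umap h g) (states (mealy_par X Y m n)) (states (mealy_par X Y m' n'))"
      using bij by (simp add: bij_betw_umap)
    fix a x assume "a \<in> RR (ins (dtensor X Y))"
    then have a: "pull (ins (dtensor X Y)) id a = a" by (simp add: pull_id)
    show "upd (mealy_par X Y m n) (pull (ins (dtensor X Y)) id a) (pull (states (mealy_par X Y m n)) (umap h g) x) =
      pull (states (mealy_par X Y m n)) (umap h g) (upd (mealy_par X Y m' n') a x)"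
      unfolding a by (simp add: pu H G)
    show "rdt (mealy_par X Y m n) (pull (ins (dtensor X Y)) id a) (pull (states (mealy_par X Y m n)) (umap h g) x) =
      pull (outs (dtensor X Y)) id (rdt (mealy_par X Y m' n') a x)"
      unfolding a by (simp add: pu H G pull_id)
  qed
  then show ?thesis
    using mealy_par_mealys[OF m(1) n(1)] mealy_par_mealys[OF m(2) n(2)] by (auto simp: mealy_rel_iff)
qed

lemma vjoin_vadd: "vadd (usum A B) (vjoin A B x y) (vjoin A B x' y') = vjoin A B (vadd A x x') (vadd B y y')"
  by (rule RR_ext[of _ "usum A B"]) (auto elim!: usumE)

lemma span_map_par_vjoin:
  assumes R: "is_span A B R" and S: "is_span A' B' S" and fin: "finite A" "finite A'"
  shows "span_map (span_par R S) (usum B B') x = vjoin B B' (span_map R B (pull A In1 x)) (span_map S B' (pull A' In2 x))"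
  by (rule RR_usum_eqI[of _ B B']) (simp_all add: span_map_par[OF assms])

text \<open>Joining the fixed points of the two systems gives a fixed point of the disjoint union.\<close>

lemma mealy_par_natural:
  assumes f: "dwiring X X' f" and g: "dwiring Y Y' g" and m: "m \<in> mealys X" and n: "n \<in> mealys Y"
  shows "(mealy_act (dtensor X Y) (dtensor X' Y') (wiring_par f g) (mealy_par X Y m n),
     mealy_par X' Y' (mealy_act X X' f m) (mealy_act Y Y' g n)) \<in> mealy_rel (dtensor X' Y')"
proof (rule mealy_rel_sameI)
  note fg = dwiring_par[OF f g] and mn = mealy_par_mealys[OF m n]
  show "mealy_act (dtensor X Y) (dtensor X' Y') (wiring_par f g) (mealy_par X Y m n) \<in> mealys (dtensor X' Y')"
    by (rule mealy_act_mealys[OF fg mn])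
  show "mealy_par X' Y' (mealy_act X X' f m) (mealy_act Y Y' g n) \<in> mealys (dtensor X' Y')"
    by (rule mealy_par_mealys[OF mealy_act_mealys[OF f m] mealy_act_mealys[OF g n]])
  note wf = dwiring_span[OF f] and wg = dwiring_span[OF g]
  note finf = dwiring_finite[OF f]
  note fing = dwiring_finite[OF g]
  fix z x assume "x \<in> RR (states (mealy_act (dtensor X Y) (dtensor X' Y') (wiring_par f g) (mealy_par X Y m n)))"
  then have x: "x \<in> RR (states (mealy_par X Y m n))" by simp
  let ?a = "span_map (win f) (ins X) (pull (ins X') In1 z)"
  let ?b = "span_map (win g) (ins Y) (pull (ins Y') In2 z)"
  obtain p1 q1 where 1: "mealy_fix X f m ?a (pull (states m) In1 x) = (p1, q1)" "p1 \<in> RR (ins X)" "q1 \<in> RR (outs X)"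
    "p1 = vadd (ins X) (span_map (wtr f) (ins X) q1) ?a" "q1 = rdt m p1 (pull (states m) In1 x)"
    by (rule mealy_fix_obtain[OF f m span_map_in_RR pull_in_RR])
  obtain p2 q2 where 2: "mealy_fix Y g n ?b (pull (states n) In2 x) = (p2, q2)" "p2 \<in> RR (ins Y)" "q2 \<in> RR (outs Y)"
    "p2 = vadd (ins Y) (span_map (wtr g) (ins Y) q2) ?b" "q2 = rdt n p2 (pull (states n) In2 x)"
    by (rule mealy_fix_obtain[OF g n span_map_in_RR pull_in_RR])
  have "mealy_fix (dtensor X Y) (wiring_par f g) (mealy_par X Y m n)
      (span_map (win (wiring_par f g)) (ins (dtensor X Y)) z) x = (vjoin (ins X) (ins Y) p1 p2, vjoin (outs X) (outs Y) q1 q2)"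
  proof (rule mealy_fix_eqI[OF fg mn span_map_in_RR x])
    show "vjoin (ins X) (ins Y) p1 p2 \<in> RR (ins (dtensor X Y))" by simp
    show "vjoin (ins X) (ins Y) p1 p2 = vadd (ins (dtensor X Y))
        (span_map (wtr (wiring_par f g)) (ins (dtensor X Y)) (vjoin (outs X) (outs Y) q1 q2))
        (span_map (win (wiring_par f g)) (ins (dtensor X Y)) z)"
      unfolding wiring_par_def using finf fing 1(3) 2(3) 1(4)[symmetric] 2(4)[symmetric]
      by (simp add: span_map_par_vjoin[OF wf(2) wg(2)] span_map_par_vjoin[OF wf(1) wg(1)] vjoin_vadd)
    show "vjoin (outs X) (outs Y) q1 q2 = rdt (mealy_par X Y m n) (vjoin (ins X) (ins Y) p1 p2) x"
      using 1(2) 2(2) 1(5)[symmetric] 2(5)[symmetric] by simp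
  qed
  then show "upd (mealy_act (dtensor X Y) (dtensor X' Y') (wiring_par f g) (mealy_par X Y m n)) z x =
        upd (mealy_par X' Y' (mealy_act X X' f m) (mealy_act Y Y' g n)) z x \<and>
     rdt (mealy_act (dtensor X Y) (dtensor X' Y') (wiring_par f g) (mealy_par X Y m n)) z x =
        rdt (mealy_par X' Y' (mealy_act X X' f m) (mealy_act Y Y' g n)) z x"
    using 1(1-3) 2(1-3) finf fing by (simp add: wiring_par_def span_map_par_vjoin[OF wf(3) wg(3)])
qed simp

lemma pull_uassoc:
  "pull A In1 (pull (usum A B) In1 (pull (usum (usum A B) C) uassoc x)) = pull A In1 x"
  "pull B In2 (pull (usum A B) In1 (pull (usum (usum A B) C) uassoc x)) = pull B In1 (pull (usum B C) In2 x)"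
  "pull C In2 (pull (usum (usum A B) C) uassoc x) = pull C In2 (pull (usum B C) In2 x)"
  "pull (usum (usum A B) C) uassoc (vjoin A (usum B C) u (vjoin B C v w)) = vjoin (usum A B) C (vjoin A B u v) w"
  by (auto simp: pull_def vjoin_def restrict_def fun_eq_iff elim!: usumE)

text \<open>A vector on the empty set carries no data, so \<open>w\<close> is arbitrary.\<close>

lemma pull_ucodiag:
  "x \<in> RR A \<Longrightarrow> pull A In2 (pull (usum {} A) ucodiag x) = x"
  "x \<in> RR A \<Longrightarrow> pull A In1 (pull (usum A {}) ucodiag x) = x"
  "pull (usum {} A) ucodiag u = vjoin {} A w u"
  "pull (usum A {}) ucodiag u = vjoin A {} u w"
  by (auto simp: pull_def vjoin_def restrict_def fun_eq_iff RR_def PiE_iff extensional_def elim!: usumE)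

lemma mealy_par_assoc:
  "mealy_iso uassoc uassoc uassoc (dtensor (dtensor X Y) Z) (dtensor X (dtensor Y Z))
     (mealy_par (dtensor X Y) Z (mealy_par X Y m n) k) (mealy_par X (dtensor Y Z) m (mealy_par Y Z n k))"
  unfolding mealy_iso_def by (simp add: bij_betw_uassoc pull_uassoc)

lemma mealy_par_unit:
  "mealy_iso ucodiag ucodiag ucodiag (dtensor dunit X) X (mealy_par dunit X mealy_unit m) m"
  "mealy_iso ucodiag ucodiag ucodiag (dtensor X dunit) X (mealy_par X dunit m mealy_unit) m"
proof -
  show "mealy_iso ucodiag ucodiag ucodiag (dtensor dunit X) X (mealy_par dunit X mealy_unit m) m"
    unfolding mealy_iso_def
    by (simp add: bij_betw_ucodiag pull_ucodiag(1) pull_ucodiag(3)[where w = "\<lambda>v\<in>{}. 0"])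
  show "mealy_iso ucodiag ucodiag ucodiag (dtensor X dunit) X (mealy_par X dunit m mealy_unit) m"
    unfolding mealy_iso_def
    by (simp add: bij_betw_ucodiag pull_ucodiag(2) pull_ucodiag(4)[where w = "\<lambda>v\<in>{}. 0"])
qed

interpretation mealy: wiring_action mealys mealy_rel "\<lambda>b c X X' m m'. \<exists>h. mealy_iso b c h X X' m m'"
  mealy_act mealy_par mealy_unit
  by unfold_locales
    (rule equiv_mealy_rel mealy_rel_iff
    | (rule mealy_act_mealys mealy_act_ident mealy_act_comp mealy_par_mealys mealy_par_cong mealy_par_natural
        mealy_unit_mealys; assumption)
    | (elim exE, rule exI, rule mealy_act_transport; assumption)
    | (rule exI, rule mealy_par_assoc mealy_par_unit))+

lemma mealy_class_cls: "mealy_class = mealy.cls"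
  by (simp add: fun_eq_iff mealy_class_def mealy.cls_def)

lemma Mealy_functor: "Mealy = mealy.class_functor"
  by (simp add: Mealy_def mealy.class_functor_def mealy_class_cls)


section \<open>Open stock-flow diagrams\<close>

lemma nonlink [simp]: "Stock \<notin> range Link" "Flow \<notin> range Link" "Inflow \<notin> range Link" "Outflow \<notin> range Link"
  "Var \<notin> range Link" "SumVar \<notin> range Link" "InPort \<notin> range Link" "OutPort \<notin> range Link"
  "lsrc l \<notin> range Link" "ltgt l \<notin> range Link"
  by (auto, cases l, auto, cases l, auto)

lemma link_span_sel [simp]: "apex (link_span F l) = ob F (Link l)" "sleg (link_span F l) = ar F (A_s l)"
   "tleg (link_span F l) = ar F (A_t l)"
  by (simp_all add: link_span_def)

lemma all_har: "(\<forall>h. P h) \<longleftrightarrow> P A_is \<and> P A_if \<and> P A_os \<and> P A_of \<and> P A_fv \<and> (\<forall>l. P (A_s l)) \<and> (\<forall>l. P (A_t l))"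
  by (metis har.exhaust)

lemma finite_hfun_iff: "finite_hfun F \<longleftrightarrow> (\<forall>v. finite (ob F v)) \<and>
    ar F A_is \<in> ob F Inflow \<rightarrow> ob F Stock \<and> ar F A_if \<in> ob F Inflow \<rightarrow> ob F Flow \<and>
    ar F A_os \<in> ob F Outflow \<rightarrow> ob F Stock \<and> ar F A_of \<in> ob F Outflow \<rightarrow> ob F Flow \<and>
    ar F A_fv \<in> ob F Flow \<rightarrow> ob F Var \<and> (\<forall>l. is_span (ob F (lsrc l)) (ob F (ltgt l)) (link_span F l))"
  unfolding finite_hfun_def all_har is_span_def by (simp add: all_conj_distrib) blast

text \<open>\<open>phi_respects\<close> with the four arguments kept apart instead of bundled into one vector on a
  disjoint union.\<close>

definition phi_local :: "'a sfd \<Rightarrow> bool" where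
  "phi_local F \<longleftrightarrow> (\<forall>b\<in>ob F Var. \<forall>s\<in>RR (ob F Stock). \<forall>s'\<in>RR (ob F Stock). \<forall>w\<in>RR (ob F SumVar). \<forall>w'\<in>RR (ob F SumVar).
     \<forall>v\<in>RR (ob F Var). \<forall>v'\<in>RR (ob F Var). \<forall>a\<in>RR (ob F InPort). \<forall>a'\<in>RR (ob F InPort).
     (\<forall>x. (x, b) \<in> ends (link_span F StockL) \<longrightarrow> s x = s' x) \<longrightarrow>
     (\<forall>x. (x, b) \<in> ends (link_span F SumL) \<longrightarrow> w x = w' x) \<longrightarrow>
     (\<forall>x. (x, b) \<in> ends (link_span F VarL) \<longrightarrow> v x = v' x) \<longrightarrow>
     (\<forall>x. (x, b) \<in> ends (link_span F InL) \<longrightarrow> a x = a' x) \<longrightarrow> phi F s w v a b = phi F s' w' v' a' b)"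

lemma phi_respects_iff:
  fixes F :: "'a sfd"
  assumes fin: "finite_hfun F"
  shows "phi_respects F \<longleftrightarrow> phi_local F"
proof
  let ?A = "Sigma {Stock, SumVar, Var, InPort} (ob F)"
  let ?R = "Sigma {StockL, SumL, VarL, InL} (\<lambda>l. ob F (Link l))"
  let ?s = "\<lambda>(l, e). (lsrc l, ar F (A_s l) e)" and ?t = "\<lambda>(l, e). ar F (A_t l) e"
  let ?\<phi> = "\<lambda>x. phi F (pull (ob F Stock) (Pair Stock) x) (pull (ob F SumVar) (Pair SumVar) x)
                (pull (ob F Var) (Pair Var) x) (pull (ob F InPort) (Pair InPort) x)"
  assume resp: "phi_respects F"
  show "phi_local F"
    unfolding phi_local_def
  proof (intro ballI impI)
    fix b s s' w w' v v' a a'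
    assume b: "b \<in> ob F Var" and RR: "s \<in> RR (ob F Stock)" "s' \<in> RR (ob F Stock)" "w \<in> RR (ob F SumVar)"
      "w' \<in> RR (ob F SumVar)" "v \<in> RR (ob F Var)" "v' \<in> RR (ob F Var)" "a \<in> RR (ob F InPort)" "a' \<in> RR (ob F InPort)"
      and eq: "\<forall>x. (x, b) \<in> ends (link_span F StockL) \<longrightarrow> s x = s' x"
      "\<forall>x. (x, b) \<in> ends (link_span F SumL) \<longrightarrow> w x = w' x"
      "\<forall>x. (x, b) \<in> ends (link_span F VarL) \<longrightarrow> v x = v' x"
      "\<forall>x. (x, b) \<in> ends (link_span F InL) \<longrightarrow> a x = a' x"
    \<comment> \<open>\<open>J\<close> bundles four vectors into one on the tagged union; ports take the default branch.\<close>
    define J where "J = (\<lambda>s w v a. restrict (\<lambda>(t, e). (case t of Stock \<Rightarrow> s e | SumVar \<Rightarrow> w e | Var \<Rightarrow> v e | _ \<Rightarrow> a e) :: real) ?A)"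
    have J: "?\<phi> (J s w v a) = phi F s w v a" if "s \<in> RR (ob F Stock)" "w \<in> RR (ob F SumVar)" "v \<in> RR (ob F Var)" "a \<in> RR (ob F InPort)" for s w v a
    proof -
      have "pull (ob F Stock) (Pair Stock) (J s w v a) = s" by (rule RR_ext[of _ "ob F Stock"]) (simp_all add: that J_def)
      moreover have "pull (ob F SumVar) (Pair SumVar) (J s w v a) = w" by (rule RR_ext[of _ "ob F SumVar"]) (simp_all add: that J_def)
      moreover have "pull (ob F Var) (Pair Var) (J s w v a) = v" by (rule RR_ext[of _ "ob F Var"]) (simp_all add: that J_def)
      moreover have "pull (ob F InPort) (Pair InPort) (J s w v a) = a" by (rule RR_ext[of _ "ob F InPort"]) (simp_all add: that J_def)
      ultimately show ?thesis by simp
    qed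
    have "\<forall>p\<in>?s ` {e \<in> ?R. ?t e = b}. J s w v a p = J s' w' v' a' p"
    proof
      fix p assume "p \<in> ?s ` {e \<in> ?R. ?t e = b}"
      then obtain l e where l: "l \<in> {StockL, SumL, VarL, InL}" and e: "e \<in> ob F (Link l)" "ar F (A_t l) e = b"
        and p: "p = (lsrc l, ar F (A_s l) e)" by auto
      have "(ar F (A_s l) e, b) \<in> ends (link_span F l)" using e by (auto simp: ends_def)
      then show "J s w v a p = J s' w' v' a' p" using l eq by (auto simp: J_def p)
    qed
    moreover have "J s w v a \<in> RR ?A" "J s' w' v' a' \<in> RR ?A" by (simp_all add: J_def)
    ultimately have "?\<phi> (J s w v a) b = ?\<phi> (J s' w' v' a') b"
      using resp b unfolding phi_respects_def respects_span_def by blast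
    then show "phi F s w v a b = phi F s' w' v' a' b"
      using J RR by simp
  qed
next
  let ?A = "Sigma {Stock, SumVar, Var, InPort} (ob F)"
  let ?R = "Sigma {StockL, SumL, VarL, InL} (\<lambda>l. ob F (Link l))"
  let ?s = "\<lambda>(l, e). (lsrc l, ar F (A_s l) e)" and ?t = "\<lambda>(l, e). ar F (A_t l) e"
  assume loc: "phi_local F"
  show "phi_respects F"
    unfolding phi_respects_def respects_span_def
  proof (intro ballI impI)
    fix b and x x' :: "hob \<times> 'a univ \<Rightarrow> real" assume b: "b \<in> ob F Var" and eq: "\<forall>p\<in>?s ` {e \<in> ?R. ?t e = b}. x p = x' p"
    have *: "pull (ob F (lsrc l)) (Pair (lsrc l)) x y = pull (ob F (lsrc l)) (Pair (lsrc l)) x' y"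
      if l: "l \<in> {StockL, SumL, VarL, InL}" and y: "(y, b) \<in> ends (link_span F l)" for l y
    proof -
      obtain e where e: "e \<in> ob F (Link l)" "y = ar F (A_s l) e" "b = ar F (A_t l) e" using y by (auto simp: ends_def)
      have "(lsrc l, y) \<in> ?s ` {e \<in> ?R. ?t e = b}"
        by (rule image_eqI[of _ _ "(l, e)"]) (use e l in simp_all)
      then have "x (lsrc l, y) = x' (lsrc l, y)" using eq by blast
      then show ?thesis by (simp add: pull_def)
    qed
    show "phi F (pull (ob F Stock) (Pair Stock) x) (pull (ob F SumVar) (Pair SumVar) x)
                (pull (ob F Var) (Pair Var) x) (pull (ob F InPort) (Pair InPort) x) b =
       phi F (pull (ob F Stock) (Pair Stock) x') (pull (ob F SumVar) (Pair SumVar) x')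
                (pull (ob F Var) (Pair Var) x') (pull (ob F InPort) (Pair InPort) x') b"
      by (rule loc[unfolded phi_local_def, rule_format, OF b])
        (use *[of StockL] *[of SumL] *[of VarL] *[of InL] in simp_all)
  qed
qed

lemma arcs_ends_var_graph: "arcs_ends (var_graph F) = ends (link_span F VarL)"
  by (simp add: arcs_ends_conv var_graph_def ends_def)

text \<open>Open stock-flow diagrams with the graph conditions in relational form.\<close>

lemma sfds_iff: "F \<in> sfds X \<longleftrightarrow> finite_hfun F \<and>
     inj_on (ar F A_if) (ob F Inflow) \<and> inj_on (ar F A_of) (ob F Outflow) \<and>
     acyclic (ends (link_span F VarL)) \<and> ob F InPort = ins X \<and> ob F OutPort = outs X \<and>
     (\<forall>x v w z. (x, v) \<in> ends (link_span F InL) \<longrightarrow> (v, w) \<in> (ends (link_span F VarL))\<^sup>* \<longrightarrow>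
        (w, z) \<in> ends (link_span F OutL) \<longrightarrow> (x, z) \<in> dep X) \<and>
     phi F \<in> RR (ob F Stock) \<rightarrow> RR (ob F SumVar) \<rightarrow> RR (ob F Var) \<rightarrow> RR (ob F InPort) \<rightarrow> RR (ob F Var) \<and>
     phi_local F"
proof (cases "finite_hfun F")
  case True
  then have span: "is_span (ob F (lsrc l)) (ob F (ltgt l)) (link_span F l)" for l by (simp add: finite_hfun_iff)
  have wf: "wf_digraph (var_graph F)"
    using span[of VarL] by unfold_locales (auto simp: var_graph_def is_span_def Pi_iff)
  have walk: "(\<exists>p. pre_digraph.awalk (var_graph F) v p w) \<longleftrightarrow> (v, w) \<in> (ends (link_span F VarL))\<^sup>*"
    if "(x, v) \<in> ends (link_span F InL)" for x v w
  proof -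
    have "v \<in> verts (var_graph F)"
      using that ends_subset[OF span[of InL]] by (auto simp: var_graph_def)
    then show ?thesis using awalk_iff_rtrancl[OF wf] by (simp add: arcs_ends_var_graph)
  qed
  have "link_dep F = {(x, z). \<exists>v w. (x, v) \<in> ends (link_span F InL) \<and>
      (\<exists>p. pre_digraph.awalk (var_graph F) v p w) \<and> (w, z) \<in> ends (link_span F OutL)}"
    by (fastforce simp: link_dep_def ends_def)
  also have "\<dots> = {(x, z). \<exists>v w. (x, v) \<in> ends (link_span F InL) \<and> (v, w) \<in> (ends (link_span F VarL))\<^sup>* \<and>
       (w, z) \<in> ends (link_span F OutL)}"
    using walk by blast
  finally have dep: "link_dep F = \<dots>" .
  have "link_dep F \<subseteq> dep X \<longleftrightarrow> (\<forall>x v w z. (x, v) \<in> ends (link_span F InL) \<longrightarrow>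
      (v, w) \<in> (ends (link_span F VarL))\<^sup>* \<longrightarrow> (w, z) \<in> ends (link_span F OutL) \<longrightarrow> (x, z) \<in> dep X)"
    unfolding dep by blast
  then show ?thesis
    using True by (simp add: sfds_def phi_respects_iff acyclic_graph_iff[OF wf] arcs_ends_var_graph)
qed (auto simp: sfds_def)

lemma sfds_span:
  assumes "F \<in> sfds X"
  shows "is_span (ob F Stock) (ob F Var) (link_span F StockL)" "is_span (ob F SumVar) (ob F Var) (link_span F SumL)"
    "is_span (ob F Stock) (ob F SumVar) (link_span F StockSumL)" "is_span (ob F Var) (ob F Var) (link_span F VarL)"
    "is_span (ins X) (ob F Var) (link_span F InL)" "is_span (ob F Var) (outs X) (link_span F OutL)"
proof -
  have span: "\<And>l. is_span (ob F (lsrc l)) (ob F (ltgt l)) (link_span F l)"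
    and port: "ob F InPort = ins X" "ob F OutPort = outs X"
    using assms by (simp_all add: sfds_iff finite_hfun_iff)
  show "is_span (ob F Stock) (ob F Var) (link_span F StockL)" "is_span (ob F SumVar) (ob F Var) (link_span F SumL)"
    "is_span (ob F Stock) (ob F SumVar) (link_span F StockSumL)" "is_span (ob F Var) (ob F Var) (link_span F VarL)"
    "is_span (ins X) (ob F Var) (link_span F InL)" "is_span (ob F Var) (outs X) (link_span F OutL)"
    using span[of StockL] span[of SumL] span[of StockSumL] span[of VarL] span[of InL] span[of OutL] port by simp_all
qed

lemma sfdsD:
  assumes "F \<in> sfds X"
  shows "finite (ob F v)" "ob F InPort = ins X" "ob F OutPort = outs X" "acyclic (ends (link_span F VarL))"
    "(x, u) \<in> ends (link_span F InL) \<Longrightarrow> (u, w) \<in> (ends (link_span F VarL))\<^sup>* \<Longrightarrow>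
        (w, z) \<in> ends (link_span F OutL) \<Longrightarrow> (x, z) \<in> dep X"
  using assms by (simp_all add: sfds_iff finite_hfun_iff)

lemma sfds_arrow:
  assumes "F \<in> sfds X"
  shows "ar F A_is \<in> ob F Inflow \<rightarrow> ob F Stock" "ar F A_if \<in> ob F Inflow \<rightarrow> ob F Flow"
    "ar F A_os \<in> ob F Outflow \<rightarrow> ob F Stock" "ar F A_of \<in> ob F Outflow \<rightarrow> ob F Flow"
    "ar F A_fv \<in> ob F Flow \<rightarrow> ob F Var"
  using assms by (simp_all add: sfds_iff finite_hfun_iff)

lemma sfds_phi:
  assumes F: "F \<in> sfds X" and "s \<in> RR (ob F Stock)" "w \<in> RR (ob F SumVar)" "v \<in> RR (ob F Var)" "a \<in> RR (ins X)"
  shows "phi F s w v a \<in> RR (ob F Var)"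
  using assms by (auto simp: sfds_iff Pi_iff)

lemma sfds_phi_local:
  assumes F: "F \<in> sfds X" and b: "b \<in> ob F Var" and RR: "s \<in> RR (ob F Stock)" "s' \<in> RR (ob F Stock)"
    "w \<in> RR (ob F SumVar)" "w' \<in> RR (ob F SumVar)" "v \<in> RR (ob F Var)" "v' \<in> RR (ob F Var)"
    "a \<in> RR (ins X)" "a' \<in> RR (ins X)"
    and eq: "\<And>x. (x, b) \<in> ends (link_span F StockL) \<Longrightarrow> s x = s' x"
     "\<And>x. (x, b) \<in> ends (link_span F SumL) \<Longrightarrow> w x = w' x"
     "\<And>x. (x, b) \<in> ends (link_span F VarL) \<Longrightarrow> v x = v' x"
     "\<And>x. (x, b) \<in> ends (link_span F InL) \<Longrightarrow> a x = a' x"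
  shows "phi F s w v a b = phi F s' w' v' a' b"
proof -
  have "phi_local F" and port: "ob F InPort = ins X" using F by (simp_all add: sfds_iff)
  from this(1)[unfolded phi_local_def port, rule_format, OF b RR eq] show ?thesis .
qed

text \<open>An isomorphism of stock-flow diagrams in which the links are compared by their number only and the
  ports may be relabelled.  Links carry no structure besides their two ends, so nothing is lost.\<close>

definition sfd_iso :: "(hob \<Rightarrow> 'a univ \<Rightarrow> 'a univ) \<Rightarrow> 'a sfd \<Rightarrow> 'a sfd \<Rightarrow> bool" where
  "sfd_iso \<eta> F G \<longleftrightarrow> (\<forall>v. v \<notin> range Link \<longrightarrow> bij_betw (\<eta> v) (ob F v) (ob G v)) \<and>
     (\<forall>h\<in>{A_is, A_if, A_os, A_of, A_fv}. \<forall>e\<in>ob F (hdom h). \<eta> (hcod h) (ar F h e) = ar G h (\<eta> (hdom h) e)) \<and>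
     (\<forall>l. \<forall>a\<in>ob F (lsrc l). \<forall>b\<in>ob F (ltgt l).
        wires (link_span G l) (\<eta> (lsrc l) a) (\<eta> (ltgt l) b) = wires (link_span F l) a b) \<and>
     (\<forall>s\<in>RR (ob G Stock). \<forall>w\<in>RR (ob G SumVar). \<forall>v\<in>RR (ob G Var). \<forall>a\<in>RR (ob G InPort).
        phi F (pull (ob F Stock) (\<eta> Stock) s) (pull (ob F SumVar) (\<eta> SumVar) w) (pull (ob F Var) (\<eta> Var) v)
          (pull (ob F InPort) (\<eta> InPort) a) = pull (ob F Var) (\<eta> Var) (phi G s w v a))"

lemma sfd_isoD:
  assumes "sfd_iso \<eta> F G"
  shows "v \<notin> range Link \<Longrightarrow> bij_betw (\<eta> v) (ob F v) (ob G v)"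
    "h \<in> {A_is, A_if, A_os, A_of, A_fv} \<Longrightarrow> e \<in> ob F (hdom h) \<Longrightarrow> \<eta> (hcod h) (ar F h e) = ar G h (\<eta> (hdom h) e)"
    "a \<in> ob F (lsrc l) \<Longrightarrow> b \<in> ob F (ltgt l) \<Longrightarrow>
        wires (link_span G l) (\<eta> (lsrc l) a) (\<eta> (ltgt l) b) = wires (link_span F l) a b"
    "s \<in> RR (ob G Stock) \<Longrightarrow> w \<in> RR (ob G SumVar) \<Longrightarrow> x \<in> RR (ob G Var) \<Longrightarrow> p \<in> RR (ob G InPort) \<Longrightarrow>
        phi F (pull (ob F Stock) (\<eta> Stock) s) (pull (ob F SumVar) (\<eta> SumVar) w) (pull (ob F Var) (\<eta> Var) x)
          (pull (ob F InPort) (\<eta> InPort) p) = pull (ob F Var) (\<eta> Var) (phi G s w x p)"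
  using assms unfolding sfd_iso_def by blast+

text \<open>Equal numbers of links give bijections of links by \<open>fibrewise_bij\<close>, and these are natural by
  construction.\<close>

lemma sfd_relI:
  assumes F: "F \<in> sfds X" and G: "G \<in> sfds X" and iso: "sfd_iso \<eta> F G"
    and port: "\<And>p. p \<in> ins X \<Longrightarrow> \<eta> InPort p = p" "\<And>p. p \<in> outs X \<Longrightarrow> \<eta> OutPort p = p"
  shows "(F, G) \<in> sfd_rel X"
proof -
  have spanF: "is_span (ob F (lsrc l)) (ob F (ltgt l)) (link_span F l)"
    and spanG: "is_span (ob G (lsrc l)) (ob G (ltgt l)) (link_span G l)" for l
    using F G by (simp_all add: sfds_iff finite_hfun_iff)
  have "\<exists>k. bij_betw k (ob F (Link l)) (ob G (Link l)) \<and>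
      (\<forall>e\<in>ob F (Link l). (ar G (A_s l) (k e), ar G (A_t l) (k e)) = (\<eta> (lsrc l) (ar F (A_s l) e), \<eta> (ltgt l) (ar F (A_t l) e)))" for l
  proof (rule fibrewise_bij)
    show "finite (ob F (Link l))" "finite (ob G (Link l))" using F G by (simp_all add: sfdsD)
    fix c :: "'a univ \<times> 'a univ"
    obtain a' b' where c: "c = (a', b')" by (cases c)
    note bs = sfd_isoD(1)[OF iso, of "lsrc l", simplified] and bt = sfd_isoD(1)[OF iso, of "ltgt l", simplified]
    have sF: "ar F (A_s l) e \<in> ob F (lsrc l)" "ar F (A_t l) e \<in> ob F (ltgt l)" if "e \<in> ob F (Link l)" for e
      using spanF[of l] that by (auto simp: is_span_def Pi_iff)
    have sG: "ar G (A_s l) e \<in> ob G (lsrc l)" "ar G (A_t l) e \<in> ob G (ltgt l)" if "e \<in> ob G (Link l)" for e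
      using spanG[of l] that by (auto simp: is_span_def Pi_iff)
    show "card {e \<in> ob F (Link l). (\<eta> (lsrc l) (ar F (A_s l) e), \<eta> (ltgt l) (ar F (A_t l) e)) = c} =
      card {e \<in> ob G (Link l). (ar G (A_s l) e, ar G (A_t l) e) = c}"
    proof (cases "a' \<in> ob G (lsrc l) \<and> b' \<in> ob G (ltgt l)")
      case True
      then obtain a b where ab: "a \<in> ob F (lsrc l)" "a' = \<eta> (lsrc l) a" "b \<in> ob F (ltgt l)" "b' = \<eta> (ltgt l) b"
        using bij_betw_imp_surj_on[OF bs] bij_betw_imp_surj_on[OF bt] by blast
      have "\<eta> (lsrc l) (ar F (A_s l) e) = a' \<longleftrightarrow> ar F (A_s l) e = a" "\<eta> (ltgt l) (ar F (A_t l) e) = b' \<longleftrightarrow> ar F (A_t l) e = b"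
        if "e \<in> ob F (Link l)" for e
        using bs bt sF[OF that] ab by (auto simp: bij_betw_def inj_on_def)
      then have "{e \<in> ob F (Link l). (\<eta> (lsrc l) (ar F (A_s l) e), \<eta> (ltgt l) (ar F (A_t l) e)) = c} =
         {e \<in> ob F (Link l). ar F (A_s l) e = a \<and> ar F (A_t l) e = b}"
        by (auto simp: c)
      moreover have "wires (link_span G l) a' b' = wires (link_span F l) a b"
        using sfd_isoD(3)[OF iso ab(1,3)] ab by simp
      ultimately show ?thesis by (simp add: wires_def c)
    next
      case False
      then have "{e \<in> ob F (Link l). (\<eta> (lsrc l) (ar F (A_s l) e), \<eta> (ltgt l) (ar F (A_t l) e)) = c} = {}"
        "{e \<in> ob G (Link l). (ar G (A_s l) e, ar G (A_t l) e) = c} = {}"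
        using sF sG bij_betwE[OF bs] bij_betwE[OF bt] by (auto simp: c)
      then show ?thesis by (simp only: card.empty)
    qed
  qed
  then obtain k where k: "\<And>l. bij_betw (k l) (ob F (Link l)) (ob G (Link l))"
    "\<And>l e. e \<in> ob F (Link l) \<Longrightarrow> ar G (A_s l) (k l e) = \<eta> (lsrc l) (ar F (A_s l) e)"
    "\<And>l e. e \<in> ob F (Link l) \<Longrightarrow> ar G (A_t l) (k l e) = \<eta> (ltgt l) (ar F (A_t l) e)"
    by (metis prod.inject)
  \<comment> \<open>\<open>\<eta>\<close> is arbitrary on links and is replaced there by the bijections \<open>k\<close>.\<close>
  define \<theta> where "\<theta> v = (case v of Link l \<Rightarrow> k l | _ \<Rightarrow> \<eta> v)" for v
  have \<theta>_link: "\<theta> (Link l) = k l" for l by (simp add: \<theta>_def)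
  have \<theta>_other: "\<theta> v = \<eta> v" if "v \<notin> range Link" for v using that by (auto simp: \<theta>_def split: hob.split)
  have ports: "ob F InPort = ins X" "ob G InPort = ins X" using F G by (simp_all add: sfdsD)
  show ?thesis
    unfolding sfd_rel_def
  proof (intro CollectI case_prodI conjI exI[of _ \<theta>] allI ballI)
    fix v show "bij_betw (\<theta> v) (ob F v) (ob G v)"
      using k(1) sfd_isoD(1)[OF iso] by (cases "v \<in> range Link") (auto simp: \<theta>_link \<theta>_other)
  next
    fix h e assume "e \<in> ob F (hdom h)"
    then show "\<theta> (hcod h) (ar F h e) = ar G h (\<theta> (hdom h) e)"
      using sfd_isoD(2)[OF iso, of h e] k(2,3) by (cases h) (simp_all add: \<theta>_link \<theta>_other)
  next
    fix s w v a assume "s \<in> RR (ob G Stock)" "w \<in> RR (ob G SumVar)" "v \<in> RR (ob G Var)" "a \<in> RR (ins X)"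
    then show "phi F (pull (ob F Stock) (\<theta> Stock) s) (pull (ob F SumVar) (\<theta> SumVar) w) (pull (ob F Var) (\<theta> Var) v) a =
      pull (ob F Var) (\<theta> Var) (phi G s w v a)"
      using sfd_isoD(4)[OF iso, of s w v a] port(1) by (simp add: \<theta>_other ports pull_id)
  qed (use F G port in \<open>simp_all add: \<theta>_other\<close>)
qed

lemma sfd_relE:
  assumes "(F, G) \<in> sfd_rel X"
  obtains \<eta> where "F \<in> sfds X" "G \<in> sfds X" "sfd_iso \<eta> F G"
    "\<And>p. p \<in> ins X \<Longrightarrow> \<eta> InPort p = p" "\<And>p. p \<in> outs X \<Longrightarrow> \<eta> OutPort p = p"
proof -
  from assms obtain \<eta> where F: "F \<in> sfds X" and G: "G \<in> sfds X" and bij: "\<And>v. bij_betw (\<eta> v) (ob F v) (ob G v)"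
    and nat: "\<And>h e. e \<in> ob F (hdom h) \<Longrightarrow> \<eta> (hcod h) (ar F h e) = ar G h (\<eta> (hdom h) e)"
    and port: "\<forall>p\<in>ins X. \<eta> InPort p = p" "\<forall>p\<in>outs X. \<eta> OutPort p = p"
    and phi: "\<forall>s \<in> RR (ob G Stock). \<forall>w \<in> RR (ob G SumVar). \<forall>v \<in> RR (ob G Var). \<forall>a \<in> RR (ins X).
           phi F (pull (ob F Stock) (\<eta> Stock) s) (pull (ob F SumVar) (\<eta> SumVar) w)
                 (pull (ob F Var) (\<eta> Var) v) a = pull (ob F Var) (\<eta> Var) (phi G s w v a)"
    unfolding sfd_rel_def by blast
  have spanF: "is_span (ob F (lsrc l)) (ob F (ltgt l)) (link_span F l)" for l
    using F by (simp add: sfds_iff finite_hfun_iff)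
  have ports: "ob F InPort = ins X" "ob G InPort = ins X" using F G by (simp_all add: sfdsD)
  have "sfd_iso \<eta> F G"
    unfolding sfd_iso_def
  proof (intro conjI allI ballI impI)
    fix l a b assume ab: "a \<in> ob F (lsrc l)" "b \<in> ob F (ltgt l)"
    have sF: "ar F (A_s l) e \<in> ob F (lsrc l)" "ar F (A_t l) e \<in> ob F (ltgt l)" if "e \<in> ob F (Link l)" for e
      using spanF[of l] that by (auto simp: is_span_def Pi_iff)
    have nat': "ar G (A_s l) (\<eta> (Link l) e) = \<eta> (lsrc l) (ar F (A_s l) e)"
      "ar G (A_t l) (\<eta> (Link l) e) = \<eta> (ltgt l) (ar F (A_t l) e)" if "e \<in> ob F (Link l)" for e
      using nat[of e "A_s l"] nat[of e "A_t l"] that by simp_all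
    let ?S = "{e \<in> ob F (Link l). ar F (A_s l) e = a \<and> ar F (A_t l) e = b}"
    let ?T = "{e \<in> ob G (Link l). ar G (A_s l) e = \<eta> (lsrc l) a \<and> ar G (A_t l) e = \<eta> (ltgt l) b}"
    have "\<eta> (Link l) ` ?S = ?T"
    proof (intro equalityI subsetI)
      fix y assume "y \<in> \<eta> (Link l) ` ?S"
      then obtain e where "e \<in> ob F (Link l)" "ar F (A_s l) e = a" "ar F (A_t l) e = b" "y = \<eta> (Link l) e" by blast
      then show "y \<in> ?T" using bij_betwE[OF bij[of "Link l"]] by (simp add: nat')
    next
      fix y assume y: "y \<in> ?T"
      then obtain e where e: "e \<in> ob F (Link l)" "y = \<eta> (Link l) e"
        using bij_betw_imp_surj_on[OF bij[of "Link l"]] by blast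
      have "ar F (A_s l) e = a"
        using y e nat'(1)[OF e(1)] inj_onD[OF bij_betw_imp_inj_on[OF bij[of "lsrc l"]] _ sF(1)[OF e(1)] ab(1)] by simp
      moreover have "ar F (A_t l) e = b"
        using y e nat'(2)[OF e(1)] inj_onD[OF bij_betw_imp_inj_on[OF bij[of "ltgt l"]] _ sF(2)[OF e(1)] ab(2)] by simp
      ultimately show "y \<in> \<eta> (Link l) ` ?S" using e by blast
    qed
    moreover have "inj_on (\<eta> (Link l)) ?S"
      by (rule inj_on_subset[OF bij_betw_imp_inj_on[OF bij[of "Link l"]]]) simp
    ultimately have "card ?T = card ?S" by (auto dest: card_image)
    then show "wires (link_span G l) (\<eta> (lsrc l) a) (\<eta> (ltgt l) b) = wires (link_span F l) a b"
      by (simp add: wires_def)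
  qed (use bij nat phi port ports in \<open>simp_all add: pull_id\<close>)
  then show ?thesis using F G port that by blast
qed

lemma sfd_iso_refl:
  assumes "F \<in> sfds X"
  shows "sfd_iso (\<lambda>_. id) F F"
  unfolding sfd_iso_def using sfds_phi[OF assms] by (simp add: pull_id sfdsD(2)[OF assms])

lemma sfd_iso_sym:
  assumes F: "F \<in> sfds X" and G: "G \<in> sfds X'" and iso: "sfd_iso \<eta> F G"
  shows "sfd_iso (\<lambda>v. inv_into (ob F v) (\<eta> v)) G F"
proof -
  note bij = sfd_isoD(1)[OF iso]
  have ports: "ob F InPort = ins X" "ob G InPort = ins X'" using F G by (simp_all add: sfdsD)
  have inv: "inv_into (ob F v) (\<eta> v) y \<in> ob F v" "\<eta> v (inv_into (ob F v) (\<eta> v) y) = y"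
    if "v \<notin> range Link" "y \<in> ob G v" for v y
    using bij[OF that(1)] that(2) by (auto simp: bij_betw_def inv_into_into f_inv_into_f)
  have typed: "\<forall>h\<in>{A_is, A_if, A_os, A_of, A_fv}. ar F h \<in> ob F (hdom h) \<rightarrow> ob F (hcod h)"
    using sfds_arrow[OF F] by simp
  show ?thesis
    unfolding sfd_iso_def
  proof (intro conjI allI ballI impI)
    fix v :: hob assume "v \<notin> range Link"
    then show "bij_betw (inv_into (ob F v) (\<eta> v)) (ob G v) (ob F v)" by (rule bij_betw_inv_into[OF bij])
  next
    fix h y assume h: "h \<in> {A_is, A_if, A_os, A_of, A_fv}" and y: "y \<in> ob G (hdom h)"
    have nl: "hdom h \<notin> range Link" "hcod h \<notin> range Link" using h by auto
    let ?e = "inv_into (ob F (hdom h)) (\<eta> (hdom h)) y"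
    have e: "?e \<in> ob F (hdom h)" "\<eta> (hdom h) ?e = y" using inv[OF nl(1) y] by simp_all
    have "\<eta> (hcod h) (ar F h ?e) = ar G h y" using sfd_isoD(2)[OF iso h e(1)] e(2) by simp
    moreover have "ar F h ?e \<in> ob F (hcod h)" using typed h e(1) by (simp only: Pi_iff)
    ultimately show "inv_into (ob F (hcod h)) (\<eta> (hcod h)) (ar G h y) = ar F h ?e"
      using bij_betw_inv_into_left[OF bij[OF nl(2)]] by metis
  next
    fix l a b assume "a \<in> ob G (lsrc l)" "b \<in> ob G (ltgt l)"
    then show "wires (link_span F l) (inv_into (ob F (lsrc l)) (\<eta> (lsrc l)) a) (inv_into (ob F (ltgt l)) (\<eta> (ltgt l)) b)
      = wires (link_span G l) a b"
      using sfd_isoD(3)[OF iso inv(1)[of "lsrc l" a] inv(1)[of "ltgt l" b]] inv(2)[of "lsrc l" a] inv(2)[of "ltgt l" b] by simp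
  next
    fix s w v a assume RR: "s \<in> RR (ob F Stock)" "w \<in> RR (ob F SumVar)" "v \<in> RR (ob F Var)" "a \<in> RR (ob F InPort)"
    let ?s = "pull (ob G Stock) (inv_into (ob F Stock) (\<eta> Stock)) s"
    let ?w = "pull (ob G SumVar) (inv_into (ob F SumVar) (\<eta> SumVar)) w"
    let ?v = "pull (ob G Var) (inv_into (ob F Var) (\<eta> Var)) v"
    let ?a = "pull (ob G InPort) (inv_into (ob F InPort) (\<eta> InPort)) a"
    have "phi F s w v a = pull (ob F Var) (\<eta> Var) (phi G ?s ?w ?v ?a)"
      using sfd_isoD(4)[OF iso, of ?s ?w ?v ?a] RR by (simp add: pull_inverse(1)[OF bij])
    then show "phi G ?s ?w ?v ?a = pull (ob G Var) (inv_into (ob F Var) (\<eta> Var)) (phi F s w v a)"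
      using sfds_phi[OF G, of ?s ?w ?v ?a] by (simp add: pull_inverse(2)[OF bij] ports)
  qed
qed

lemma sfd_iso_trans:
  assumes iso: "sfd_iso \<eta> F G" "sfd_iso \<theta> G H"
  shows "sfd_iso (\<lambda>v. \<theta> v \<circ> \<eta> v) F H"
proof -
  note bij = sfd_isoD(1)[OF iso(1)] sfd_isoD(1)[OF iso(2)]
  have maps: "\<eta> v x \<in> ob G v" if "v \<notin> range Link" "x \<in> ob F v" for v x
    using bij_betwE[OF bij(1)[OF that(1)]] that(2) by blast
  have p: "pull (ob F v) (\<theta> v \<circ> \<eta> v) x = pull (ob F v) (\<eta> v) (pull (ob G v) (\<theta> v) x)" if "v \<notin> range Link" for v x
    by (rule pull_pull[symmetric]) (rule bij_betw_imp_funcset[OF bij(1)[OF that]])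
  show ?thesis
    unfolding sfd_iso_def
  proof (intro conjI allI ballI impI)
    fix v :: hob assume "v \<notin> range Link"
    then show "bij_betw (\<theta> v \<circ> \<eta> v) (ob F v) (ob H v)" by (intro bij_betw_trans[OF bij(1) bij(2)])
  next
    fix h e assume h: "h \<in> {A_is, A_if, A_os, A_of, A_fv}" and e: "e \<in> ob F (hdom h)"
    have nl: "hdom h \<notin> range Link" using h by auto
    show "(\<theta> (hcod h) \<circ> \<eta> (hcod h)) (ar F h e) = ar H h ((\<theta> (hdom h) \<circ> \<eta> (hdom h)) e)"
      using sfd_isoD(2)[OF iso(1) h e] sfd_isoD(2)[OF iso(2) h maps[OF nl e]] by simp
  next
    fix l a b assume ab: "a \<in> ob F (lsrc l)" "b \<in> ob F (ltgt l)"
    show "wires (link_span H l) ((\<theta> (lsrc l) \<circ> \<eta> (lsrc l)) a) ((\<theta> (ltgt l) \<circ> \<eta> (ltgt l)) b) = wires (link_span F l) a b"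
      using sfd_isoD(3)[OF iso(1) ab] sfd_isoD(3)[OF iso(2) maps[OF _ ab(1)] maps[OF _ ab(2)]] by simp
  next
    fix s w v a assume "s \<in> RR (ob H Stock)" "w \<in> RR (ob H SumVar)" "v \<in> RR (ob H Var)" "a \<in> RR (ob H InPort)"
    then show "phi F (pull (ob F Stock) (\<theta> Stock \<circ> \<eta> Stock) s) (pull (ob F SumVar) (\<theta> SumVar \<circ> \<eta> SumVar) w)
        (pull (ob F Var) (\<theta> Var \<circ> \<eta> Var) v) (pull (ob F InPort) (\<theta> InPort \<circ> \<eta> InPort) a) =
      pull (ob F Var) (\<theta> Var \<circ> \<eta> Var) (phi H s w v a)"
      by (simp add: p sfd_isoD(4)[OF iso(1)] sfd_isoD(4)[OF iso(2)])
  qed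
qed

lemma equiv_sfd_rel: "equiv (sfds X) (sfd_rel X)"
proof (rule equivI)
  show "sfd_rel X \<subseteq> sfds X \<times> sfds X" by (auto simp: sfd_rel_def)
  show "refl_on (sfds X) (sfd_rel X)"
    by (rule refl_onI) (rule sfd_relI[OF _ _ sfd_iso_refl]; simp)
  show "sym (sfd_rel X)"
  proof (rule symI)
    fix F G assume "(F, G) \<in> sfd_rel X"
    then obtain \<eta> where F: "F \<in> sfds X" and G: "G \<in> sfds X" and iso: "sfd_iso \<eta> F G"
      and port: "\<And>p. p \<in> ins X \<Longrightarrow> \<eta> InPort p = p" "\<And>p. p \<in> outs X \<Longrightarrow> \<eta> OutPort p = p"
      by (rule sfd_relE) blast
    have bij: "bij_betw (\<eta> InPort) (ins X) (ins X)" "bij_betw (\<eta> OutPort) (outs X) (outs X)"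
      using sfd_isoD(1)[OF iso, of InPort] sfd_isoD(1)[OF iso, of OutPort] F G by (simp_all add: sfdsD)
    have "inv_into (ins X) (\<eta> InPort) p = p" if "p \<in> ins X" for p
      using bij_betw_inv_into_left[OF bij(1) that] port(1)[OF that] by simp
    moreover have "inv_into (outs X) (\<eta> OutPort) p = p" if "p \<in> outs X" for p
      using bij_betw_inv_into_left[OF bij(2) that] port(2)[OF that] by simp
    ultimately show "(G, F) \<in> sfd_rel X"
      using F G by (intro sfd_relI[OF G F sfd_iso_sym[OF F G iso]]) (simp_all add: sfdsD)
  qed
  show "trans (sfd_rel X)"
  proof (rule transI)
    fix F G H assume FG: "(F, G) \<in> sfd_rel X" and GH: "(G, H) \<in> sfd_rel X"
    obtain \<eta> where F: "F \<in> sfds X" and 1: "sfd_iso \<eta> F G"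
      "\<And>p. p \<in> ins X \<Longrightarrow> \<eta> InPort p = p" "\<And>p. p \<in> outs X \<Longrightarrow> \<eta> OutPort p = p"
      using FG by (rule sfd_relE) blast
    obtain \<theta> where H: "H \<in> sfds X" and 2: "sfd_iso \<theta> G H"
      "\<And>p. p \<in> ins X \<Longrightarrow> \<theta> InPort p = p" "\<And>p. p \<in> outs X \<Longrightarrow> \<theta> OutPort p = p"
      using GH by (rule sfd_relE) blast
    show "(F, H) \<in> sfd_rel X"
      by (rule sfd_relI[OF F H sfd_iso_trans[OF 1(1) 2(1)]]) (simp_all add: 1 2)
  qed
qed


section \<open>The lax monoidal functor of open stock-flow diagrams\<close>

text \<open>Rewiring changes the ports and some of the links.  For two rewirings of the same diagram it suffices
  to compare link counts and \<open>phi\<close>.\<close>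

lemma sfd_rel_sameI:
  assumes F: "F \<in> sfds X" and G: "G \<in> sfds X"
    and ob: "\<And>v. v \<notin> range Link \<Longrightarrow> ob F v = ob G v"
    and ar: "\<And>h. h \<in> {A_is, A_if, A_os, A_of, A_fv} \<Longrightarrow> ar F h = ar G h"
    and links: "\<And>l a b. a \<in> ob F (lsrc l) \<Longrightarrow> b \<in> ob F (ltgt l) \<Longrightarrow>
       wires (link_span G l) a b = wires (link_span F l) a b"
    and phi: "\<And>s w v a. s \<in> RR (ob F Stock) \<Longrightarrow> w \<in> RR (ob F SumVar) \<Longrightarrow> v \<in> RR (ob F Var) \<Longrightarrow>
       a \<in> RR (ins X) \<Longrightarrow> phi F s w v a = phi G s w v a"
  shows "(F, G) \<in> sfd_rel X"
proof (rule sfd_relI[OF F G])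
  have eq: "ob G Stock = ob F Stock" "ob G SumVar = ob F SumVar" "ob G Var = ob F Var" "ob G InPort = ob F InPort"
    "ob F InPort = ins X"
    using ob[of Stock] ob[of SumVar] ob[of Var] ob[of InPort] sfdsD(2)[OF F] by simp_all
  show "sfd_iso (\<lambda>_. id) F G"
    unfolding sfd_iso_def
  proof (intro conjI allI ballI impI)
    fix v :: hob assume "v \<notin> range Link" then show "bij_betw id (ob F v) (ob G v)" by (simp add: ob)
  next
    fix h e assume "h \<in> {A_is, A_if, A_os, A_of, A_fv}"
    then show "id (ar F h e) = ar G h (id e)" by (simp only: ar id_apply)
  next
    fix s w v a assume "s \<in> RR (ob G Stock)" "w \<in> RR (ob G SumVar)" "v \<in> RR (ob G Var)" "a \<in> RR (ob G InPort)"
    then have "s \<in> RR (ob F Stock)" "w \<in> RR (ob F SumVar)" "v \<in> RR (ob F Var)" "a \<in> RR (ins X)"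
      by (simp_all only: eq)
    then show "phi F (pull (ob F Stock) id s) (pull (ob F SumVar) id w) (pull (ob F Var) id v) (pull (ob F InPort) id a) =
       pull (ob F Var) id (phi G s w v a)"
      using sfds_phi[OF F, of s w v a] phi[of s w v a] by (simp add: pull_id eq(5))
  qed (simp add: links)
qed simp_all

lemma sfd_act_sel [simp]:
  "ob (sfd_act X Y f F) Stock = ob F Stock" "ob (sfd_act X Y f F) Flow = ob F Flow"
  "ob (sfd_act X Y f F) Inflow = ob F Inflow" "ob (sfd_act X Y f F) Outflow = ob F Outflow"
  "ob (sfd_act X Y f F) Var = ob F Var" "ob (sfd_act X Y f F) SumVar = ob F SumVar"
  "ob (sfd_act X Y f F) InPort = ins Y" "ob (sfd_act X Y f F) OutPort = outs Y"
  "ar (sfd_act X Y f F) A_is = ar F A_is" "ar (sfd_act X Y f F) A_if = ar F A_if"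
  "ar (sfd_act X Y f F) A_os = ar F A_os" "ar (sfd_act X Y f F) A_of = ar F A_of" "ar (sfd_act X Y f F) A_fv = ar F A_fv"
  "link_span (sfd_act X Y f F) StockL = link_span F StockL" "link_span (sfd_act X Y f F) SumL = link_span F SumL"
  "link_span (sfd_act X Y f F) StockSumL = link_span F StockSumL"
  "link_span (sfd_act X Y f F) VarL = act_var_links f F"
  "link_span (sfd_act X Y f F) InL = act_in_links f F" "link_span (sfd_act X Y f F) OutL = act_out_links f F"
  "phi (sfd_act X Y f F) s w v y = phi F s w v (vadd (ins X) (span_map (win f) (ins X) y)
      (span_map (wtr f) (ins X) (span_map (link_span F OutL) (outs X) v)))"
  by (simp_all add: sfd_act_def link_span_def)

lemma act_links_span:
  assumes f: "f \<in> wirings X Y" and F: "F \<in> sfds X"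
  shows "is_span (ins Y) (ob F Var) (act_in_links f F)" "is_span (ob F Var) (outs Y) (act_out_links f F)"
    "is_span (ob F Var) (ob F Var) (act_var_links f F)"
  using wiringsD[OF f] sfds_span[OF F] unfolding act_in_links_def act_out_links_def act_var_links_def
  by (blast intro: is_span_comp is_span_plus)+

lemma act_links_wires:
  assumes f: "f \<in> wirings X Y" and F: "F \<in> sfds X" and X: "X \<in> dboxes"
  shows "wires (act_in_links f F) = mmult (ins X) (wires (win f)) (wires (link_span F InL))"
    "wires (act_out_links f F) = mmult (outs X) (wires (link_span F OutL)) (wires (wout f))"
    "wires (act_var_links f F) = (\<lambda>a b. wires (link_span F VarL) a b +
       mmult (ins X) (mmult (outs X) (wires (link_span F OutL)) (wires (wtr f))) (wires (link_span F InL)) a b)"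
proof -
  note w = wiringsD[OF f] and l = sfds_span[OF F] and fin = dboxesD(1,2)[OF X]
  note c1 = is_span_comp[OF l(6) w(2)]
  note c2 = is_span_comp[OF c1 l(5)]
  have fin': "finite (ob F (Link VarL))" "finite (apex (span_comp (span_comp (link_span F OutL) (wtr f)) (link_span F InL)))"
    using c2 F by (simp_all add: is_span_def sfdsD)
  show "wires (act_in_links f F) = mmult (ins X) (wires (win f)) (wires (link_span F InL))"
    using fin by (simp add: act_in_links_def wires_comp[OF w(1) l(5)])
  show "wires (act_out_links f F) = mmult (outs X) (wires (link_span F OutL)) (wires (wout f))"
    using fin by (simp add: act_out_links_def wires_comp[OF l(6) w(3)])
  show "wires (act_var_links f F) = (\<lambda>a b. wires (link_span F VarL) a b +
       mmult (ins X) (mmult (outs X) (wires (link_span F OutL)) (wires (wtr f))) (wires (link_span F InL)) a b)"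
    using fin fin' by (simp add: act_var_links_def fun_eq_iff wires_plus wires_comp[OF c1 l(5)] wires_comp[OF l(6) w(2)])
qed

lemma act_links_ends:
  "ends (act_in_links f F) = ends (win f) O ends (link_span F InL)"
  "ends (act_out_links f F) = ends (link_span F OutL) O ends (wout f)"
  "ends (act_var_links f F) = ends (link_span F VarL) \<union> ends (link_span F OutL) O ends (wtr f) O ends (link_span F InL)"
  by (simp_all add: act_in_links_def act_out_links_def act_var_links_def ends_comp ends_plus O_assoc)

text \<open>Feedback with the variable links as the inner relation, in and out links as entries and exits, and
  the trace graph of \<open>f\<close> as the outer relation; the dependency \<open>d\<^sub>X\<close> bounds the passages.  For
  locality, an input reaches \<open>phi\<close> either from outside, along a new in link, or from a variable
  along out link, trace wire and in link, which is a new variable link.\<close>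

lemma sfd_act_sfds:
  fixes F :: "'a sfd"
  assumes f: "dwiring X Y f" and F: "F \<in> sfds X"
  shows "sfd_act X Y f F \<in> sfds Y"
proof -
  let ?G = "sfd_act X Y f F"
  note fw = dwiringD(3)[OF f]
  note w = wiringsD[OF fw] and l = sfds_span[OF F]
  note al = act_links_span[OF fw F]
  have fin: "finite (ob ?G v)" for v
    using sfdsD(1)[OF F, of v] dwiring_finite(3,4)[OF f] al
    by (simp add: sfd_act_def is_span_def)
  have span: "is_span (ob ?G (lsrc k)) (ob ?G (ltgt k)) (link_span ?G k)" for k
    using l al by (cases k) simp_all
  have hf: "finite_hfun ?G"
    unfolding finite_hfun_iff using fin span sfds_arrow[OF F] by simp
  \<comment> \<open>Feedback enters through in ports and leaves through out ports, as vertices of the trace graph.\<close>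
  define I :: "(('a univ + 'a univ) \<times> 'a univ) set" where "I = map_prod Inl id ` ends (link_span F InL)"
  define K :: "('a univ \<times> ('a univ + 'a univ)) set" where "K = map_prod id Inr ` ends (link_span F OutL)"
  define W :: "(('a univ + 'a univ) \<times> ('a univ + 'a univ)) set" where "W = map_prod Inr Inl ` ends (wtr f)"
  have var: "ends (link_span ?G VarL) = ends (link_span F VarL) \<union> K O W O I"
    by (simp add: act_links_ends I_def K_def W_def map_prod_relcomp map_prod.id)
  have WQ: "W \<subseteq> trel X f" by (auto simp: W_def trel_def)
  have inner: "I O (ends (link_span F VarL))\<^sup>* O K \<subseteq> trel X f"
    using sfdsD(5)[OF F] by (auto simp: I_def K_def trel_def)
  have acyc: "acyclic (ends (link_span ?G VarL))"
    unfolding var using WQ inner sfdsD(4)[OF F] dwiringD(4)[OF f] by (rule feedback_acyclic)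
  have dep: "(y, z) \<in> dep Y" if y: "(y, v) \<in> ends (link_span ?G InL)"
    and p: "(v, u) \<in> (ends (link_span ?G VarL))\<^sup>*" and z: "(u, z) \<in> ends (link_span ?G OutL)" for y v u z
  proof -
    from y obtain x where x: "(y, x) \<in> ends (win f)" "(x, v) \<in> ends (link_span F InL)"
      by (auto simp: act_links_ends)
    from z obtain k where k: "(u, k) \<in> ends (link_span F OutL)" "(k, z) \<in> ends (wout f)"
      by (auto simp: act_links_ends)
    have "(Inl x, v) \<in> I" "(u, Inr k) \<in> K" using x k by (force simp: I_def K_def)+
    then have "(Inl x, Inr k) \<in> (trel X f)\<^sup>+"
      using feedback_through[OF WQ inner] p[unfolded var] by blast
    then show ?thesis using dwiringD(5)[OF f x(1) _ k(2)] by (blast intro: trancl_into_rtrancl)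
  qed
  have typed: "phi ?G \<in> RR (ob ?G Stock) \<rightarrow> RR (ob ?G SumVar) \<rightarrow> RR (ob ?G Var) \<rightarrow> RR (ob ?G InPort) \<rightarrow> RR (ob ?G Var)"
    using sfds_phi[OF F] by (simp add: Pi_iff)
  have loc: "phi_local ?G"
    unfolding phi_local_def sfd_act_sel
  proof (intro ballI impI)
    fix b s s' q q' v v' y y'
    assume b: "b \<in> ob F Var" and RR: "s \<in> RR (ob F Stock)" "s' \<in> RR (ob F Stock)" "q \<in> RR (ob F SumVar)"
      "q' \<in> RR (ob F SumVar)" "v \<in> RR (ob F Var)" "v' \<in> RR (ob F Var)" "y \<in> RR (ins Y)" "y' \<in> RR (ins Y)"
      and eq: "\<forall>x. (x, b) \<in> ends (link_span F StockL) \<longrightarrow> s x = s' x"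
      "\<forall>x. (x, b) \<in> ends (link_span F SumL) \<longrightarrow> q x = q' x"
      "\<forall>x. (x, b) \<in> ends (act_var_links f F) \<longrightarrow> v x = v' x"
      "\<forall>x. (x, b) \<in> ends (act_in_links f F) \<longrightarrow> y x = y' x"
    show "phi F s q v (vadd (ins X) (span_map (win f) (ins X) y)
         (span_map (wtr f) (ins X) (span_map (link_span F OutL) (outs X) v))) b =
       phi F s' q' v' (vadd (ins X) (span_map (win f) (ins X) y')
         (span_map (wtr f) (ins X) (span_map (link_span F OutL) (outs X) v'))) b"
    proof (rule sfds_phi_local[OF F b RR(1-6)])
      fix x assume x: "(x, b) \<in> ends (link_span F InL)"
      then have xX: "x \<in> ins X" using ends_subset[OF l(5)] by blast
      have "span_map (win f) (ins X) y x = span_map (win f) (ins X) y' x"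
        by (rule span_map_cong[OF w(1) xX]) (use x eq(4) in \<open>auto simp: act_links_ends\<close>)
      moreover have "span_map (wtr f) (ins X) (span_map (link_span F OutL) (outs X) v) x =
          span_map (wtr f) (ins X) (span_map (link_span F OutL) (outs X) v') x"
      proof (rule span_map_cong[OF w(2) xX])
        fix k assume k: "(k, x) \<in> ends (wtr f)"
        then have kX: "k \<in> outs X" using ends_subset[OF w(2)] by blast
        show "span_map (link_span F OutL) (outs X) v k = span_map (link_span F OutL) (outs X) v' k"
          by (rule span_map_cong[OF l(6) kX]) (use x k eq(3) in \<open>auto simp: act_links_ends\<close>)
      qed
      ultimately show "vadd (ins X) (span_map (win f) (ins X) y)
         (span_map (wtr f) (ins X) (span_map (link_span F OutL) (outs X) v)) x =
        vadd (ins X) (span_map (win f) (ins X) y')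
         (span_map (wtr f) (ins X) (span_map (link_span F OutL) (outs X) v')) x"
        using xX by simp
    qed (use eq in \<open>simp_all add: act_links_ends\<close>)
  qed
  show ?thesis
    unfolding sfds_iff using hf acyc typed loc F by (auto simp: sfds_iff[of F] intro: dep)
qed

lemma mmult_transport:
  assumes "bij_betw \<beta> B B'" "\<And>b. b \<in> B \<Longrightarrow> M' a' (\<beta> b) = M a b" "\<And>b. b \<in> B \<Longrightarrow> N' (\<beta> b) c' = N b c"
  shows "mmult B' M' N' a' c' = mmult B M N a c"
  unfolding mmult_def sum.reindex_bij_betw[OF assms(1), symmetric]
  by (rule sum.cong) (simp_all add: assms(2,3))

text \<open>Each new matrix of links is a sum of matrix products over old ports; reindexing these sums along the
  relabelling of the ports shows that the link counts match.\<close>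

lemma sfd_act_transport:
  assumes sq: "wiring_square (\<eta> InPort) (\<eta> OutPort) b' c' X Y f X' Y' f'"
    and f: "dwiring X Y f" and f': "dwiring X' Y' f'"
    and F: "F \<in> sfds X" and G: "G \<in> sfds X'" and iso: "sfd_iso \<eta> F G"
  shows "sfd_iso (\<eta>(InPort := b', OutPort := c')) (sfd_act X Y f F) (sfd_act X' Y' f' G)"
proof -
  let ?\<theta> = "\<eta>(InPort := b', OutPort := c')"
  let ?F = "sfd_act X Y f F" and ?G = "sfd_act X' Y' f' G"
  note fw = dwiringD(3)[OF f] and fw' = dwiringD(3)[OF f']
  note w = wiringsD[OF fw] and w' = wiringsD[OF fw'] and lF = sfds_span[OF F] and lG = sfds_span[OF G]
  note fin = dwiring_finite(1,2)[OF f] dwiring_finite(1,2)[OF f']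
    dwiring_finite(3,4)[OF f] dwiring_finite(3,4)[OF f']
  have bij: "bij_betw (\<eta> InPort) (ins X) (ins X')" "bij_betw (\<eta> OutPort) (outs X) (outs X')"
     "bij_betw b' (ins Y) (ins Y')" "bij_betw c' (outs Y) (outs Y')"
    and eq: "\<And>y x. y \<in> ins Y \<Longrightarrow> x \<in> ins X \<Longrightarrow> wires (win f') (b' y) (\<eta> InPort x) = wires (win f) y x"
     "\<And>k x. k \<in> outs X \<Longrightarrow> x \<in> ins X \<Longrightarrow> wires (wtr f') (\<eta> OutPort k) (\<eta> InPort x) = wires (wtr f) k x"
     "\<And>k z. k \<in> outs X \<Longrightarrow> z \<in> outs Y \<Longrightarrow> wires (wout f') (\<eta> OutPort k) (c' z) = wires (wout f) k z"
    using sq by (simp_all add: wiring_square_def)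
  note bv = sfd_isoD(1)[OF iso]
  note in_fun = bij_betw_imp_funcset[OF bij(1)] and out_fun = bij_betw_imp_funcset[OF bij(2)]
  have inL: "wires (link_span G InL) (\<eta> InPort x) (\<eta> Var v) = wires (link_span F InL) x v" if "x \<in> ins X" "v \<in> ob F Var" for x v
    using sfd_isoD(3)[OF iso, of x InL v] that by (simp add: sfdsD(2)[OF F])
  have outL: "wires (link_span G OutL) (\<eta> Var v) (\<eta> OutPort z) = wires (link_span F OutL) v z" if "z \<in> outs X" "v \<in> ob F Var" for z v
    using sfd_isoD(3)[OF iso, of v OutL z] that by (simp add: sfdsD(3)[OF F])
  have varL: "wires (link_span G VarL) (\<eta> Var u) (\<eta> Var v) = wires (link_span F VarL) u v" if "u \<in> ob F Var" "v \<in> ob F Var" for u v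
    using sfd_isoD(3)[OF iso, of u VarL v] that by simp
  show ?thesis
    unfolding sfd_iso_def
  proof (intro conjI allI ballI impI)
    fix v assume v: "v \<notin> range Link"
    show "bij_betw (?\<theta> v) (ob ?F v) (ob ?G v)"
      using v bij bv[of v] by (cases v) simp_all
  next
    fix h e assume h: "h \<in> {A_is, A_if, A_os, A_of, A_fv}" and e: "e \<in> ob ?F (hdom h)"
    then show "?\<theta> (hcod h) (ar ?F h e) = ar ?G h (?\<theta> (hdom h) e)"
      using sfd_isoD(2)[OF iso h, of e] by auto
  next
    fix l a b assume ab: "a \<in> ob ?F (lsrc l)" "b \<in> ob ?F (ltgt l)"
    show "wires (link_span ?G l) (?\<theta> (lsrc l) a) (?\<theta> (ltgt l) b) = wires (link_span ?F l) a b"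
    proof (cases l)
      case InL
      then show ?thesis
        using ab by (simp add: act_links_wires[OF fw F dwiringD(1)[OF f]] act_links_wires[OF fw' G dwiringD(1)[OF f']])
          (rule mmult_transport[OF bij(1)]; simp add: eq inL)
    next
      case OutL
      then show ?thesis
        using ab by (simp add: act_links_wires[OF fw F dwiringD(1)[OF f]] act_links_wires[OF fw' G dwiringD(1)[OF f']])
          (rule mmult_transport[OF bij(2)]; simp add: eq outL)
    next
      case VarL
      have "mmult (ins X') (mmult (outs X') (wires (link_span G OutL)) (wires (wtr f'))) (wires (link_span G InL)) (\<eta> Var a) (\<eta> Var b)
        = mmult (ins X) (mmult (outs X) (wires (link_span F OutL)) (wires (wtr f))) (wires (link_span F InL)) a b"
      proof (rule mmult_transport[OF bij(1)])
        fix x assume x: "x \<in> ins X"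
        show "mmult (outs X') (wires (link_span G OutL)) (wires (wtr f')) (\<eta> Var a) (\<eta> InPort x) =
          mmult (outs X) (wires (link_span F OutL)) (wires (wtr f)) a x"
          by (rule mmult_transport[OF bij(2)]) (use x ab VarL in \<open>simp_all add: eq outL\<close>)
        show "wires (link_span G InL) (\<eta> InPort x) (\<eta> Var b) = wires (link_span F InL) x b"
          using x ab VarL by (simp add: inL)
      qed
      then show ?thesis
        using VarL ab by (simp add: act_links_wires[OF fw F dwiringD(1)[OF f]] act_links_wires[OF fw' G dwiringD(1)[OF f']] varL)
    qed (use ab sfd_isoD(3)[OF iso, of a l b] in simp_all)
  next
    fix s q v y assume "s \<in> RR (ob ?G Stock)" "q \<in> RR (ob ?G SumVar)" "v \<in> RR (ob ?G Var)" "y \<in> RR (ob ?G InPort)"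
    then have RR: "s \<in> RR (ob G Stock)" "q \<in> RR (ob G SumVar)" "v \<in> RR (ob G Var)" by simp_all
    let ?a = "vadd (ins X') (span_map (win f') (ins X') y) (span_map (wtr f') (ins X') (span_map (link_span G OutL) (outs X') v))"
    have "vadd (ins X) (span_map (win f) (ins X) (pull (ins Y) b' y))
        (span_map (wtr f) (ins X) (span_map (link_span F OutL) (outs X) (pull (ob F Var) (\<eta> Var) v))) =
      pull (ins X) (\<eta> InPort) ?a"
      using span_map_transport[OF lF(6) lG(6) sfdsD(1)[OF F] sfdsD(1)[OF G] bv out_fun outL]
      by (simp add: pull_vadd[OF in_fun] span_map_transport[OF w(1) w'(1) fin(5,7) bij(3) in_fun eq(1)]
        span_map_transport[OF w(2) w'(2) fin(2,4) bij(2) in_fun eq(2)])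
    then show "phi ?F (pull (ob ?F Stock) (?\<theta> Stock) s) (pull (ob ?F SumVar) (?\<theta> SumVar) q) (pull (ob ?F Var) (?\<theta> Var) v)
        (pull (ob ?F InPort) (?\<theta> InPort) y) = pull (ob ?F Var) (?\<theta> Var) (phi ?G s q v y)"
      using sfd_isoD(4)[OF iso RR, of ?a] by (simp add: sfdsD(2)[OF F] sfdsD(2)[OF G])
  qed
qed

lemma sfd_act_ident:
  assumes X: "X \<in> dboxes" and F: "F \<in> sfds X"
  shows "(sfd_act X X (wiring_of_bij X id id) F, F) \<in> sfd_rel X"
proof (rule sfd_rel_sameI[OF sfd_act_sfds[OF dwiring_of_bij[OF box_iso_ident[OF X]] F] F])
  let ?I = "wiring_of_bij X id id" and ?F = "sfd_act X X (wiring_of_bij X id id) F"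
  note fin = dboxesD(1,2)[OF X]
  note al = act_links_wires[OF box_isoD(5)[OF box_iso_ident[OF X]] F X]
  fix l a b assume ab: "a \<in> ob ?F (lsrc l)" "b \<in> ob ?F (ltgt l)"
  show "wires (link_span F l) a b = wires (link_span ?F l) a b"
  proof (cases l)
    case InL
    have "mmult (ins X) (wires (win ?I)) (wires (link_span F InL)) a b = wires (link_span F InL) a b"
      by (rule mmult_delta_left) (use ab InL fin in auto)
    then show ?thesis using InL by (simp add: al)
  next
    case OutL
    have "mmult (outs X) (wires (link_span F OutL)) (wires (wout ?I)) a b = wires (link_span F OutL) a b"
      by (rule mmult_delta_right) (use ab OutL fin in auto)
    then show ?thesis using OutL by (simp add: al)
  qed (simp_all add: al mmult_def)
next
  fix s w v a assume "a \<in> RR (ins X)"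
  then have "vadd (ins X) (span_map (win (wiring_of_bij X id id)) (ins X) a)
      (span_map (wtr (wiring_of_bij X id id)) (ins X) (span_map (link_span F OutL) (outs X) v)) = a"
    by (intro RR_ext[of _ "ins X"]) (simp_all add: span_map_of_bij)
  then show "phi (sfd_act X X (wiring_of_bij X id id) F) s w v a = phi F s w v a" by simp
next
  fix v :: hob assume "v \<notin> range Link"
  then show "ob (sfd_act X X (wiring_of_bij X id id) F) v = ob F v" using F by (cases v) (simp_all add: sfdsD)
qed auto

text \<open>The variable links of both sides are
  \<open>V + O (f + fo g fi) I = (V + O f I) + (O fo) g (fi I)\<close> as matrices, where \<open>V\<close>, \<open>I\<close> and \<open>O\<close>
  stand for the variable, in and out links of \<open>F\<close>, \<open>f\<close> and \<open>g\<close> for the traces, and \<open>fi\<close> and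
  \<open>fo\<close> for the input and output wires of \<open>f\<close>.\<close>

lemma sfd_act_comp:
  assumes f: "dwiring X Y f" and g: "dwiring Y Z g" and F: "F \<in> sfds X"
  shows "(sfd_act X Z (wiring_comp g f) F, sfd_act Y Z g (sfd_act X Y f F)) \<in> sfd_rel Z"
proof (rule sfd_rel_sameI[OF sfd_act_sfds[OF dwiring_comp[OF f g] F] sfd_act_sfds[OF g sfd_act_sfds[OF f F]]])
  let ?G = "sfd_act X Y f F"
  have G: "?G \<in> sfds Y" by (rule sfd_act_sfds[OF f F])
  note fw = dwiringD(3)[OF f] and gw = dwiringD(3)[OF g]
  note wf = wiringsD[OF fw] and wg = wiringsD[OF gw] and l = sfds_span[OF F]
  note fin = dwiring_finite[OF f]
  note al = act_links_wires[OF wiring_comp_in[OF fw gw] F dwiringD(1)[OF f]]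
    act_links_wires[OF gw G dwiringD(2)[OF f]] act_links_wires[OF fw F dwiringD(1)[OF f]]
  fix k a b
  show "wires (link_span (sfd_act Y Z g ?G) k) a b = wires (link_span (sfd_act X Z (wiring_comp g f) F) k) a b"
    using fin by (cases k) (simp_all add: al wires_wiring_comp[OF fw gw] mmult_assoc mmult_add)
  fix s w v z assume v: "v \<in> RR (ob (sfd_act X Z (wiring_comp g f) F) Var)"
  let ?x = "span_map (link_span F OutL) (outs X) v"
  have out: "span_map (act_out_links f F) (outs Y) v = span_map (wout f) (outs Y) ?x"
    unfolding act_out_links_def using fin sfdsD(1)[OF F] by (simp add: span_map_comp[OF l(6) wf(3)])
  have "span_map (wtr (wiring_comp g f)) (ins X) ?x =
      vadd (ins X) (span_map (wtr f) (ins X) ?x) (span_map (win f) (ins X) (span_map (wtr g) (ins Y) (span_map (wout f) (outs Y) ?x)))"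
    using fin unfolding wiring_comp_def
    by (simp add: span_map_plus[OF wf(2) is_span_comp[OF is_span_comp[OF wf(3) wg(2)] wf(1)]]
       span_map_comp[OF is_span_comp[OF wf(3) wg(2)] wf(1)] span_map_comp[OF wf(3) wg(2)])
  moreover have "span_map (win (wiring_comp g f)) (ins X) z = span_map (win f) (ins X) (span_map (win g) (ins Y) z)"
    using fin dwiring_finite(3,4)[OF g] by (simp add: wiring_comp_def span_map_comp[OF wg(1) wf(1)])
  ultimately have "vadd (ins X) (span_map (win (wiring_comp g f)) (ins X) z) (span_map (wtr (wiring_comp g f)) (ins X) ?x) =
     vadd (ins X) (span_map (win f) (ins X) (vadd (ins Y) (span_map (win g) (ins Y) z)
        (span_map (wtr g) (ins Y) (span_map (wout f) (outs Y) ?x)))) (span_map (wtr f) (ins X) ?x)"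
    using fin by (intro RR_ext[of _ "ins X"]) (simp_all add: span_map_vadd[OF wf(1)])
  then show "phi (sfd_act X Z (wiring_comp g f) F) s w v z = phi (sfd_act Y Z g ?G) s w v z"
    by (simp add: out)
next
  fix v :: hob assume "v \<notin> range Link"
  then show "ob (sfd_act X Z (wiring_comp g f) F) v = ob (sfd_act Y Z g (sfd_act X Y f F)) v" by (cases v) simp_all
qed auto

lemma sfd_par_sel [simp]: "ob (sfd_par F G) v = usum (ob F v) (ob G v)" "ar (sfd_par F G) h = umap (ar F h) (ar G h)"
  "link_span (sfd_par F G) l = span_par (link_span F l) (link_span G l)"
  "phi (sfd_par F G) s w y a = vjoin (ob F Var) (ob G Var)
       (phi F (pull (ob F Stock) In1 s) (pull (ob F SumVar) In1 w) (pull (ob F Var) In1 y) (pull (ob F InPort) In1 a))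
       (phi G (pull (ob G Stock) In2 s) (pull (ob G SumVar) In2 w) (pull (ob G Var) In2 y) (pull (ob G InPort) In2 a))"
  by (simp_all add: sfd_par_def link_span_def span_par_def)

lemma sfd_empty_sel [simp]: "ob sfd_empty v = {}" "ar sfd_empty h = id" "phi sfd_empty s w y a = (\<lambda>z\<in>{}. 0)"
  by (simp_all add: sfd_empty_def)

lemma sfd_empty_sfds: "sfd_empty \<in> sfds dunit"
  unfolding sfds_iff finite_hfun_iff phi_local_def by (simp add: is_span_def ends_def Pi_iff acyclic_def)

lemma sfd_par_sfds:
  fixes F G :: "'a sfd"
  assumes F: "F \<in> sfds X" and G: "G \<in> sfds Y"
  shows "sfd_par F G \<in> sfds (dtensor X Y)"
proof -
  let ?H = "sfd_par F G"
  have spanF: "\<And>l. is_span (ob F (lsrc l)) (ob F (ltgt l)) (link_span F l)"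
    and spanG: "\<And>l. is_span (ob G (lsrc l)) (ob G (ltgt l)) (link_span G l)"
    using F G by (simp_all add: sfds_iff finite_hfun_iff)
  have hf: "finite_hfun ?H"
    unfolding finite_hfun_iff using sfdsD(1)[OF F] sfdsD(1)[OF G] sfds_arrow[OF F] sfds_arrow[OF G] spanF spanG
    by (simp add: is_span_par Pi_iff)
  have inj: "inj_on (ar ?H A_if) (ob ?H Inflow)" "inj_on (ar ?H A_of) (ob ?H Outflow)"
    using F G by (simp_all add: sfds_iff inj_on_def)
  have ij: "inj (In1 :: 'a univ \<Rightarrow> 'a univ)" "inj (In2 :: 'a univ \<Rightarrow> 'a univ)" "\<And>a b. In1 a \<noteq> In2 (b :: 'a univ)"
    by simp_all
  have acyc: "acyclic (ends (link_span ?H VarL))"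
    unfolding sfd_par_sel ends_par by (rule acyclic_disjoint_images[OF ij]) (use F G in \<open>simp_all add: sfdsD\<close>)
  have dep: "(x, z) \<in> dep (dtensor X Y)" if x: "(x, v) \<in> ends (link_span ?H InL)"
    and p: "(v, u) \<in> (ends (link_span ?H VarL))\<^sup>*" and z: "(u, z) \<in> ends (link_span ?H OutL)" for x v u z
  proof -
    note p' = p[unfolded sfd_par_sel ends_par]
    consider x1 v1 where "x = In1 x1" "v = In1 v1" "(x1, v1) \<in> ends (link_span F InL)"
      | x2 v2 where "x = In2 x2" "v = In2 v2" "(x2, v2) \<in> ends (link_span G InL)"
      using x by (auto simp: ends_par)
    then show ?thesis
    proof cases
      case 1
      obtain u1 where u1: "u = In1 u1" "(v1, u1) \<in> (ends (link_span F VarL))\<^sup>*"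
        using rtrancl_disjoint_images(1)[OF ij, of v1 u] p' 1 by blast
      then obtain z1 where "z = In1 z1" "(u1, z1) \<in> ends (link_span F OutL)" using z by (auto simp: ends_par)
      then show ?thesis using 1 u1 sfdsD(5)[OF F] by (auto intro: image_eqI[of _ _ "(_, _)"])
    next
      case 2
      obtain u1 where u1: "u = In2 u1" "(v2, u1) \<in> (ends (link_span G VarL))\<^sup>*"
        using rtrancl_disjoint_images(2)[OF ij, of v2 u] p' 2 by blast
      then obtain z1 where "z = In2 z1" "(u1, z1) \<in> ends (link_span G OutL)" using z by (auto simp: ends_par)
      then show ?thesis using 2 u1 sfdsD(5)[OF G] by (auto intro: image_eqI[of _ _ "(_, _)"])
    qed
  qed
  have loc: "phi_local ?H"
    unfolding phi_local_def
  proof (intro ballI impI)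
    fix b and s s' w w' v v' a a' :: "'a univ \<Rightarrow> real"
    assume b: "b \<in> ob ?H Var" and eq: "\<forall>x. (x, b) \<in> ends (link_span ?H StockL) \<longrightarrow> s x = s' x"
      "\<forall>x. (x, b) \<in> ends (link_span ?H SumL) \<longrightarrow> w x = w' x"
      "\<forall>x. (x, b) \<in> ends (link_span ?H VarL) \<longrightarrow> v x = v' x"
      "\<forall>x. (x, b) \<in> ends (link_span ?H InL) \<longrightarrow> a x = a' x"
    show "phi ?H s w v a b = phi ?H s' w' v' a' b"
      using b unfolding sfd_par_sel(1)
    proof (cases rule: usumE)
      case (1 b1)
      have *: "pull A In1 y x = pull A In1 y' x" if "\<forall>x. (x, b) \<in> ends (link_span ?H l) \<longrightarrow> y x = y' x"
        "(x, b1) \<in> ends (link_span F l)" for l x y A and y' :: "'a univ \<Rightarrow> real"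
        using that 1 by (force simp: pull_def ends_par)
      have "phi F (pull (ob F Stock) In1 s) (pull (ob F SumVar) In1 w) (pull (ob F Var) In1 v) (pull (ob F InPort) In1 a) b1 =
        phi F (pull (ob F Stock) In1 s') (pull (ob F SumVar) In1 w') (pull (ob F Var) In1 v') (pull (ob F InPort) In1 a') b1"
        by (rule sfds_phi_local[OF F 1(2)])
          (use sfdsD(2)[OF F] *[OF eq(1)] *[OF eq(2)] *[OF eq(3)] *[OF eq(4)] in simp_all)
      then show ?thesis using 1 by simp
    next
      case (2 b2)
      have *: "pull A In2 y x = pull A In2 y' x" if "\<forall>x. (x, b) \<in> ends (link_span ?H l) \<longrightarrow> y x = y' x"
        "(x, b2) \<in> ends (link_span G l)" for l x y A and y' :: "'a univ \<Rightarrow> real"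
        using that 2 by (force simp: pull_def ends_par)
      have "phi G (pull (ob G Stock) In2 s) (pull (ob G SumVar) In2 w) (pull (ob G Var) In2 v) (pull (ob G InPort) In2 a) b2 =
        phi G (pull (ob G Stock) In2 s') (pull (ob G SumVar) In2 w') (pull (ob G Var) In2 v') (pull (ob G InPort) In2 a') b2"
        by (rule sfds_phi_local[OF G 2(2)])
          (use sfdsD(2)[OF G] *[OF eq(1)] *[OF eq(2)] *[OF eq(3)] *[OF eq(4)] in simp_all)
      then show ?thesis using 2 by simp
    qed
  qed
  show ?thesis
    unfolding sfds_iff
    using hf inj acyc loc sfdsD(2,3)[OF F] sfdsD(2,3)[OF G] dep by (simp add: Pi_iff)
qed

lemma sfd_par_iso:
  assumes iso: "sfd_iso \<eta> F F'" "sfd_iso \<theta> G G'"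
  shows "sfd_iso (\<lambda>v. umap (\<eta> v) (\<theta> v)) (sfd_par F G) (sfd_par F' G')"
proof -
  note bij = sfd_isoD(1)[OF iso(1)] sfd_isoD(1)[OF iso(2)]
  note pu = pull_umap[OF bij_betw_imp_funcset[OF bij(1)] bij_betw_imp_funcset[OF bij(2)]]
  show ?thesis
    unfolding sfd_iso_def
  proof (intro conjI allI ballI impI)
    fix v :: hob assume "v \<notin> range Link"
    then show "bij_betw (umap (\<eta> v) (\<theta> v)) (ob (sfd_par F G) v) (ob (sfd_par F' G') v)"
      by (simp add: bij_betw_umap bij)
  next
    fix h e assume "h \<in> {A_is, A_if, A_os, A_of, A_fv}" "e \<in> ob (sfd_par F G) (hdom h)"
    then show "umap (\<eta> (hcod h)) (\<theta> (hcod h)) (ar (sfd_par F G) h e) = ar (sfd_par F' G') h (umap (\<eta> (hdom h)) (\<theta> (hdom h)) e)"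
      using sfd_isoD(2)[OF iso(1), of h] sfd_isoD(2)[OF iso(2), of h] by (auto elim!: usumE)
  next
    fix l a b assume "a \<in> ob (sfd_par F G) (lsrc l)" "b \<in> ob (sfd_par F G) (ltgt l)"
    then show "wires (link_span (sfd_par F' G') l) (umap (\<eta> (lsrc l)) (\<theta> (lsrc l)) a) (umap (\<eta> (ltgt l)) (\<theta> (ltgt l)) b) =
      wires (link_span (sfd_par F G) l) a b"
      using sfd_isoD(3)[OF iso(1)] sfd_isoD(3)[OF iso(2)] unfolding sfd_par_sel(1)
      by (auto elim!: usumE simp: wires_par)
  next
    fix s w v a
    show "phi (sfd_par F G) (pull (ob (sfd_par F G) Stock) (umap (\<eta> Stock) (\<theta> Stock)) s)
       (pull (ob (sfd_par F G) SumVar) (umap (\<eta> SumVar) (\<theta> SumVar)) w) (pull (ob (sfd_par F G) Var) (umap (\<eta> Var) (\<theta> Var)) v)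
       (pull (ob (sfd_par F G) InPort) (umap (\<eta> InPort) (\<theta> InPort)) a) =
      pull (ob (sfd_par F G) Var) (umap (\<eta> Var) (\<theta> Var)) (phi (sfd_par F' G') s w v a)"
      by (simp add: pu sfd_isoD(4)[OF iso(1)] sfd_isoD(4)[OF iso(2)])
  qed
qed

lemma sfd_par_cong:
  assumes FF: "(F, F') \<in> sfd_rel X" and GG: "(G, G') \<in> sfd_rel Y"
  shows "(sfd_par F G, sfd_par F' G') \<in> sfd_rel (dtensor X Y)"
proof -
  obtain \<eta> where F: "F \<in> sfds X" "F' \<in> sfds X" and 1: "sfd_iso \<eta> F F'"
    "\<And>p. p \<in> ins X \<Longrightarrow> \<eta> InPort p = p" "\<And>p. p \<in> outs X \<Longrightarrow> \<eta> OutPort p = p"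
    using FF by (rule sfd_relE) blast
  obtain \<theta> where G: "G \<in> sfds Y" "G' \<in> sfds Y" and 2: "sfd_iso \<theta> G G'"
    "\<And>p. p \<in> ins Y \<Longrightarrow> \<theta> InPort p = p" "\<And>p. p \<in> outs Y \<Longrightarrow> \<theta> OutPort p = p"
    using GG by (rule sfd_relE) blast
  show ?thesis
    by (rule sfd_relI[OF sfd_par_sfds[OF F(1) G(1)] sfd_par_sfds[OF F(2) G(2)] sfd_par_iso[OF 1(1) 2(1)]])
      (use 1 2 in \<open>auto elim!: usumE\<close>)
qed

lemma sfd_par_natural:
  assumes f: "dwiring X X' f" and g: "dwiring Y Y' g" and F: "F \<in> sfds X" and G: "G \<in> sfds Y"
  shows "(sfd_act (dtensor X Y) (dtensor X' Y') (wiring_par f g) (sfd_par F G),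
     sfd_par (sfd_act X X' f F) (sfd_act Y Y' g G)) \<in> sfd_rel (dtensor X' Y')"
proof (rule sfd_rel_sameI[OF sfd_act_sfds[OF dwiring_par[OF f g] sfd_par_sfds[OF F G]]
      sfd_par_sfds[OF sfd_act_sfds[OF f F] sfd_act_sfds[OF g G]]])
  let ?H = "sfd_act (dtensor X Y) (dtensor X' Y') (wiring_par f g) (sfd_par F G)"
  let ?K = "sfd_par (sfd_act X X' f F) (sfd_act Y Y' g G)"
  note fw = dwiringD(3)[OF f] and gw = dwiringD(3)[OF g]
  note wf = wiringsD[OF fw] and wg = wiringsD[OF gw] and lF = sfds_span[OF F] and lG = sfds_span[OF G]
  note fin = dwiring_finite(1,2)[OF f] dwiring_finite(1,2)[OF g]
    dwiring_finite(3,4)[OF f] dwiring_finite(3,4)[OF g]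
  note al = act_links_wires[OF fw F dwiringD(1)[OF f]] act_links_wires[OF gw G dwiringD(1)[OF g]]
    act_links_wires[OF wiring_par_in[OF fw gw] sfd_par_sfds[OF F G] dtensor_dboxes[OF dwiringD(1)[OF f] dwiringD(1)[OF g]]]
  fix l a b
  show "wires (link_span ?K l) a b = wires (link_span ?H l) a b"
    using fin by (cases l) (simp_all add: al wires_par mmult_mblock mblock_add)
  fix s w v y
  show "phi ?H s w v y = phi ?K s w v y"
    using fin sfdsD(1,2)[OF F] sfdsD(1,2)[OF G] unfolding wiring_par_def
    by (simp add: span_map_par_vjoin[OF wf(1) wg(1)] span_map_par_vjoin[OF wf(2) wg(2)] span_map_par_vjoin[OF lF(6) lG(6)] vjoin_vadd)
next
  fix v :: hob assume "v \<notin> range Link"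
  then show "ob (sfd_act (dtensor X Y) (dtensor X' Y') (wiring_par f g) (sfd_par F G)) v =
    ob (sfd_par (sfd_act X X' f F) (sfd_act Y Y' g G)) v" by (cases v) simp_all
qed auto

lemma sfd_par_assoc: "sfd_iso (\<lambda>_. uassoc) (sfd_par (sfd_par F G) H) (sfd_par F (sfd_par G H))"
  unfolding sfd_iso_def by (simp add: bij_betw_uassoc wires_par pull_uassoc)

lemma sfd_par_unit:
  "sfd_iso (\<lambda>_. ucodiag) (sfd_par sfd_empty F) F" "sfd_iso (\<lambda>_. ucodiag) (sfd_par F sfd_empty) F"
proof -
  show "sfd_iso (\<lambda>_. ucodiag) (sfd_par sfd_empty F) F"
    unfolding sfd_iso_def
    by (simp add: bij_betw_ucodiag wires_par pull_ucodiag(1) pull_ucodiag(3)[where w = "\<lambda>v\<in>{}. 0"])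
  show "sfd_iso (\<lambda>_. ucodiag) (sfd_par F sfd_empty) F"
    unfolding sfd_iso_def
    by (simp add: bij_betw_ucodiag wires_par pull_ucodiag(2) pull_ucodiag(4)[where w = "\<lambda>v\<in>{}. 0"])
qed

lemma wiring_square_cong:
  assumes "wiring_square b c b' c' X Y f X' Y' f'" "\<And>x. x \<in> ins X \<Longrightarrow> d x = b x" "\<And>k. k \<in> outs X \<Longrightarrow> e k = c k"
  shows "wiring_square d e b' c' X Y f X' Y' f'"
  using assms bij_betw_cong[of "ins X" d b "ins X'"] bij_betw_cong[of "outs X" e c "outs X'"]
  by (simp add: wiring_square_def)

text \<open>The relabellings are only compared on ports, because the isomorphisms in \<open>sfd_rel\<close> are
  unconstrained elsewhere.\<close>

definition sfd_isomorphic :: "('a univ \<Rightarrow> 'a univ) \<Rightarrow> ('a univ \<Rightarrow> 'a univ) \<Rightarrow> 'a dbox \<Rightarrow> 'a dbox \<Rightarrow> 'a sfd \<Rightarrow> 'a sfd \<Rightarrow> bool" where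
  "sfd_isomorphic b c X X' F G \<longleftrightarrow> (\<exists>\<eta>. sfd_iso \<eta> F G \<and>
     (\<forall>p\<in>ins X. \<eta> InPort p = b p) \<and> (\<forall>p\<in>outs X. \<eta> OutPort p = c p))"

lemma sfd_isomorphicI: "sfd_iso (\<lambda>_. b) F G \<Longrightarrow> sfd_isomorphic b b X X' F G"
  unfolding sfd_isomorphic_def by (intro exI[of _ "\<lambda>_. b"]) simp

lemma sfd_rel_iff: "(F, G) \<in> sfd_rel X \<longleftrightarrow> F \<in> sfds X \<and> G \<in> sfds X \<and> sfd_isomorphic id id X X F G"
proof
  assume "(F, G) \<in> sfd_rel X"
  then show "F \<in> sfds X \<and> G \<in> sfds X \<and> sfd_isomorphic id id X X F G"
    by (rule sfd_relE) (auto simp: sfd_isomorphic_def)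
qed (auto simp: sfd_isomorphic_def intro: sfd_relI)

lemma sfd_act_isomorphic:
  assumes sq: "wiring_square b c b' c' X Y f X' Y' f'" and f: "dwiring X Y f" "dwiring X' Y' f'"
    and F: "F \<in> sfds X" "G \<in> sfds X'" and iso: "sfd_isomorphic b c X X' F G"
  shows "sfd_isomorphic b' c' Y Y' (sfd_act X Y f F) (sfd_act X' Y' f' G)"
proof -
  obtain \<eta> where \<eta>: "sfd_iso \<eta> F G" "\<And>p. p \<in> ins X \<Longrightarrow> \<eta> InPort p = b p" "\<And>p. p \<in> outs X \<Longrightarrow> \<eta> OutPort p = c p"
    using iso by (auto simp: sfd_isomorphic_def)
  have "sfd_iso (\<eta>(InPort := b', OutPort := c')) (sfd_act X Y f F) (sfd_act X' Y' f' G)"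
    by (rule sfd_act_transport[OF wiring_square_cong[OF sq \<eta>(2,3)] f F \<eta>(1)])
  then show ?thesis
    unfolding sfd_isomorphic_def by (intro exI[of _ "\<eta>(InPort := b', OutPort := c')"] conjI) simp_all
qed

interpretation sf: wiring_action sfds sfd_rel sfd_isomorphic sfd_act "\<lambda>X Y. sfd_par" sfd_empty
  by unfold_locales
    (rule equiv_sfd_rel sfd_rel_iff
    | (rule sfd_act_sfds sfd_act_isomorphic sfd_act_ident sfd_act_comp sfd_par_sfds sfd_par_cong sfd_par_natural
        sfd_empty_sfds; assumption)
    | (rule sfd_isomorphicI, rule sfd_par_assoc sfd_par_unit))+

lemma sfd_class_cls: "sfd_class = sf.cls"
  by (simp add: fun_eq_iff sfd_class_def sf.cls_def)

lemma SF_functor: "SF = sf.class_functor"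
  by (simp add: SF_def sf.class_functor_def sfd_class_cls)


section \<open>The Mealy machine of a stock-flow diagram\<close>

lemma wf_var_links: 
  assumes "F \<in> sfds X"
  shows "wf (ends (link_span F VarL))"
proof (rule finite_acyclic_wf)
  show "finite (ends (link_span F VarL))" using sfdsD(1)[OF assms] by (simp add: ends_def)
  show "acyclic (ends (link_span F VarL))" using assms by (rule sfdsD(4))
qed

lemma var_fix_ex1:
  assumes F: "F \<in> sfds X" and a: "a \<in> RR (ins X)" and s: "s \<in> RR (ob F Stock)"
  shows "\<exists>!v. v \<in> RR (ob F Var) \<and> phi F s (span_map (link_span F StockSumL) (ob F SumVar) s) v a = v"
proof (rule acyclic_unique_fixpoint[OF wf_var_links[OF F]])
  fix v assume "v \<in> RR (ob F Var)"
  then show "phi F s (span_map (link_span F StockSumL) (ob F SumVar) s) v a \<in> RR (ob F Var)"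
    by (rule sfds_phi[OF F s span_map_in_RR _ a])
next
  fix b v v' assume b: "b \<in> ob F Var" and v: "v \<in> RR (ob F Var)" "v' \<in> RR (ob F Var)"
    and eq: "\<And>u. u \<in> ob F Var \<Longrightarrow> (u, b) \<in> ends (link_span F VarL) \<Longrightarrow> v u = v' u"
  show "phi F s (span_map (link_span F StockSumL) (ob F SumVar) s) v a b =
    phi F s (span_map (link_span F StockSumL) (ob F SumVar) s) v' a b"
    by (rule sfds_phi_local[OF F b s s span_map_in_RR span_map_in_RR v a a])
      (use eq ends_subset[OF sfds_span(4)[OF F]] in auto)
qed

lemma var_fix:
  assumes "F \<in> sfds X" "a \<in> RR (ins X)" "s \<in> RR (ob F Stock)"
  shows "var_fix F a s \<in> RR (ob F Var)"
    "phi F s (span_map (link_span F StockSumL) (ob F SumVar) s) (var_fix F a s) a = var_fix F a s"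
  using theI'[OF var_fix_ex1[OF assms]] unfolding var_fix_def[symmetric] by simp_all

lemma var_fix_eqI:
  assumes "F \<in> sfds X" "a \<in> RR (ins X)" "s \<in> RR (ob F Stock)"
    and "v \<in> RR (ob F Var)" "phi F s (span_map (link_span F StockSumL) (ob F SumVar) s) v a = v"
  shows "var_fix F a s = v"
  unfolding var_fix_def by (rule the1_equality[OF var_fix_ex1[OF assms(1-3)]]) (use assms(4,5) in simp)

lemma mealy_of_sfd_sel [simp]: "states (mealy_of_sfd F) = ob F Stock"
  "upd (mealy_of_sfd F) a s = vsub (ob F Stock) (flow_in F (var_fix F a s)) (flow_out F (var_fix F a s))"
  "rdt (mealy_of_sfd F) a s = span_map (link_span F OutL) (ob F OutPort) (var_fix F a s)"
  by (simp_all add: mealy_of_sfd_def)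

text \<open>Only variables with a path to an out link of \<open>k\<close> matter for the readout at \<open>k\<close>.  By induction along
  variable links, the values of these variables are determined by the in ports with a path to \<open>k\<close>,
  which are dependencies of \<open>k\<close>.\<close>

lemma mealy_of_sfd_mealys:
  assumes F: "F \<in> sfds X"
  shows "mealy_of_sfd F \<in> mealys X"
proof (rule mealysI)
  note l = sfds_span[OF F]
  fix a a' s k assume a: "a \<in> RR (ins X)" "a' \<in> RR (ins X)" and "s \<in> RR (states (mealy_of_sfd F))"
    and k: "k \<in> outs X" and eq: "\<And>i. (i, k) \<in> dep X \<Longrightarrow> a i = a' i"
  then have s: "s \<in> RR (ob F Stock)" by simp
  note v = var_fix[OF F a(1) s] and v' = var_fix[OF F a(2) s]
  have agree: "v \<in> ob F Var \<longrightarrow> (\<forall>w. (v, w) \<in> (ends (link_span F VarL))\<^sup>* \<longrightarrow> (w, k) \<in> ends (link_span F OutL) \<longrightarrow>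
      var_fix F a s v = var_fix F a' s v)" for v
    using wf_var_links[OF F]
  proof (induction v rule: wf_induct_rule)
    case (less v)
    show ?case
    proof (intro impI allI)
      fix w assume vV: "v \<in> ob F Var" and path: "(v, w) \<in> (ends (link_span F VarL))\<^sup>*"
        and w: "(w, k) \<in> ends (link_span F OutL)"
      have "phi F s (span_map (link_span F StockSumL) (ob F SumVar) s) (var_fix F a s) a v =
        phi F s (span_map (link_span F StockSumL) (ob F SumVar) s) (var_fix F a' s) a' v"
      proof (rule sfds_phi_local[OF F vV s s _ _ v(1) v'(1) a])
        fix u assume u: "(u, v) \<in> ends (link_span F VarL)"
        then have "u \<in> ob F Var" using ends_subset[OF l(4)] by blast
        then show "var_fix F a s u = var_fix F a' s u"
          using less.IH[OF u] path w u by (meson converse_rtrancl_into_rtrancl)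
      next
        fix x assume "(x, v) \<in> ends (link_span F InL)"
        then show "a x = a' x" by (rule eq[OF sfdsD(5)[OF F _ path w]])
      qed simp_all
      then show "var_fix F a s v = var_fix F a' s v" using v(2) v'(2) by simp
    qed
  qed
  have "span_map (link_span F OutL) (outs X) (var_fix F a s) k = span_map (link_span F OutL) (outs X) (var_fix F a' s) k"
  proof (rule span_map_cong[OF l(6) k])
    fix w assume w: "(w, k) \<in> ends (link_span F OutL)"
    then have "w \<in> ob F Var" using ends_subset[OF l(6)] by blast
    then show "var_fix F a s w = var_fix F a' s w" using agree w by blast
  qed
  then show "rdt (mealy_of_sfd F) a s k = rdt (mealy_of_sfd F) a' s k" by (simp add: sfdsD(3)[OF F])
qed (use sfdsD(1,3)[OF F] in simp_all)

text \<open>Naturality of \<open>f\<^sub>*\<close> under relabelling: the bijection \<open>h\<close> identifies the fibres over \<open>b\<close> and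
  \<open>k b\<close>.\<close>

lemma push_transport:
  assumes h: "bij_betw h A A'" and k: "bij_betw k B B'" and f: "f \<in> A \<rightarrow> B"
    and comm: "\<And>a. a \<in> A \<Longrightarrow> k (f a) = f' (h a)"
  shows "push A B f (pull A h x) = pull B k (push A' B' f' x)"
proof (rule RR_ext[of _ B])
  fix b assume b: "b \<in> B"
  have "h ` {a. a \<in> A \<and> f a = b} = {a'. a' \<in> A' \<and> f' a' = k b}"
  proof (intro equalityI subsetI)
    fix y assume "y \<in> h ` {a. a \<in> A \<and> f a = b}"
    then show "y \<in> {a'. a' \<in> A' \<and> f' a' = k b}" using bij_betwE[OF h] comm by force
  next
    fix y assume y: "y \<in> {a'. a' \<in> A' \<and> f' a' = k b}"
    then obtain a where a: "a \<in> A" "y = h a" using bij_betw_imp_surj_on[OF h] by blast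
    have "f a = b"
      by (rule inj_onD[OF bij_betw_imp_inj_on[OF k] _ funcset_mem[OF f a(1)] b]) (use a y comm in simp)
    then show "y \<in> h ` {a. a \<in> A \<and> f a = b}" using a by blast
  qed
  then have bij: "bij_betw h {a. a \<in> A \<and> f a = b} {a'. a' \<in> A' \<and> f' a' = k b}"
    using inj_on_subset[OF bij_betw_imp_inj_on[OF h], of "{a. a \<in> A \<and> f a = b}"] by (simp add: bij_betw_def subset_iff)
  have "k b \<in> B'" using bij_betwE[OF k] b by blast
  moreover have "sum (pull A h x) {a. a \<in> A \<and> f a = b} = (\<Sum>a | a \<in> A \<and> f a = b. x (h a))"
    by (rule sum.cong) simp_all
  ultimately show "push A B f (pull A h x) b = pull B k (push A' B' f' x) b"
    using b sum.reindex_bij_betw[OF bij, of x] by (simp add: push_def)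
qed simp_all

lemma flow_iso:
  assumes F: "F \<in> sfds X" and iso: "sfd_iso \<eta> F G"
  shows "flow_in F (pull (ob F Var) (\<eta> Var) v) = pull (ob F Stock) (\<eta> Stock) (flow_in G v)"
    "flow_out F (pull (ob F Var) (\<eta> Var) v) = pull (ob F Stock) (\<eta> Stock) (flow_out G v)"
proof -
  note bij = sfd_isoD(1)[OF iso] and nat = sfd_isoD(2)[OF iso] and arr = sfds_arrow[OF F]
  have maps: "\<eta> v x \<in> ob G v" if "v \<notin> range Link" "x \<in> ob F v" for v x
    using bij_betwE[OF bij[OF that(1)]] that(2) by blast
  have 0: "pull (ob F Flow) (ar F A_fv) (pull (ob F Var) (\<eta> Var) v) = pull (ob F Flow) (\<eta> Flow) (pull (ob G Flow) (ar G A_fv) v)"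
    by (rule RR_ext[of _ "ob F Flow"]) (use arr(5) nat[of A_fv] maps[of Flow] in \<open>simp_all add: Pi_iff\<close>)
  have 1: "pull (ob F Inflow) (ar F A_if) (pull (ob F Flow) (\<eta> Flow) x) =
      pull (ob F Inflow) (\<eta> Inflow) (pull (ob G Inflow) (ar G A_if) x)" for x
    by (rule RR_ext[of _ "ob F Inflow"]) (use arr(2) nat[of A_if] maps[of Inflow] in \<open>simp_all add: Pi_iff\<close>)
  have 2: "pull (ob F Outflow) (ar F A_of) (pull (ob F Flow) (\<eta> Flow) x) =
      pull (ob F Outflow) (\<eta> Outflow) (pull (ob G Outflow) (ar G A_of) x)" for x
    by (rule RR_ext[of _ "ob F Outflow"]) (use arr(4) nat[of A_of] maps[of Outflow] in \<open>simp_all add: Pi_iff\<close>)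
  show "flow_in F (pull (ob F Var) (\<eta> Var) v) = pull (ob F Stock) (\<eta> Stock) (flow_in G v)"
    unfolding flow_in_def 0 1 by (rule push_transport[OF bij bij arr(1)]) (use nat[of A_is] in simp_all)
  show "flow_out F (pull (ob F Var) (\<eta> Var) v) = pull (ob F Stock) (\<eta> Stock) (flow_out G v)"
    unfolding flow_out_def 0 2 by (rule push_transport[OF bij bij arr(3)]) (use nat[of A_os] in simp_all)
qed

text \<open>The unique solution of a diagram is transported along an isomorphism, and readout and flows with it.\<close>

lemma mealy_of_sfd_iso:
  assumes F: "F \<in> sfds X" and G: "G \<in> sfds X'" and iso: "sfd_iso \<eta> F G"
  shows "mealy_iso (\<eta> InPort) (\<eta> OutPort) (\<eta> Stock) X X' (mealy_of_sfd F) (mealy_of_sfd G)"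
proof -
  note bij = sfd_isoD(1)[OF iso] and links = sfd_isoD(3)[OF iso]
  note lF = sfds_span[OF F] and lG = sfds_span[OF G]
  have funs: "\<eta> v \<in> ob F v \<rightarrow> ob G v" if "v \<notin> range Link" for v
    by (rule bij_betw_imp_funcset[OF bij[OF that]])
  have fix': "var_fix F (pull (ins X) (\<eta> InPort) a) (pull (ob F Stock) (\<eta> Stock) s) = pull (ob F Var) (\<eta> Var) (var_fix G a s)"
    if a: "a \<in> RR (ins X')" and s: "s \<in> RR (ob G Stock)" for a s
  proof (rule var_fix_eqI[OF F])
    note v = var_fix[OF G a s]
    have "span_map (link_span F StockSumL) (ob F SumVar) (pull (ob F Stock) (\<eta> Stock) s) =
      pull (ob F SumVar) (\<eta> SumVar) (span_map (link_span G StockSumL) (ob G SumVar) s)"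
      by (rule span_map_transport[OF lF(3) lG(3) sfdsD(1)[OF F] sfdsD(1)[OF G] bij funs])
        (use links[of _ StockSumL] in simp_all)
    then show "phi F (pull (ob F Stock) (\<eta> Stock) s) (span_map (link_span F StockSumL) (ob F SumVar) (pull (ob F Stock) (\<eta> Stock) s))
        (pull (ob F Var) (\<eta> Var) (var_fix G a s)) (pull (ins X) (\<eta> InPort) a) = pull (ob F Var) (\<eta> Var) (var_fix G a s)"
      using sfd_isoD(4)[OF iso s span_map_in_RR v(1), of a] v(2) a by (simp add: sfdsD(2)[OF F] sfdsD(2)[OF G])
  qed simp_all
  have out: "span_map (link_span F OutL) (outs X) (pull (ob F Var) (\<eta> Var) v) =
      pull (outs X) (\<eta> OutPort) (span_map (link_span G OutL) (outs X') v)" for v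
    by (rule span_map_transport[OF lF(6) lG(6) sfdsD(1)[OF F] sfdsD(1)[OF G] bij])
      (use links[of _ OutL] funs[of OutPort] in \<open>simp_all add: sfdsD(3)[OF F] sfdsD(3)[OF G]\<close>)
  have sub: "vsub (ob F Stock) (pull (ob F Stock) (\<eta> Stock) x) (pull (ob F Stock) (\<eta> Stock) y) =
      pull (ob F Stock) (\<eta> Stock) (vsub (ob G Stock) x y)" for x y
    by (rule RR_ext[of _ "ob F Stock"]) (use funs[of Stock] in \<open>simp_all add: Pi_iff\<close>)
  show ?thesis
    unfolding mealy_iso_def using bij[of Stock]
    by (simp add: fix' flow_iso[OF F iso] sub out sfdsD(3)[OF F] sfdsD(3)[OF G])
qed

lemma mealy_of_sfd_cong:
  assumes "(F, G) \<in> sfd_rel X"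
  shows "(mealy_of_sfd F, mealy_of_sfd G) \<in> mealy_rel X"
proof -
  obtain \<eta> where F: "F \<in> sfds X" and G: "G \<in> sfds X" and iso: "sfd_iso \<eta> F G"
    and port: "\<And>p. p \<in> ins X \<Longrightarrow> \<eta> InPort p = p" "\<And>p. p \<in> outs X \<Longrightarrow> \<eta> OutPort p = p"
    using assms by (rule sfd_relE) blast
  have "pull (ins X) (\<eta> InPort) = pull (ins X) id" "pull (outs X) (\<eta> OutPort) = pull (outs X) id"
    using port by (auto simp: fun_eq_iff pull_def)
  then have "mealy_iso id id (\<eta> Stock) X X (mealy_of_sfd F) (mealy_of_sfd G)"
    using mealy_of_sfd_iso[OF F G iso] by (simp add: mealy_iso_def)
  then show ?thesis using mealy_of_sfd_mealys[OF F] mealy_of_sfd_mealys[OF G] by (auto simp: mealy_rel_iff)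
qed

lemma flow_act: "flow_in (sfd_act X Y f F) v = flow_in F v" "flow_out (sfd_act X Y f F) v = flow_out F v"
  by (simp_all add: flow_in_def flow_out_def)

text \<open>Naturality on representatives; here the two machines even have the same state set and equal
  functions.  The equation for \<open>v\<close> is the equation of \<open>F\<close> at \<open>p\<close>, so by uniqueness \<open>v\<close> is the
  solution of \<open>F\<close> at \<open>p\<close>, and \<open>(p, q)\<close> is the fixed point for the action of \<open>f\<close>.\<close>

lemma mealy_of_sfd_natural:
  assumes f: "dwiring X Y f" and F: "F \<in> sfds X"
  shows "(mealy_of_sfd (sfd_act X Y f F), mealy_act X Y f (mealy_of_sfd F)) \<in> mealy_rel Y"
proof (rule mealy_rel_sameI)
  let ?G = "sfd_act X Y f F"
  have G: "?G \<in> sfds Y" by (rule sfd_act_sfds[OF f F])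
  show "mealy_of_sfd ?G \<in> mealys Y" by (rule mealy_of_sfd_mealys[OF G])
  show "mealy_act X Y f (mealy_of_sfd F) \<in> mealys Y" by (rule mealy_act_mealys[OF f mealy_of_sfd_mealys[OF F]])
  note w = dwiring_span[OF f] and l = sfds_span[OF F] and fin = dwiring_finite(1,2)[OF f]
  fix y s assume y: "y \<in> RR (ins Y)" and "s \<in> RR (states (mealy_of_sfd ?G))"
  then have s: "s \<in> RR (ob F Stock)" "s \<in> RR (ob ?G Stock)" "s \<in> RR (states (mealy_of_sfd F))" by simp_all
  define v where "v = var_fix ?G y s"
  define q where "q = span_map (link_span F OutL) (outs X) v"
  \<comment> \<open>What the in ports of the original diagram receive: outer input plus traced outputs.\<close>
  define p where "p = vadd (ins X) (span_map (win f) (ins X) y) (span_map (wtr f) (ins X) q)"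
  have "v \<in> RR (ob F Var)" "phi F s (span_map (link_span F StockSumL) (ob F SumVar) s) v p = v"
    using var_fix[OF G y s(2)] by (simp_all add: v_def p_def q_def)
  then have v: "var_fix F p s = v" by (intro var_fix_eqI[OF F _ s(1)]) (simp_all add: p_def)
  have fixp: "mealy_fix X f (mealy_of_sfd F) (span_map (win f) (ins X) y) s = (p, q)"
  proof (rule mealy_fix_eqI[OF f mealy_of_sfd_mealys[OF F] span_map_in_RR s(3)])
    show "p \<in> RR (ins X)" by (simp add: p_def)
    show "p = vadd (ins X) (span_map (wtr f) (ins X) q) (span_map (win f) (ins X) y)"
      unfolding p_def by (rule RR_ext[of _ "ins X"]) simp_all
    show "q = rdt (mealy_of_sfd F) p s" by (simp add: v q_def sfdsD(3)[OF F])
  qed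
  have "span_map (act_out_links f F) (outs Y) v = span_map (wout f) (outs Y) q"
    unfolding act_out_links_def q_def using fin sfdsD(1)[OF F] by (simp add: span_map_comp[OF l(6) w(3)])
  then show "upd (mealy_of_sfd ?G) y s = upd (mealy_act X Y f (mealy_of_sfd F)) y s \<and>
    rdt (mealy_of_sfd ?G) y s = rdt (mealy_act X Y f (mealy_of_sfd F)) y s"
    by (simp add: fixp flow_act v v_def[symmetric])
qed simp

lemma push_umap: 
  "push (usum A A') (usum B B') (umap f f') (vjoin A A' x y) = vjoin B B' (push A B f x) (push A' B' f' y)"
proof (rule RR_ext[of _ "usum B B'"])
  fix z assume "z \<in> usum B B'"
  then show "push (usum A A') (usum B B') (umap f f') (vjoin A A' x y) z = vjoin B B' (push A B f x) (push A' B' f' y) z"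
  proof (cases rule: usumE)
    case (1 b)
    have "{a. a \<in> usum A A' \<and> umap f f' a = In1 b} = In1 ` {a. a \<in> A \<and> f a = b}" by (auto elim!: usumE)
    then show ?thesis using 1 by (simp add: push_def sum.reindex)
  next
    case (2 b)
    have "{a. a \<in> usum A A' \<and> umap f f' a = In2 b} = In2 ` {a. a \<in> A' \<and> f' a = b}" by (auto elim!: usumE)
    then show ?thesis using 2 by (simp add: push_def sum.reindex)
  qed
qed simp_all

lemma flow_par:
  assumes F: "F \<in> sfds X" and G: "G \<in> sfds Y"
  shows "flow_in (sfd_par F G) (vjoin (ob F Var) (ob G Var) v w) = vjoin (ob F Stock) (ob G Stock) (flow_in F v) (flow_in G w)"
    "flow_out (sfd_par F G) (vjoin (ob F Var) (ob G Var) v w) = vjoin (ob F Stock) (ob G Stock) (flow_out F v) (flow_out G w)"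
  using sfds_arrow[OF F] sfds_arrow[OF G] by (simp_all add: flow_in_def flow_out_def pull_umap(3) push_umap)

lemma vjoin_vsub: "vsub (usum A B) (vjoin A B x y) (vjoin A B x' y') = vjoin A B (vsub A x x') (vsub B y y')"
  by (rule RR_ext[of _ "usum A B"]) (auto elim!: usumE)

text \<open>The equations of a disjoint union decouple.\<close>

lemma mealy_of_sfd_par:
  assumes F: "F \<in> sfds X" and G: "G \<in> sfds Y"
  shows "(mealy_of_sfd (sfd_par F G), mealy_par X Y (mealy_of_sfd F) (mealy_of_sfd G)) \<in> mealy_rel (dtensor X Y)"
proof (rule mealy_rel_sameI)
  let ?H = "sfd_par F G"
  have H: "?H \<in> sfds (dtensor X Y)" by (rule sfd_par_sfds[OF F G])
  show "mealy_of_sfd ?H \<in> mealys (dtensor X Y)" by (rule mealy_of_sfd_mealys[OF H])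
  show "mealy_par X Y (mealy_of_sfd F) (mealy_of_sfd G) \<in> mealys (dtensor X Y)"
    by (rule mealy_par_mealys[OF mealy_of_sfd_mealys[OF F] mealy_of_sfd_mealys[OF G]])
  note lF = sfds_span[OF F] and lG = sfds_span[OF G] and finF = sfdsD(1)[OF F] and finG = sfdsD(1)[OF G]
  fix a s assume a: "a \<in> RR (ins (dtensor X Y))" and "s \<in> RR (states (mealy_of_sfd ?H))"
  then have s: "s \<in> RR (ob ?H Stock)" by simp
  define v where "v = var_fix F (pull (ins X) In1 a) (pull (ob F Stock) In1 s)"
  define w where "w = var_fix G (pull (ins Y) In2 a) (pull (ob G Stock) In2 s)"
  note v = var_fix[OF F pull_in_RR[of "ins X" In1 a] pull_in_RR[of "ob F Stock" In1 s], folded v_def]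
  note w = var_fix[OF G pull_in_RR[of "ins Y" In2 a] pull_in_RR[of "ob G Stock" In2 s], folded w_def]
  have "var_fix ?H a s = vjoin (ob F Var) (ob G Var) v w"
    by (rule var_fix_eqI[OF H a s])
      (simp_all add: v w span_map_par_vjoin[OF lF(3) lG(3) finF finG] sfdsD(2)[OF F] sfdsD(2)[OF G])
  then show "upd (mealy_of_sfd ?H) a s = upd (mealy_par X Y (mealy_of_sfd F) (mealy_of_sfd G)) a s \<and>
     rdt (mealy_of_sfd ?H) a s = rdt (mealy_par X Y (mealy_of_sfd F) (mealy_of_sfd G)) a s"
    using v(1) w(1)
    by (simp add: v_def[symmetric] w_def[symmetric] flow_par[OF F G] vjoin_vsub sfdsD(3)[OF F] sfdsD(3)[OF G]
      span_map_par_vjoin[OF lF(6) lG(6) finF finG])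
qed simp

lemma mealy_of_sfd_empty: "(mealy_of_sfd sfd_empty, mealy_unit) \<in> mealy_rel dunit"
  by (rule mealy_rel_sameI[OF mealy_of_sfd_mealys[OF sfd_empty_sfds] mealy_unit_mealys])
    (auto intro: RR_ext[of _ "{}"])

lemma alpha_class:
  assumes "F \<in> sfds X"
  shows "alpha X (sf.cls X F) = mealy.cls X (mealy_of_sfd F)"
  unfolding alpha_def sf.cls_def mealy_class_cls
  by (rule UN_equiv_class_eq[OF equiv_sfd_rel assms]) (rule mealy.cls_eqI[OF mealy_of_sfd_cong, symmetric])

theorem theorem4p7:
  shows "monoidal_natural_transformation
    (dDWD :: ('a dbox, 'a darrow) moncat) SF Mealy alpha"
  unfolding SF_functor Mealy_functor
proof (intro monoidal_natural_transformation.intro sf.lax_monoidal mealy.lax_monoidal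
    monoidal_natural_transformation_axioms.intro)
  fix X :: "'a dbox"
  show "alpha X \<in> FObj sf.class_functor X \<rightarrow> FObj mealy.class_functor X"
    by (auto simp: alpha_class elim!: sf.FObjE intro!: mealy.FObjI mealy_of_sfd_mealys)
next
  fix X Y :: "'a dbox" and f D assume "f \<in> hom dDWD X Y" "D \<in> FObj sf.class_functor X"
  then obtain u F where "dwiring X Y u" "f = arrow X Y u" "F \<in> sfds X" "D = sf.cls X F"
    by (auto simp: in_hom_dDWD elim: sf.FObjE)
  then show "alpha Y (FArr sf.class_functor f D) = FArr mealy.class_functor f (alpha X D)"
    by (simp add: sf.act_class alpha_class sfd_act_sfds mealy.act_class mealy_of_sfd_mealys
      mealy.cls_eqI[OF mealy_of_sfd_natural])
next
  fix X Y :: "'a dbox" and D E assume "D \<in> FObj sf.class_functor X" "E \<in> FObj sf.class_functor Y"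
  then obtain F G where "F \<in> sfds X" "D = sf.cls X F" "G \<in> sfds Y" "E = sf.cls Y G"
    by (auto elim!: sf.FObjE)
  then show "alpha (TensorO dDWD X Y) (Laxator sf.class_functor X Y (D, E)) = Laxator mealy.class_functor X Y (alpha X D, alpha Y E)"
    by (simp add: sf.par_class alpha_class sfd_par_sfds mealy.par_class mealy_of_sfd_mealys
      mealy.cls_eqI[OF mealy_of_sfd_par])
next
  show "alpha (UnitO (dDWD :: ('a dbox, 'a darrow) moncat)) (LaxUnit sf.class_functor) = LaxUnit mealy.class_functor"
    by (simp add: sf.LaxUnit mealy.LaxUnit alpha_class sfd_empty_sfds mealy.cls_eqI[OF mealy_of_sfd_empty])
qed


end
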